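(* Let $X$ be a complex Banach space, let $A:\operatorname{dom}(A)\subseteq X\to X$ and $B:\operatorname{dom}(B)\subseteq X\to X$ be closed linear operators with $\rho(B)\neq\emptyset$, and let $Y$ be a Banach space continuously embedded in $X$ such that $\operatorname{dom}(A)\subseteq\operatorname{dom}(B^2)\cap Y$, $B(\operatorname{dom}(A))\subseteq Y\subseteq\operatorname{dom}(B)$, and the operator $G=\begin{bmatrix}-B & I \\ A+B^2 & -B\end{bmatrix}$ with domain $\operatorname{dom}(A)\times Y$ generates a $C_0$-group $\{\mathcal T(t)\}_{t\in\mathbb R}$ on $Y\times X$. Consider the problem $$(\ast)\qquad u''(t)+2Bu'(t)-Au(t)=f(t),\ t\in\mathbb R,\qquad u(0)=x,\ u'(0)=y,$$ and the function $$(\ast\ast)\qquad u(t)=C_{A,B}(t)x+S_{A,B}(t)y+\int_0^tS_{A,B}(t-s)f(s)\,ds,\quad t\in\mathbb R.$$ Then: (i) If $x\in\operatorname{dom}(A)$, $y\in Y$, $f\in\mathcal C^1(\mathbb R,X)$, then the function $u$ in $(\ast\ast)$ belongs to $\mathcal C^2(\mathbb R,X)\cap\mathcal C^1(\mathbb R,Y)\cap\mathcal C(\mathbb R,\operatorname{dom}(A))$ and is the unique classical solution of $(\ast)$. (ii) If $x\in\operatorname{dom}(A)$, $y\in Y$, $f\in\mathcal C(\mathbb R,Y)$, then the function $u$ in $(\ast\ast)$ belongs to $\mathcal C^2(\mathbb R,X)\cap\mathcal C^1(\mathbb R,Y)\cap\mathcal C(\mathbb R,\operatorname{dom}(A))$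 and is the unique classical solution of $(\ast)$. (iii) If $x\in\operatorname{dom}(B)$, $y\in X$, $f\in\mathcal M_{-\nu}(\mathbb R,X)$, then the function $u$ in $(\ast\ast)$ is the unique Laplace Transform mild solution of $(\ast)$. (iv) If $x\in\operatorname{dom}(B)$, $y\in X$, $f\in L^1_{\mathrm{loc}}(\mathbb R,X)$, then the function $u$ in $(\ast\ast)$ is the unique integral mild solution of $(\ast)$.
   Context: Domains of closed operators carry the graph norm. Write $\mathcal T(t)=\begin{bmatrix}T_{11}(t) & T_{12}(t) \\ T_{21}(t) & T_{22}(t)\end{bmatrix}$ in block form with respect to $Y\times X$, and fix $M,\omega$ with $\|\mathcal T(t)\|_{\mathcal B(Y\times X)}\le Me^{\omega|t|}$ for all $t\in\mathbb R$. The generalized cosine and sine families are $C_{A,B}(t)x=T_{22}(t)x-BT_{12}(t)x+2T_{12}(t)Bx$ for $x\in\operatorname{dom}(B)$ and $S_{A,B}(t)x=T_{12}(t)x$ for $x\in X$. Notation: $Q(\lambda)=\lambda^2I+2\lambda B-A$ on $\operatorname{dom}(A)$; $\mathbb C^+_a=\{\lambda\in\mathbb C:\operatorname{Re}\lambda>a\}$; $(\mathcal Lf)(\lambda)=\int_0^\infty e^{-\lambda t}f(t)\,dt$; $u(-\cdot)$ is $t\mapsto u(-t)$; $\mathcal M_{-\nu}(\mathbb R,X)$ (resp. $\mathcal C_{-\nu}(\mathbb R,X)$) is the set of (strongly) measurable (resp. continuous) $f:\mathbb R\to X$ with $\sup_{t\in\mathbb R}e^{-\nu|t|}\|f(t)\|<\infty$.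 Solution concepts for $(\ast)$: (a) If $f\in\mathcal C(\mathbb R,X)$, a classical solution is $u\in\mathcal C^2(\mathbb R,X)$ with $u(t)\in\operatorname{dom}(A)$, $u'(t)\in\operatorname{dom}(B)$ for all $t$, $Au(\cdot)\in\mathcal C(\mathbb R,X)$, satisfying $(\ast)$. (b) If $f\in\mathcal M_{-\nu}(\mathbb R,X)$, a Laplace Transform mild solution is a function $u\in\mathcal C_{-\nu}(\mathbb R,X)$ (with the same $\nu$ as for $f$) such that for every $\lambda\in\mathbb C^+_{\max\{\nu,\omega\}}$ one has $(\mathcal Lu)(\lambda),(\mathcal Lu(-\cdot))(\lambda)\in\operatorname{dom}(A)$ and $$Q(\lambda)(\mathcal Lu)(\lambda)=\lambda x+2Bx+y+(\mathcal Lf)(\lambda),\quad Q(-\lambda)(\mathcal Lu(-\cdot))(\lambda)=\lambda x-2Bx-y+(\mathcal Lf(-\cdot))(\lambda).$$ (c) If $f\in L^1_{\mathrm{loc}}(\mathbb R,X)$, an integral mild solution is $u\in\mathcal C(\mathbb R,X)$ such that for all $t$: $\int_0^tu(s)\,ds\in\operatorname{dom}(B)$, $\int_0^t(t-s)u(s)\,ds\in\operatorname{dom}(A)$; the maps $t\mapsto B\int_0^tu(s)\,ds$ and $t\mapsto A\int_0^t(t-s)u(s)\,ds$ are in $\mathcal C(\mathbb R,X)$; and $$u(t)+2B\int_0^tu(s)\,ds=A\int_0^t(t-s)u(s)\,ds+x+t(y+2Bx)+\int_0^t(t-s)f(s)\,ds\quad\text{for all }t\in\mathbb R.$$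
   Formalization: In (iii), existence is claimed with exponent ν only if ν > ω; for ν ≤ ω it is claimed with every exponent μ > ω instead, since u need not lie in C_{-ν} (X=Y=ℂ, B=0, A=1, f=0, ν=0, x=1, y=0 gives u = cosh). Uniqueness is kept for every ν. *)

theory Defs
  imports "HOL-Analysis.Analysis"
begin

class complex_normed_vector = real_normed_vector +
  fixes scaleC :: "complex \<Rightarrow> 'a \<Rightarrow> 'a"  (infixr "*\<^sub>C" 75)
  assumes scaleC_add_right: "c *\<^sub>C (x + y) = c *\<^sub>C x + c *\<^sub>C y"
    and scaleC_add_left: "(c + d) *\<^sub>C x = c *\<^sub>C x + d *\<^sub>C x"
    and scaleC_scaleC: "c *\<^sub>C (d *\<^sub>C x) = (c * d) *\<^sub>C x"
    and scaleR_scaleC: "r *\<^sub>R x = complex_of_real r *\<^sub>C x"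
    and norm_scaleC: "norm (c *\<^sub>C x) = cmod c * norm x"

class complex_banach = complex_normed_vector + banach

instantiation prod :: (complex_normed_vector, complex_normed_vector) complex_normed_vector
begin

definition scaleC_prod_def: "c *\<^sub>C p = (c *\<^sub>C fst p, c *\<^sub>C snd p)"

instance
proof
  fix c d :: complex and r :: real and x y :: "'a \<times> 'b"
  show "c *\<^sub>C (x + y) = c *\<^sub>C x + c *\<^sub>C y"
    by (simp add: scaleC_prod_def scaleC_add_right)
  show "(c + d) *\<^sub>C x = c *\<^sub>C x + d *\<^sub>C x"
    by (simp add: scaleC_prod_def scaleC_add_left)
  show "c *\<^sub>C (d *\<^sub>C x) = (c * d) *\<^sub>C x"
    by (simp add: scaleC_prod_def scaleC_scaleC)
  show "r *\<^sub>R x = complex_of_real r *\<^sub>C x"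
    by (simp add: scaleC_prod_def scaleR_prod_def scaleR_scaleC)
  have "sqrt ((cmod c * a)\<^sup>2 + (cmod c * b)\<^sup>2) = cmod c * sqrt (a\<^sup>2 + b\<^sup>2)" for a b
    by (simp add: power_mult_distrib real_sqrt_mult flip: distrib_left)
  then show "norm (c *\<^sub>C x) = cmod c * norm x"
    by (simp add: scaleC_prod_def norm_prod_def norm_scaleC)
qed

end

instance prod :: (complex_banach, complex_banach) complex_banach ..

definition csubspace :: "'a::complex_normed_vector set \<Rightarrow> bool" where
  "csubspace D \<longleftrightarrow> 0 \<in> D \<and> (\<forall>x\<in>D. \<forall>y\<in>D. x + y \<in> D) \<and> (\<forall>c. \<forall>x\<in>D. c *\<^sub>C x \<in> D)"

definition bounded_clinear :: "('a::complex_normed_vector \<Rightarrow> 'b::complex_normed_vector) \<Rightarrow> bool" where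
  "bounded_clinear f \<longleftrightarrow> bounded_linear f \<and> (\<forall>c x. f (c *\<^sub>C x) = c *\<^sub>C f x)"

text \<open>
  An operator with domain \<open>D\<close> is given by \<open>D\<close> and a total function, of which only the
  values on \<open>D\<close> matter.
\<close>

definition closed_operator ::
  "'a::complex_normed_vector set \<Rightarrow> ('a \<Rightarrow> 'a) \<Rightarrow> bool" where
  "closed_operator D T \<longleftrightarrow>
     csubspace D \<and>
     (\<forall>x\<in>D. \<forall>y\<in>D. T (x + y) = T x + T y) \<and>
     (\<forall>c. \<forall>x\<in>D. T (c *\<^sub>C x) = c *\<^sub>C T x) \<and>
     closed {(x, T x) | x. x \<in> D}"

definition resolvent_set ::
  "'a::complex_normed_vector set \<Rightarrow> ('a \<Rightarrow> 'a) \<Rightarrow> complex set" where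
  "resolvent_set D T =
     {z. \<exists>R. bounded_clinear R \<and>
             (\<forall>x. R x \<in> D \<and> z *\<^sub>C R x - T (R x) = x) \<and>
             (\<forall>x\<in>D. R (z *\<^sub>C x - T x) = x)}"

definition graph_norm :: "('a::real_normed_vector \<Rightarrow> 'a) \<Rightarrow> 'a \<Rightarrow> real" where
  "graph_norm T x = norm x + norm (T x)"

definition C0_group :: "(real \<Rightarrow> 'a::complex_normed_vector \<Rightarrow> 'a) \<Rightarrow> bool" where
  "C0_group T \<longleftrightarrow>
     (\<forall>t. bounded_clinear (T t)) \<and>
     (\<forall>x. T 0 x = x) \<and>
     (\<forall>s t x. T (s + t) x = T s (T t x)) \<and>
     (\<forall>x. continuous_on UNIV (\<lambda>t. T t x))"

text \<open>
  The equivalence fixes the domain exactly: it is the set of all \<open>x\<close> at which the difference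
  quotient converges.
\<close>

definition generates_C0_group ::
  "'a::complex_normed_vector set \<Rightarrow> ('a \<Rightarrow> 'a) \<Rightarrow> (real \<Rightarrow> 'a \<Rightarrow> 'a) \<Rightarrow> bool" where
  "generates_C0_group D G T \<longleftrightarrow>
     C0_group T \<and>
     (\<forall>x z. x \<in> D \<and> G x = z \<longleftrightarrow> ((\<lambda>h. (T h x - x) /\<^sub>R h) \<longlongrightarrow> z) (at 0))"

text \<open>
  The space \<open>Y\<close> is a type \<open>'y\<close> together with an injective bounded linear map \<open>j\<close> into
  \<open>X\<close>; as a subset of \<open>X\<close> it is \<open>range j\<close>. The product \<open>Y \<times> X\<close> carries the Euclidean
  combination of the two norms.
\<close>

definition continuous_embedding ::
  "('y::complex_normed_vector \<Rightarrow> 'x::complex_normed_vector) \<Rightarrow> bool" where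
  "continuous_embedding j \<longleftrightarrow> bounded_clinear j \<and> inj j"

definition dom_square :: "'x set \<Rightarrow> ('x \<Rightarrow> 'x) \<Rightarrow> 'x set" where
  "dom_square D T = {x \<in> D. T x \<in> D}"

definition domG :: "('y \<Rightarrow> 'x) \<Rightarrow> 'x set \<Rightarrow> ('y \<times> 'x) set" where
  "domG j domA = {(v, w). j v \<in> domA \<and> w \<in> range j}"

text \<open>On \<open>domG j domA\<close> the argument of \<open>inv j\<close> lies in \<open>range j\<close>.\<close>

definition opG ::
  "('y \<Rightarrow> 'x::real_vector) \<Rightarrow> ('x \<Rightarrow> 'x) \<Rightarrow> ('x \<Rightarrow> 'x) \<Rightarrow> 'y \<times> 'x \<Rightarrow> 'y \<times> 'x" where
  "opG j A B = (\<lambda>(v, w).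
     (inv j (- B (j v) + w), A (j v) + B (B (j v)) - B w))"

definition T12 :: "(real \<Rightarrow> 'y::zero \<times> 'x \<Rightarrow> 'y \<times> 'x) \<Rightarrow> real \<Rightarrow> 'x \<Rightarrow> 'y" where
  "T12 T t x = fst (T t (0, x))"

definition T22 :: "(real \<Rightarrow> 'y::zero \<times> 'x \<Rightarrow> 'y \<times> 'x) \<Rightarrow> real \<Rightarrow> 'x \<Rightarrow> 'x" where
  "T22 T t x = snd (T t (0, x))"

definition gen_cos ::
  "('y::zero \<Rightarrow> 'x::real_vector) \<Rightarrow> ('x \<Rightarrow> 'x) \<Rightarrow> (real \<Rightarrow> 'y \<times> 'x \<Rightarrow> 'y \<times> 'x) \<Rightarrow>
   real \<Rightarrow> 'x \<Rightarrow> 'x" where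
  "gen_cos j B T t x = T22 T t x - B (j (T12 T t x)) + 2 *\<^sub>R j (T12 T t (B x))"

definition gen_sin ::
  "('y::zero \<Rightarrow> 'x) \<Rightarrow> (real \<Rightarrow> 'y \<times> 'x \<Rightarrow> 'y \<times> 'x) \<Rightarrow> real \<Rightarrow> 'x \<Rightarrow> 'x" where
  "gen_sin j T t x = j (T12 T t x)"

text \<open>
  The Bochner integral of the library needs a second countable target, so integrals of
  \<open>X\<close>-valued functions are Henstock--Kurzweil integrals here. They agree with the Bochner
  integrals whenever the integrand is strongly measurable with integrable norm.
\<close>

definition integral_from_0 :: "(real \<Rightarrow> 'a::real_normed_vector) \<Rightarrow> real \<Rightarrow> 'a" where
  "integral_from_0 g t = (if 0 \<le> t then integral {0..t} g else - integral {t..0} g)"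

definition laplace :: "(real \<Rightarrow> 'a::complex_normed_vector) \<Rightarrow> complex \<Rightarrow> 'a" where
  "laplace f z = integral {0..} (\<lambda>t. exp (- (z * complex_of_real t)) *\<^sub>C f t)"

definition strongly_measurable :: "(real \<Rightarrow> 'a::real_normed_vector) \<Rightarrow> bool" where
  "strongly_measurable f \<longleftrightarrow>
     (\<exists>s :: nat \<Rightarrow> real \<Rightarrow> 'a. (\<forall>n. simple_function lebesgue (s n)) \<and>
        (AE t in lebesgue. (\<lambda>n. s n t) \<longlonglongrightarrow> f t))"

definition L1_loc :: "(real \<Rightarrow> 'a::real_normed_vector) set" where
  "L1_loc = {f. strongly_measurable f \<and>
     (\<forall>a b. set_integrable lebesgue {a..b} (\<lambda>t. norm (f t)))}"

text \<open>\<open>M_exp \<nu>\<close> and \<open>C_exp \<nu>\<close> are the spaces usually written with index \<open>- \<nu>\<close>.\<close>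

definition M_exp :: "real \<Rightarrow> (real \<Rightarrow> 'a::real_normed_vector) set" where
  "M_exp \<nu> = {f. strongly_measurable f \<and>
     bdd_above (range (\<lambda>t. exp (- \<nu> * \<bar>t\<bar>) * norm (f t)))}"

definition C_exp :: "real \<Rightarrow> (real \<Rightarrow> 'a::real_normed_vector) set" where
  "C_exp \<nu> = {f. continuous_on UNIV f \<and>
     bdd_above (range (\<lambda>t. exp (- \<nu> * \<bar>t\<bar>) * norm (f t)))}"

abbreviation vderiv :: "(real \<Rightarrow> 'a::real_normed_vector) \<Rightarrow> real \<Rightarrow> 'a" where
  "vderiv u \<equiv> (\<lambda>t. vector_derivative u (at t))"

definition C0_fun :: "(real \<Rightarrow> 'a::real_normed_vector) set" where
  "C0_fun = {u. continuous_on UNIV u}"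

definition C1_fun :: "(real \<Rightarrow> 'a::real_normed_vector) set" where
  "C1_fun = {u. u C1_differentiable_on UNIV}"

definition C2_fun :: "(real \<Rightarrow> 'a::real_normed_vector) set" where
  "C2_fun = {u \<in> C1_fun. vderiv u \<in> C1_fun}"

definition C0_Y :: "('y::real_normed_vector \<Rightarrow> 'x) \<Rightarrow> (real \<Rightarrow> 'x) set" where
  "C0_Y j = {j \<circ> g | g. g \<in> C0_fun}"

definition C1_Y :: "('y::real_normed_vector \<Rightarrow> 'x) \<Rightarrow> (real \<Rightarrow> 'x) set" where
  "C1_Y j = {j \<circ> g | g. g \<in> C1_fun}"

definition C0_dom :: "'x::real_normed_vector set \<Rightarrow> ('x \<Rightarrow> 'x) \<Rightarrow> (real \<Rightarrow> 'x) set" where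
  "C0_dom D T = {u. (\<forall>t. u t \<in> D) \<and>
     (\<forall>t. ((\<lambda>s. graph_norm T (u s - u t)) \<longlongrightarrow> 0) (at t))}"

definition Qop ::
  "('x::complex_normed_vector \<Rightarrow> 'x) \<Rightarrow> ('x \<Rightarrow> 'x) \<Rightarrow> complex \<Rightarrow> 'x \<Rightarrow> 'x" where
  "Qop A B z v = z\<^sup>2 *\<^sub>C v + (2 * z) *\<^sub>C B v - A v"

definition sol_formula ::
  "('y::zero \<Rightarrow> 'x::real_normed_vector) \<Rightarrow> ('x \<Rightarrow> 'x) \<Rightarrow> (real \<Rightarrow> 'y \<times> 'x \<Rightarrow> 'y \<times> 'x) \<Rightarrow>
   (real \<Rightarrow> 'x) \<Rightarrow> 'x \<Rightarrow> 'x \<Rightarrow> real \<Rightarrow> 'x" where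
  "sol_formula j B T f x y = (\<lambda>t.
     gen_cos j B T t x + gen_sin j T t y +
     integral_from_0 (\<lambda>s. gen_sin j T (t - s) (f s)) t)"

definition classical_solution ::
  "'x::real_normed_vector set \<Rightarrow> ('x \<Rightarrow> 'x) \<Rightarrow> 'x set \<Rightarrow> ('x \<Rightarrow> 'x) \<Rightarrow>
   (real \<Rightarrow> 'x) \<Rightarrow> 'x \<Rightarrow> 'x \<Rightarrow> (real \<Rightarrow> 'x) \<Rightarrow> bool" where
  "classical_solution domA A domB B f x y u \<longleftrightarrow>
     u \<in> C2_fun \<and>
     (\<forall>t. u t \<in> domA) \<and> (\<forall>t. vderiv u t \<in> domB) \<and>
     (\<lambda>t. A (u t)) \<in> C0_fun \<and>
     (\<forall>t. vderiv (vderiv u) t + 2 *\<^sub>R B (vderiv u t) - A (u t) = f t) \<and>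
     u 0 = x \<and> vderiv u 0 = y"

text \<open>
  A pitfall: the formula solution grows like \<open>exp (\<omega> * \<bar>t\<bar>)\<close> in general, even for \<open>f = 0\<close>, so
  it can be guaranteed to lie in \<open>C_exp \<nu>\<close> only for \<open>\<nu> > \<omega>\<close>. For an \<open>f\<close> in \<open>M_exp \<nu>\<close> with
  \<open>\<nu> \<le> \<omega>\<close> one uses that \<open>f\<close> is in \<open>M_exp \<mu>\<close> for every \<open>\<mu> > \<omega>\<close>.
\<close>

definition LT_mild_solution ::
  "'x::complex_normed_vector set \<Rightarrow> ('x \<Rightarrow> 'x) \<Rightarrow> ('x \<Rightarrow> 'x) \<Rightarrow> real \<Rightarrow> real \<Rightarrow>
   (real \<Rightarrow> 'x) \<Rightarrow> 'x \<Rightarrow> 'x \<Rightarrow> (real \<Rightarrow> 'x) \<Rightarrow> bool" where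
  "LT_mild_solution domA A B \<omega> \<nu> f x y u \<longleftrightarrow>
     u \<in> C_exp \<nu> \<and>
     (\<forall>z. max \<nu> \<omega> < Re z \<longrightarrow>
        laplace u z \<in> domA \<and>
        laplace (\<lambda>t. u (- t)) z \<in> domA \<and>
        Qop A B z (laplace u z) = z *\<^sub>C x + 2 *\<^sub>R B x + y + laplace f z \<and>
        Qop A B (- z) (laplace (\<lambda>t. u (- t)) z) =
          z *\<^sub>C x - 2 *\<^sub>R B x - y + laplace (\<lambda>t. f (- t)) z)"

definition integral_mild_solution ::
  "'x::real_normed_vector set \<Rightarrow> ('x \<Rightarrow> 'x) \<Rightarrow> 'x set \<Rightarrow> ('x \<Rightarrow> 'x) \<Rightarrow>
   (real \<Rightarrow> 'x) \<Rightarrow> 'x \<Rightarrow> 'x \<Rightarrow> (real \<Rightarrow> 'x) \<Rightarrow> bool" where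
  "integral_mild_solution domA A domB B f x y u \<longleftrightarrow>
     u \<in> C0_fun \<and>
     (\<forall>t. integral_from_0 u t \<in> domB) \<and>
     (\<forall>t. integral_from_0 (\<lambda>s. (t - s) *\<^sub>R u s) t \<in> domA) \<and>
     (\<lambda>t. B (integral_from_0 u t)) \<in> C0_fun \<and>
     (\<lambda>t. A (integral_from_0 (\<lambda>s. (t - s) *\<^sub>R u s) t)) \<in> C0_fun \<and>
     (\<forall>t. u t + 2 *\<^sub>R B (integral_from_0 u t) =
          A (integral_from_0 (\<lambda>s. (t - s) *\<^sub>R u s) t) + x + t *\<^sub>R (y + 2 *\<^sub>R B x) +
          integral_from_0 (\<lambda>s. (t - s) *\<^sub>R f s) t)"

definition is_the_unique :: "('a \<Rightarrow> bool) \<Rightarrow> 'a \<Rightarrow> bool" where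
  "is_the_unique P u \<longleftrightarrow> P u \<and> (\<forall>w. P w \<longrightarrow> w = u)"

end

theory Submission
  imports Defs
begin

text \<open>
  With \<open>v = u\<close> and \<open>w = u' + B u\<close> the problem becomes the first order system
  \<open>U' = G U + (0, f)\<close> for \<open>U = (v, w)\<close> on \<open>Y \<times> X\<close>. Its mild solution
  \<open>U(t) = T(t) p + \<integral>\<^sub>0\<^sup>t T(t - s) (0, f(s)) ds\<close> satisfies
  \<open>G \<integral>\<^sub>0\<^sup>t U = U(t) - p - \<integral>\<^sub>0\<^sup>t (0, f)\<close>; read componentwise, integrated once more or
  multiplied by \<open>exp (- \<lambda> t)\<close>, this relation yields the integral and the Laplace transform form of
  the second order equation. For \<open>x\<close> in \<open>dom B\<close> only, the term \<open>C\<^sub>A\<^sub>,\<^sub>B(t) x\<close> is split into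
  \<open>2 T\<^sub>1\<^sub>2(t) B x\<close> and the part \<open>T\<^sub>2\<^sub>2(t) x - B T\<^sub>1\<^sub>2(t) x\<close>, whose integral is
  \<open>T\<^sub>1\<^sub>2(t) x\<close>. Uniqueness: the difference of two integral mild solutions, integrated three times,
  gives a classical solution of \<open>U' = G U\<close>, \<open>U(0) = 0\<close>; for Laplace transforms, \<open>Q(\<lambda>)\<close> is
  injective since \<open>G\<close> has no eigenvalue \<open>\<lambda>\<close> with \<open>\<bar>Re \<lambda>\<bar> > \<omega>\<close>, and the Laplace transform is
  injective on continuous functions.
\<close>

section \<open>Signed Henstock--Kurzweil integrals\<close>

text \<open>All integrals are Henstock-Kurzweil integrals in arbitrary Banach spaces, and this
  shapes the proof. Two devices carry it. A closed linear relation that holds pointwise passes to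
  integrals, because Riemann sums stay in a closed subspace; therefore generators and closed
  operators are handled through their graphs. Interchanging two integrals is replaced by integration
  by parts against a strongly continuous operator family, shown for continuous data and extended by
  approximation in mean to a class that contains \<open>L1_loc\<close>.

  Two estimates that the hypotheses do not list come from the closed graph theorem:
  \<open>B \<circ> j\<close> is bounded from Y to X, and dom(A) with its graph norm embeds boundedly
  into Y. They transport continuity between the three topologies involved.

  Negative times cost nothing extra: the signed integral from 0 covers both half lines, and the
  transform of a reflected function is a limit at minus infinity with parameter \<open>- z\<close>.
  The relevant lemmas leave the limit filter open and are used once with \<open>at_top\<close> and
  once with \<open>at_bot\<close>.\<close>

abbreviation int0 :: "(real \<Rightarrow> 'a::real_normed_vector) \<Rightarrow> real \<Rightarrow> 'a" where
  "int0 \<equiv> integral_from_0"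

definition locally_integrable :: "(real \<Rightarrow> 'a::real_normed_vector) \<Rightarrow> bool" where
  "locally_integrable f \<longleftrightarrow> (\<forall>a b. f integrable_on {a..b})"

lemma locally_integrableD: "locally_integrable f \<Longrightarrow> f integrable_on {a..b}"
  by (simp add: locally_integrable_def)

lemma locally_integrable_continuous:
  fixes f :: "real \<Rightarrow> 'a::banach"
  shows "continuous_on UNIV f \<Longrightarrow> locally_integrable f"
  unfolding locally_integrable_def
  by (meson continuous_on_subset integrable_continuous_real subset_UNIV)

lemma locally_integrable_linear:
  assumes "bounded_linear L" "locally_integrable f"
  shows "locally_integrable (\<lambda>s. L (f s))"
  using assms integrable_linear[of f _ L] by (auto simp: locally_integrable_def o_def)

lemma locally_integrable_add:
  "locally_integrable f \<Longrightarrow> locally_integrable g \<Longrightarrow> locally_integrable (\<lambda>s. f s + g s)"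
  by (auto simp: locally_integrable_def intro: integrable_add)

lemma locally_integrable_diff:
  "locally_integrable f \<Longrightarrow> locally_integrable g \<Longrightarrow> locally_integrable (\<lambda>s. f s - g s)"
  by (auto simp: locally_integrable_def intro: integrable_diff)

lemma int0_0 [simp]: "int0 g 0 = 0"
  by (simp add: integral_from_0_def)

text \<open>Moving the base point from 0 to \<open>- N\<close> describes the signed integral on the
  whole of [-N, N] by a single indefinite integral. Continuity and differentiability at 0 then need
  no distinction of signs.\<close>

lemma int0_shift:
  fixes g :: "real \<Rightarrow> 'a::banach"
  assumes g: "locally_integrable g" and N: "\<bar>t\<bar> \<le> N"
  shows "int0 g t = integral {- N..t} g - integral {- N..0} g"
proof (cases "0 \<le> t")
  case True
  have "integral {- N..0} g + integral {0..t} g = integral {- N..t} g"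
    by (rule Henstock_Kurzweil_Integration.integral_combine) (use True N g in \<open>auto simp: locally_integrable_def\<close>)
  then show ?thesis
    using True by (simp add: integral_from_0_def algebra_simps)
next
  case False
  have "integral {- N..t} g + integral {t..0} g = integral {- N..0} g"
    by (rule Henstock_Kurzweil_Integration.integral_combine) (use False N g in \<open>auto simp: locally_integrable_def\<close>)
  then show ?thesis
    using False by (simp add: integral_from_0_def algebra_simps)
qed

lemma continuous_int0:
  fixes g :: "real \<Rightarrow> 'a::banach"
  assumes g: "locally_integrable g"
  shows "continuous_on UNIV (int0 g)"
proof -
  have "isCont (int0 g) t" for t
  proof -
    define N where "N = \<bar>t\<bar> + 1"
    have "continuous_on {- N..N} (\<lambda>u. integral {- N..u} g - integral {- N..0} g)"
      by (intro continuous_intros indefinite_integral_continuous_1 locally_integrableD[OF g])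
    moreover have "int0 g u = integral {- N..u} g - integral {- N..0} g" if "u \<in> {- N..N}" for u
      using int0_shift[OF g, of u N] that by auto
    ultimately have "continuous_on {- N..N} (int0 g)"
      by (metis (no_types, lifting) continuous_on_cong)
    then have "continuous_on {- N<..<N} (int0 g)"
      by (rule continuous_on_subset) auto
    moreover have "t \<in> {- N<..<N}"
      by (auto simp: N_def)
    ultimately show ?thesis
      by (simp add: continuous_on_eq_continuous_at)
  qed
  then show ?thesis
    by (simp add: continuous_at_imp_continuous_on)
qed

lemma int0_has_vector_derivative:
  fixes g :: "real \<Rightarrow> 'a::banach"
  assumes g: "continuous_on UNIV g"
  shows "(int0 g has_vector_derivative g t) (at t)"
proof -
  define N where "N = \<bar>t\<bar> + 1"
  have t: "t \<in> {- N<..<N}"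
    by (auto simp: N_def)
  have c: "continuous_on {- N..N} g"
    by (rule continuous_on_subset[OF g]) simp
  have "((\<lambda>u. integral {- N..u} g) has_vector_derivative g t) (at t within {- N..N})"
    by (rule integral_has_vector_derivative[OF c]) (use t in simp)
  moreover have "at t within {- N..N} = at t"
    by (rule at_within_interior) (use t in simp)
  ultimately have "((\<lambda>u. integral {- N..u} g) has_vector_derivative g t) (at t)"
    by simp
  then have "((\<lambda>u. integral {- N..u} g - integral {- N..0} g) has_vector_derivative g t) (at t)"
    by (simp only: has_vector_derivative_diff_const)
  then show ?thesis
  proof (rule has_vector_derivative_transform_within_open[OF _ open_greaterThanLessThan t])
    show "integral {- N..u} g - integral {- N..0} g = int0 g u" if "u \<in> {- N<..<N}" for u
      by (rule int0_shift[symmetric, OF locally_integrable_continuous[OF g]]) (use that in \<open>simp add: abs_le_iff\<close>)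
  qed
qed

lemma int0_vector_derivative:
  fixes G :: "real \<Rightarrow> 'a::banach"
  assumes G: "\<And>t. (G has_vector_derivative g t) (at t)"
  shows "int0 g t = G t - G 0"
proof -
  have "integral {a..b} g = G b - G a" if "a \<le> b" for a b
    by (rule integral_unique, rule fundamental_theorem_of_calculus)
      (rule that, rule has_vector_derivative_at_within[OF G])
  then show ?thesis
    by (simp add: integral_from_0_def)
qed

lemma int0_linear:
  assumes L: "bounded_linear L" and f: "locally_integrable f"
  shows "int0 (\<lambda>s. L (f s)) t = L (int0 f t)"
proof -
  have "integral {a..b} (\<lambda>s. L (f s)) = L (integral {a..b} f)" for a b
    using integral_linear[OF locally_integrableD[OF f] L] by (simp add: o_def)
  then show ?thesis
    using linear_neg[OF bounded_linear.linear[OF L]] by (simp add: integral_from_0_def)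
qed

lemma int0_add:
  "locally_integrable f \<Longrightarrow> locally_integrable g \<Longrightarrow> int0 (\<lambda>s. f s + g s) t = int0 f t + int0 g t"
  by (simp add: integral_from_0_def locally_integrable_def Henstock_Kurzweil_Integration.integral_add)

lemma int0_diff:
  "locally_integrable f \<Longrightarrow> locally_integrable g \<Longrightarrow> int0 (\<lambda>s. f s - g s) t = int0 f t - int0 g t"
  by (simp add: integral_from_0_def locally_integrable_def Henstock_Kurzweil_Integration.integral_diff)

lemma int0_reflect:
  fixes g :: "real \<Rightarrow> 'a::banach"
  shows "int0 (\<lambda>s. g (- s)) t = - int0 g (- t)"
  using Henstock_Kurzweil_Integration.integral_reflect_real[of 0 "-t" g]
    Henstock_Kurzweil_Integration.integral_reflect_real[of "-t" 0 g]
  by (cases "t = 0") (auto simp: integral_from_0_def)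

text \<open>Coarse on purpose: the bound is the same for all t in [-N, N], which is what error
  estimates for approximations need.\<close>

lemma norm_int0_le:
  fixes g :: "real \<Rightarrow> 'a::banach"
  assumes g: "locally_integrable g" and h: "h integrable_on {- N..N}"
    and t: "\<bar>t\<bar> \<le> N" and le: "\<And>s. \<bar>s\<bar> \<le> N \<Longrightarrow> norm (g s) \<le> h s"
  shows "norm (int0 g t) \<le> integral {- N..N} h"
proof -
  have *: "norm (integral {a..b} g) \<le> integral {- N..N} h" if "{a..b} \<subseteq> {- N..N}" for a b
  proof -
    have hab: "h integrable_on {a..b}"
      using h that integrable_on_subinterval by blast
    have "norm (integral {a..b} g) \<le> integral {a..b} h"
      by (rule integral_norm_bound_integral[OF locally_integrableD[OF g] hab])
        (use that in \<open>auto intro!: le\<close>)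
    also have "\<dots> \<le> integral {- N..N} h"
      by (rule integral_subset_le[OF that hab h]) (auto intro!: order_trans[OF norm_ge_zero le])
    finally show ?thesis .
  qed
  show ?thesis
    using *[of 0 t] *[of t 0] t by (auto simp: integral_from_0_def abs_le_iff)
qed

text \<open>Riemann sums of a function with values in a subspace stay in the subspace.\<close>

lemma integral_in_closed_subspace:
  fixes f :: "real \<Rightarrow> 'a::real_normed_vector"
  assumes f: "f integrable_on {a..b}" and S: "subspace S" "closed S"
    and fS: "\<And>s. s \<in> {a..b} \<Longrightarrow> f s \<in> S"
  shows "integral {a..b} f \<in> S"
proof -
  have "\<exists>y\<in>S. dist y (integral {a..b} f) < e" if "e > 0" for e
  proof -
    have "(f has_integral integral {a..b} f) (cbox a b)"
      using f by (simp add: has_integral_integral)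
    then obtain \<gamma> where \<gamma>: "gauge \<gamma>"
      and sum: "\<And>D. D tagged_division_of cbox a b \<Longrightarrow> \<gamma> fine D \<Longrightarrow>
        norm ((\<Sum>(x,K)\<in>D. measure lborel K *\<^sub>R f x) - integral {a..b} f) < e"
      by (rule has_integralD[OF _ \<open>e > 0\<close>]) (rule that)
    obtain D where D: "D tagged_division_of cbox a b" "\<gamma> fine D"
      using fine_division_exists[OF \<gamma>] by blast
    have "(\<Sum>(x,K)\<in>D. measure lborel K *\<^sub>R f x) \<in> S"
    proof (rule subspace_sum[OF S(1)])
      fix p assume p: "p \<in> D"
      then obtain x K where [simp]: "p = (x, K)" by (cases p)
      have "x \<in> {a..b}"
        using tagged_division_ofD(2,3)[OF D(1), of x K] p by auto
      then show "(case p of (x,K) \<Rightarrow> measure lborel K *\<^sub>R f x) \<in> S"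
        using fS subspace_scale[OF S(1)] by auto
    qed
    then show ?thesis
      using sum[OF D] by (auto simp: dist_norm)
  qed
  then have "integral {a..b} f \<in> closure S"
    by (auto simp: closure_approachable)
  then show ?thesis
    using S by simp
qed

lemma int0_in_closed_subspace:
  fixes f :: "real \<Rightarrow> 'a::real_normed_vector"
  assumes "locally_integrable f" "subspace S" "closed S" "\<And>s. f s \<in> S"
  shows "int0 f t \<in> S"
  using integral_in_closed_subspace[OF locally_integrableD[OF assms(1)] assms(2,3,4)]
  by (auto simp: integral_from_0_def subspace_neg[OF assms(2)])

lemma int0_Pair:
  fixes f :: "real \<Rightarrow> 'a::banach" and g :: "real \<Rightarrow> 'b::banach"
  assumes f: "locally_integrable f" and g: "locally_integrable g"
  shows "locally_integrable (\<lambda>s. (f s, g s))" "int0 (\<lambda>s. (f s, g s)) t = (int0 f t, int0 g t)"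
proof -
  have l: "bounded_linear (\<lambda>x::'a. (x, 0::'b))" "bounded_linear (\<lambda>x::'b. (0::'a, x))"
    by (intro bounded_linear_Pair bounded_linear_ident bounded_linear_zero)+
  have eq: "(\<lambda>s. (f s, g s)) = (\<lambda>s. (f s, 0) + (0, g s))"
    by auto
  note li = locally_integrable_linear[OF l(1) f] locally_integrable_linear[OF l(2) g]
  show "locally_integrable (\<lambda>s. (f s, g s))"
    unfolding eq by (rule locally_integrable_add[OF li])
  show "int0 (\<lambda>s. (f s, g s)) t = (int0 f t, int0 g t)"
    unfolding eq int0_add[OF li] by (simp add: int0_linear[OF l(1) f] int0_linear[OF l(2) g])
qed

text \<open>The Cauchy criterion for gauges applies: for a common fine division the Riemann sums of
  \<open>f\<close> and \<open>g\<close> differ by at most the Riemann sum of \<open>h\<close>, which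
  is close to the small integral of \<open>h\<close>.\<close>

lemma integrable_L1_approx:
  fixes f :: "real \<Rightarrow> 'a::banach"
  assumes ap: "\<And>e. e > 0 \<Longrightarrow> \<exists>g h. g integrable_on {a..b} \<and> h integrable_on {a..b} \<and>
      (\<forall>s\<in>{a..b}. norm (f s - g s) \<le> h s) \<and> integral {a..b} h < e"
  shows "f integrable_on {a..b}"
proof -
  have "f integrable_on cbox a b"
    unfolding integrable_Cauchy
  proof (intro allI impI)
    fix e :: real assume "e > 0"
    then obtain g h where g: "g integrable_on cbox a b" and h: "h integrable_on cbox a b"
      and le: "\<And>s. s \<in> {a..b} \<Longrightarrow> norm (f s - g s) \<le> h s" and small: "integral (cbox a b) h < e / 8"
      using ap[of "e / 8"] unfolding box_real by (metis zero_less_divide_iff zero_less_numeral)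
    have "0 < e / 8"
      using \<open>e > 0\<close> by simp
    let ?S = "\<lambda>D f. \<Sum>(x,K)\<in>D. measure lborel K *\<^sub>R f x"
    obtain \<gamma>1 where \<gamma>1: "gauge \<gamma>1"
      "\<And>D. D tagged_division_of cbox a b \<Longrightarrow> \<gamma>1 fine D \<Longrightarrow> norm (?S D g - integral (cbox a b) g) < e / 8"
      by (rule has_integralD[OF integrable_integral[OF g] \<open>0 < e / 8\<close>]) (rule that)
    obtain \<gamma>2 where \<gamma>2: "gauge \<gamma>2"
      "\<And>D. D tagged_division_of cbox a b \<Longrightarrow> \<gamma>2 fine D \<Longrightarrow> norm (?S D h - integral (cbox a b) h) < e / 8"
      by (rule has_integralD[OF integrable_integral[OF h] \<open>0 < e / 8\<close>]) (rule that)
    \<comment> \<open>Error budget: the sum of \<open>h\<close> is below e/8 + e/8, the sum of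
      \<open>g\<close> is within e/8 of its integral. Two divisions together cost 6e/8.\<close>
    have close: "norm (?S D f - integral (cbox a b) g) < 3 * e / 8"
      if D: "D tagged_division_of cbox a b" "(\<lambda>x. \<gamma>1 x \<inter> \<gamma>2 x) fine D" for D
    proof -
      have fine: "\<gamma>1 fine D" "\<gamma>2 fine D"
        using D(2)[unfolded fine_Int] by blast+
      have "?S D f - ?S D g = (\<Sum>(x,K)\<in>D. measure lborel K *\<^sub>R (f x - g x))"
        by (simp add: case_prod_unfold scaleR_diff_right sum_subtractf)
      also have "norm \<dots> \<le> ?S D h"
      proof (rule sum_norm_le)
        fix p assume p: "p \<in> D"
        then obtain x K where [simp]: "p = (x, K)" by (cases p)
        have "x \<in> {a..b}"
          using tagged_division_ofD(2,3)[OF D(1), of x K] p by auto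
        then show "norm (case p of (x,K) \<Rightarrow> measure lborel K *\<^sub>R (f x - g x)) \<le> (case p of (x,K) \<Rightarrow> measure lborel K *\<^sub>R h x)"
          using le by (simp add: mult_left_mono)
      qed
      finally have 1: "norm (?S D f - ?S D g) \<le> ?S D h" .
      have 2: "norm (?S D f - integral (cbox a b) g)
          \<le> norm (?S D f - ?S D g) + norm (?S D g - integral (cbox a b) g)"
        using norm_triangle_ineq[of "?S D f - ?S D g" "?S D g - integral (cbox a b) g"] by simp
      have 3: "?S D h < e / 8 + e / 8"
    proof -
        have "norm (?S D h - integral (cbox a b) h) < e / 8"
          by (rule \<gamma>2(2)) (rule D(1) fine(2))+
        then show ?thesis
          using small unfolding real_norm_def by linarith
      qed
      have 4: "norm (?S D g - integral (cbox a b) g) < e / 8"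
        by (rule \<gamma>1(2)) (rule D(1) fine(1))+
      show ?thesis
        using 1 2 3 4 by linarith
    qed
    show "\<exists>\<gamma>. gauge \<gamma> \<and> (\<forall>D1 D2. D1 tagged_division_of cbox a b \<and> \<gamma> fine D1 \<and>
        D2 tagged_division_of cbox a b \<and> \<gamma> fine D2 \<longrightarrow> norm (?S D1 f - ?S D2 f) < e)"
    proof (intro exI conjI allI impI)
      show "gauge (\<lambda>x. \<gamma>1 x \<inter> \<gamma>2 x)"
        using \<gamma>1(1) \<gamma>2(1) by (rule gauge_Int)
      fix D1 D2 assume *: "D1 tagged_division_of cbox a b \<and> (\<lambda>x. \<gamma>1 x \<inter> \<gamma>2 x) fine D1 \<and>
        D2 tagged_division_of cbox a b \<and> (\<lambda>x. \<gamma>1 x \<inter> \<gamma>2 x) fine D2"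
      let ?I = "integral (cbox a b) g"
      have "norm (?S D1 f - ?S D2 f) \<le> norm (?S D1 f - ?I) + norm (?S D2 f - ?I)"
        using norm_triangle_ineq4[of "?S D1 f - ?I" "?S D2 f - ?I"] by simp
      moreover have "norm (?S D1 f - ?I) < 3 * e / 8" "norm (?S D2 f - ?I) < 3 * e / 8"
        using * by (blast intro: close)+
      ultimately show "norm (?S D1 f - ?S D2 f) < e"
        using \<open>e > 0\<close> by linarith
    qed
  qed
  then show ?thesis by simp
qed

text \<open>The majorant \<open>h\<close> stands for the norm of \<open>f - g\<close>, so that
  integrability of that norm never has to be established. The approximants are continuous on the
  whole line, which makes the fundamental theorem of calculus available for them.\<close>

definition L1_approximable :: "(real \<Rightarrow> 'a::real_normed_vector) \<Rightarrow> bool" where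
  "L1_approximable f \<longleftrightarrow> (\<forall>a b. \<forall>e>0. \<exists>g h. continuous_on UNIV g \<and> h integrable_on {a..b} \<and>
     (\<forall>s\<in>{a..b}. norm (f s - g s) \<le> h s) \<and> integral {a..b} h < e)"

lemma L1_approximableE:
  assumes "L1_approximable f" "e > 0"
  obtains g h where "continuous_on UNIV g" "h integrable_on {a..b}"
    "\<And>s. s \<in> {a..b} \<Longrightarrow> norm (f s - g s) \<le> h s" "integral {a..b} h < e"
  using assms unfolding L1_approximable_def by metis

lemma L1_approximable_continuous: "continuous_on UNIV f \<Longrightarrow> L1_approximable f"
  unfolding L1_approximable_def
proof (intro allI impI)
  fix a b e :: real assume f: "continuous_on UNIV f" "e > 0"
  show "\<exists>g h. continuous_on UNIV g \<and> h integrable_on {a..b} \<and>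
     (\<forall>s\<in>{a..b}. norm (f s - g s) \<le> h s) \<and> integral {a..b} h < e"
    by (intro exI[of _ f] exI[of _ "\<lambda>_. 0"]) (use f in auto)
qed

text \<open>Strong continuity with a bound that is uniform on compact time intervals. The two
  together make \<open>K t (f t)\<close> continuous for continuous \<open>f\<close>, although
  \<open>K\<close> need not be continuous in operator norm.\<close>

definition strongly_cont :: "(real \<Rightarrow> 'a::real_normed_vector \<Rightarrow> 'b::real_normed_vector) \<Rightarrow> bool" where
  "strongly_cont K \<longleftrightarrow> (\<forall>t. bounded_linear (K t)) \<and> (\<forall>x. continuous_on UNIV (\<lambda>t. K t x)) \<and>
     (\<forall>N. \<exists>C. \<forall>t x. \<bar>t\<bar> \<le> N \<longrightarrow> norm (K t x) \<le> C * norm x)"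

lemma strongly_contI:
  assumes "\<And>t. bounded_linear (K t)" "\<And>x. continuous_on UNIV (\<lambda>t. K t x)"
    "\<And>t x. norm (K t x) \<le> c t * norm x" "continuous_on UNIV c"
  shows "strongly_cont K"
  unfolding strongly_cont_def
proof (intro conjI allI assms)
  fix N :: real
  have "bounded (c ` {- N..N})"
    by (intro compact_imp_bounded compact_continuous_image continuous_on_subset[OF assms(4)]) auto
  then obtain C where C: "\<And>t. t \<in> {- N..N} \<Longrightarrow> norm (c t) \<le> C"
    unfolding bounded_iff by blast
  show "\<exists>C. \<forall>t x. \<bar>t\<bar> \<le> N \<longrightarrow> norm (K t x) \<le> C * norm x"
  proof (intro exI[of _ C] allI impI)
    fix t x assume "\<bar>t\<bar> \<le> N"
    then have "c t \<le> C"
      using C[of t] by (auto simp: abs_le_iff)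
    then show "norm (K t x) \<le> C * norm x"
      using assms(3)[of t x] mult_right_mono[of "c t" C "norm x"] by simp
  qed
qed

lemma strongly_cont_linear: "strongly_cont K \<Longrightarrow> bounded_linear (K t)"
  by (simp add: strongly_cont_def)

lemma strongly_cont_bound:
  assumes "strongly_cont K"
  obtains C where "C > 0" "\<And>t x. \<bar>t\<bar> \<le> N \<Longrightarrow> norm (K t x) \<le> C * norm x"
proof -
  obtain C where C: "\<And>t x. \<bar>t\<bar> \<le> N \<Longrightarrow> norm (K t x) \<le> C * norm x"
    using assms unfolding strongly_cont_def by metis
  show ?thesis
  proof (rule that[of "max C 1"])
    fix t x assume "\<bar>t\<bar> \<le> N"
    then show "norm (K t x) \<le> max C 1 * norm x"
      using C[of t x] mult_right_mono[of C "max C 1" "norm x"] by simp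
  qed simp
qed

lemma strongly_cont_tendsto:
  assumes K: "strongly_cont K" and f: "(f \<longlongrightarrow> l) (at t)"
  shows "((\<lambda>s. K s (f s)) \<longlongrightarrow> K t l) (at t)"
proof -
  obtain C where C: "C > 0" "\<And>s x. \<bar>s\<bar> \<le> \<bar>t\<bar> + 1 \<Longrightarrow> norm (K s x) \<le> C * norm x"
    using strongly_cont_bound[OF K] by metis
  have "((\<lambda>s. K s l) \<longlongrightarrow> K t l) (at t)"
    using K unfolding strongly_cont_def continuous_on_def by auto
  moreover have "((\<lambda>s. K s (f s - l)) \<longlongrightarrow> 0) (at t)"
  proof (rule tendsto_norm_zero_cancel, rule Lim_null_comparison)
    have "((\<lambda>s. norm (f s - l)) \<longlongrightarrow> 0) (at t)"
      using f by (simp add: LIM_zero tendsto_norm_zero)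
    then show "((\<lambda>s. C * norm (f s - l)) \<longlongrightarrow> 0) (at t)"
      by (rule tendsto_mult_right_zero)
    have "eventually (\<lambda>s. s \<in> ball t 1) (at t)"
      by (intro eventually_at_in_open') auto
    then show "eventually (\<lambda>s. norm (norm (K s (f s - l))) \<le> C * norm (f s - l)) (at t)"
      by eventually_elim (use C in \<open>auto simp: dist_real_def\<close>)
  qed
  ultimately have "((\<lambda>s. K s l + K s (f s - l)) \<longlongrightarrow> K t l + 0) (at t)"
    by (rule tendsto_add)
  moreover have "K s l + K s (f s - l) = K s (f s)" for s
    using strongly_cont_linear[OF K, of s] by (simp add: linear_diff bounded_linear.linear)
  ultimately show ?thesis
    by simp
qed

lemma strongly_cont_continuous:
  assumes K: "strongly_cont K" and f: "continuous_on UNIV f"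
  shows "continuous_on UNIV (\<lambda>t. K t (f t))"
  using f strongly_cont_tendsto[OF K] unfolding continuous_on_def by auto

lemma has_vector_derivative_quotient:
  "(f has_vector_derivative d) (at t) \<longleftrightarrow> ((\<lambda>s. (f s - f t) /\<^sub>R (s - t)) \<longlongrightarrow> d) (at t)"
proof -
  have eq: "norm (f s - f t - (s - t) *\<^sub>R d) / norm (s - t) = norm ((f s - f t) /\<^sub>R (s - t) - d)"
    if "s \<noteq> t" for s
  proof -
    have "(f s - f t) /\<^sub>R (s - t) - d = (f s - f t - (s - t) *\<^sub>R d) /\<^sub>R (s - t)"
      using that by (simp add: scaleR_diff_right)
    then show ?thesis
      by (simp add: divide_inverse mult.commute)
  qed
  have "(f has_vector_derivative d) (at t) \<longleftrightarrow>
      ((\<lambda>s. norm (f s - f t - (s - t) *\<^sub>R d) / norm (s - t)) \<longlongrightarrow> 0) (at t)"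
    by (simp add: has_vector_derivative_def has_derivative_iff_norm bounded_linear_scaleR_left)
  also have "\<dots> \<longleftrightarrow> ((\<lambda>s. norm ((f s - f t) /\<^sub>R (s - t) - d)) \<longlongrightarrow> 0) (at t)"
    by (rule filterlim_cong) (use eq in \<open>auto simp: eventually_at_filter\<close>)
  also have "\<dots> \<longleftrightarrow> ((\<lambda>s. (f s - f t) /\<^sub>R (s - t)) \<longlongrightarrow> d) (at t)"
    by (simp only: tendsto_norm_zero_iff LIM_zero_iff)
  finally show ?thesis .
qed

text \<open>Differentiability is asked only for the orbit of the one vector \<open>f t\<close>,
  which fits unbounded generators. The difference quotient splits into that of this orbit and
  \<open>K s\<close> applied to the difference quotient of \<open>f\<close>; the latter converges by
  strong continuity.\<close>

lemma strongly_cont_product_rule: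
  assumes K: "strongly_cont K"
    and D: "((\<lambda>s. K s (f t)) has_vector_derivative k) (at t)"
    and f: "(f has_vector_derivative f') (at t)"
  shows "((\<lambda>s. K s (f s)) has_vector_derivative k + K t f') (at t)"
proof -
  have "((\<lambda>s. K s ((f s - f t) /\<^sub>R (s - t))) \<longlongrightarrow> K t f') (at t)"
    by (intro strongly_cont_tendsto[OF K]) (use f in \<open>simp add: has_vector_derivative_quotient\<close>)
  with D have "((\<lambda>s. (K s (f t) - K t (f t)) /\<^sub>R (s - t) + K s ((f s - f t) /\<^sub>R (s - t))) \<longlongrightarrow> k + K t f') (at t)"
    by (intro tendsto_add) (simp add: has_vector_derivative_quotient)
  moreover have "K s ((f s - f t) /\<^sub>R (s - t)) = (K s (f s) - K s (f t)) /\<^sub>R (s - t)" for s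
    using strongly_cont_linear[OF K, of s] by (simp add: linear_diff linear_scale bounded_linear.linear)
  ultimately show ?thesis
    by (simp add: has_vector_derivative_quotient flip: scaleR_add_right)
qed

section \<open>Approximation in mean by continuous functions\<close>

lemma L1_approximable_locally_integrable:
  fixes f :: "real \<Rightarrow> 'a::banach"
  assumes f: "L1_approximable f"
  shows "locally_integrable f"
  unfolding locally_integrable_def
proof (intro allI, rule integrable_L1_approx)
  fix a b e :: real assume "e > 0"
  then obtain g h where g: "continuous_on UNIV g" and h: "h integrable_on {a..b}"
    "\<And>s. s \<in> {a..b} \<Longrightarrow> norm (f s - g s) \<le> h s" "integral {a..b} h < e"
    using L1_approximableE[OF f] by metis
  moreover have "g integrable_on {a..b}"
    by (rule locally_integrableD[OF locally_integrable_continuous[OF g]])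
  ultimately show "\<exists>g h. g integrable_on {a..b} \<and> h integrable_on {a..b} \<and>
      (\<forall>s\<in>{a..b}. norm (f s - g s) \<le> h s) \<and> integral {a..b} h < e"
    by blast
qed

lemma L1_approximable_strongly_cont:
  assumes K: "strongly_cont K" and f: "L1_approximable f"
  shows "L1_approximable (\<lambda>s. K s (f s))"
  unfolding L1_approximable_def
proof (intro allI impI)
  fix a b e :: real assume "e > 0"
  obtain C where C: "C > 0" "\<And>t x. \<bar>t\<bar> \<le> max \<bar>a\<bar> \<bar>b\<bar> \<Longrightarrow> norm (K t x) \<le> C * norm x"
    using strongly_cont_bound[OF K] by metis
  have "e / C > 0"
    using \<open>e > 0\<close> C(1) by simp
  then obtain g h where g: "continuous_on UNIV g" and h: "h integrable_on {a..b}"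
    "\<And>s. s \<in> {a..b} \<Longrightarrow> norm (f s - g s) \<le> h s" "integral {a..b} h < e / C"
    using L1_approximableE[OF f] by metis
  have "norm (K s (f s) - K s (g s)) \<le> C * h s" if "s \<in> {a..b}" for s
  proof -
    have "K s (f s) - K s (g s) = K s (f s - g s)"
      using strongly_cont_linear[OF K, of s] by (simp add: linear_diff bounded_linear.linear)
    moreover have "norm (K s (f s - g s)) \<le> C * norm (f s - g s)"
      using that by (intro C(2)) auto
    moreover have "C * norm (f s - g s) \<le> C * h s"
      using h(2)[OF that] C(1) by simp
    ultimately show ?thesis by simp
  qed
  moreover have "integral {a..b} (\<lambda>s. C * h s) < e"
    using h(3) C(1) by (simp add: field_simps)
  moreover have "(\<lambda>s. C * h s) integrable_on {a..b}"
    using integrable_cmul[OF h(1), of C] by simp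
  ultimately show "\<exists>g h. continuous_on UNIV g \<and> h integrable_on {a..b} \<and>
      (\<forall>s\<in>{a..b}. norm (K s (f s) - g s) \<le> h s) \<and> integral {a..b} h < e"
    using strongly_cont_continuous[OF K g] by blast
qed

section \<open>Constructions of strongly continuous families\<close>

lemma strongly_cont_const: "bounded_linear L \<Longrightarrow> strongly_cont (\<lambda>_. L)"
  by (rule strongly_contI[where c = "\<lambda>_. onorm L"]) (auto intro: onorm)

lemma strongly_cont_compose:
  assumes K: "strongly_cont K" and L: "strongly_cont L"
  shows "strongly_cont (\<lambda>t x. K t (L t x))"
  unfolding strongly_cont_def
proof (intro conjI allI)
  show "bounded_linear (\<lambda>x. K t (L t x))" for t
    by (rule bounded_linear_compose[OF strongly_cont_linear[OF K] strongly_cont_linear[OF L]])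
  show "continuous_on UNIV (\<lambda>t. K t (L t x))" for x
    by (rule strongly_cont_continuous[OF K]) (use L in \<open>simp add: strongly_cont_def\<close>)
  fix N :: real
  obtain C where C: "C > 0" "\<And>t x. \<bar>t\<bar> \<le> N \<Longrightarrow> norm (K t x) \<le> C * norm x"
    using strongly_cont_bound[OF K] by metis
  obtain C' where C': "C' > 0" "\<And>t x. \<bar>t\<bar> \<le> N \<Longrightarrow> norm (L t x) \<le> C' * norm x"
    using strongly_cont_bound[OF L] by metis
  show "\<exists>C. \<forall>t x. \<bar>t\<bar> \<le> N \<longrightarrow> norm (K t (L t x)) \<le> C * norm x"
  proof (intro exI allI impI)
    fix t x assume t: "\<bar>t\<bar> \<le> N"
    have "norm (K t (L t x)) \<le> C * norm (L t x)"
      by (rule C(2)[OF t])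
    also have "\<dots> \<le> C * (C' * norm x)"
      using C'(2)[OF t] C(1) by simp
    finally show "norm (K t (L t x)) \<le> (C * C') * norm x"
      by (simp add: mult.assoc)
  qed
qed

lemma strongly_cont_reparam:
  assumes K: "strongly_cont K" and p: "continuous_on UNIV p"
  shows "strongly_cont (\<lambda>t. K (p t))"
  unfolding strongly_cont_def
proof (intro conjI allI)
  show "bounded_linear (K (p t))" for t
    by (rule strongly_cont_linear[OF K])
  show "continuous_on UNIV (\<lambda>t. K (p t) x)" for x
    using K by (intro continuous_on_compose2[OF _ p]) (auto simp: strongly_cont_def)
  fix N :: real
  have "bounded (p ` {- N..N})"
    by (intro compact_imp_bounded compact_continuous_image continuous_on_subset[OF p]) auto
  then obtain P where P: "\<And>t. t \<in> {- N..N} \<Longrightarrow> norm (p t) \<le> P"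
    unfolding bounded_iff by blast
  obtain C where C: "C > 0" "\<And>t x. \<bar>t\<bar> \<le> P \<Longrightarrow> norm (K t x) \<le> C * norm x"
    using strongly_cont_bound[OF K] by metis
  have "\<forall>t x. \<bar>t\<bar> \<le> N \<longrightarrow> norm (K (p t) x) \<le> C * norm x"
    using P C(2) by (auto simp: abs_le_iff)
  then show "\<exists>C. \<forall>t x. \<bar>t\<bar> \<le> N \<longrightarrow> norm (K (p t) x) \<le> C * norm x"
    by blast
qed

lemma strongly_cont_scaleR:
  assumes p: "continuous_on UNIV p"
  shows "strongly_cont (\<lambda>t x. p t *\<^sub>R x)"
  by (rule strongly_contI[where c = "\<lambda>t. \<bar>p t\<bar>"])
    (auto intro!: bounded_linear_scaleR_right continuous_intros p)

section \<open>Complex scalar multiplication as a bounded bilinear map\<close>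

lemma bounded_bilinear_scaleC: "bounded_bilinear (scaleC :: complex \<Rightarrow> 'a::complex_normed_vector \<Rightarrow> 'a)"
proof
  fix a a' :: complex and b b' :: 'a and r :: real
  show "(a + a') *\<^sub>C b = a *\<^sub>C b + a' *\<^sub>C b" "a *\<^sub>C (b + b') = a *\<^sub>C b + a *\<^sub>C b'"
    by (simp_all add: scaleC_add_left scaleC_add_right)
  show "(r *\<^sub>R a) *\<^sub>C b = r *\<^sub>R (a *\<^sub>C b)" "a *\<^sub>C (r *\<^sub>R b) = r *\<^sub>R (a *\<^sub>C b)"
    by (simp_all add: scaleR_scaleC scaleC_scaleC scaleR_conv_of_real mult.commute)
  show "\<exists>K. \<forall>a b. norm (a *\<^sub>C (b::'a)) \<le> norm a * norm b * K"
    by (intro exI[of _ 1]) (simp add: norm_scaleC)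
qed

lemmas scaleC_simps = bounded_bilinear.zero_left[OF bounded_bilinear_scaleC]
  bounded_bilinear.zero_right[OF bounded_bilinear_scaleC]
  bounded_bilinear.minus_left[OF bounded_bilinear_scaleC]
  bounded_bilinear.minus_right[OF bounded_bilinear_scaleC]
  bounded_bilinear.diff_left[OF bounded_bilinear_scaleC]
  bounded_bilinear.diff_right[OF bounded_bilinear_scaleC]

lemma scaleC_of_real: "complex_of_real r *\<^sub>C x = r *\<^sub>R x"
  by (simp add: scaleR_scaleC)

lemma scaleC_one: "(1::complex) *\<^sub>C x = x"
  using scaleC_of_real[of 1 x] by simp

lemma strongly_cont_scaleC:
  assumes p: "continuous_on UNIV p"
  shows "strongly_cont (\<lambda>t x. p t *\<^sub>C x)"
  by (rule strongly_contI[where c = "\<lambda>t. cmod (p t)"])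
    (auto simp: norm_scaleC intro!: continuous_intros p
      bounded_bilinear.bounded_linear_right[OF bounded_bilinear_scaleC]
      bounded_bilinear.continuous_on[OF bounded_bilinear_scaleC])

text \<open>Integration by parts against \<open>f\<close> itself, by approximation from continuous \<open>f\<close>,
  for which the product rule applies.\<close>

lemma int0_by_parts:
  fixes f :: "real \<Rightarrow> 'a::banach" and K :: "real \<Rightarrow> 'a \<Rightarrow> 'b::banach"
  assumes K: "strongly_cont K" and K': "strongly_cont K'"
    and D: "\<And>x t. ((\<lambda>s. K s x) has_vector_derivative K' t x) (at t)"
    and f: "L1_approximable f"
  shows "int0 (\<lambda>s. K s (f s)) t = K t (int0 f t) - int0 (\<lambda>s. K' s (int0 f s)) t"
proof -
  define N where "N = \<bar>t\<bar>"
  \<comment> \<open>The defect of the identity. It is linear in \<open>f\<close>, vanishes for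
    continuous \<open>f\<close> and is controlled by the mean size of \<open>f\<close>.\<close>
  define E where "E f = int0 (\<lambda>s. K s (f s)) t - K t (int0 f t) + int0 (\<lambda>s. K' s (int0 f s)) t" for f
  have cont: "E g = 0" if g: "continuous_on UNIV g" for g
  proof -
    have "((\<lambda>s. K s (int0 g s)) has_vector_derivative K' s (int0 g s) + K s (g s)) (at s)" for s
      by (rule strongly_cont_product_rule[OF K D int0_has_vector_derivative[OF g]])
    then have "int0 (\<lambda>s. K' s (int0 g s) + K s (g s)) t = K t (int0 g t) - K 0 (int0 g 0)"
      by (rule int0_vector_derivative)
    moreover have "K 0 0 = 0"
      using strongly_cont_linear[OF K, of 0] by (simp add: linear_0 bounded_linear.linear)
    moreover have "int0 (\<lambda>s. K' s (int0 g s) + K s (g s)) t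
        = int0 (\<lambda>s. K' s (int0 g s)) t + int0 (\<lambda>s. K s (g s)) t"
      by (intro int0_add locally_integrable_continuous strongly_cont_continuous[OF K]
          strongly_cont_continuous[OF K'] continuous_int0 g)
    ultimately show ?thesis
      by (simp add: E_def algebra_simps)
  qed
  obtain C where C: "C > 0" "\<And>t x. \<bar>t\<bar> \<le> N \<Longrightarrow> norm (K t x) \<le> C * norm x"
    using strongly_cont_bound[OF K] by metis
  obtain C' where C': "C' > 0" "\<And>t x. \<bar>t\<bar> \<le> N \<Longrightarrow> norm (K' t x) \<le> C' * norm x"
    using strongly_cont_bound[OF K'] by metis
  \<comment> \<open>\<open>C\<close> bounds each of the first two terms of the defect,
    \<open>C'\<close> times the length \<open>2 * N\<close> of the interval bounds the
    third.\<close>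
  define c where "c = C + C + C' * (2 * N)"
  have fi: "locally_integrable f"
    by (rule L1_approximable_locally_integrable[OF f])
  have E: "norm (E f) \<le> c * e" if "e > 0" for e
  proof -
    obtain g h where g: "continuous_on UNIV g" and h: "h integrable_on {- N..N}"
      "\<And>s. s \<in> {- N..N} \<Longrightarrow> norm (f s - g s) \<le> h s" "integral {- N..N} h < e"
      using L1_approximableE[OF f \<open>e > 0\<close>] by metis
    define d where "d s = f s - g s" for s
    have gi: "locally_integrable g"
      by (rule locally_integrable_continuous[OF g])
    have di: "locally_integrable d"
      unfolding d_def by (rule locally_integrable_diff[OF fi gi])
    have Kfi: "locally_integrable (\<lambda>s. K s (f s))"
      by (rule L1_approximable_locally_integrable[OF L1_approximable_strongly_cont[OF K f]])
    have Kgi: "locally_integrable (\<lambda>s. K s (g s))"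
      by (rule locally_integrable_continuous[OF strongly_cont_continuous[OF K g]])
    have Id: "int0 d s = int0 f s - int0 g s" for s
      unfolding d_def by (rule int0_diff[OF fi gi])
    have Kd: "K s (d s) = K s (f s) - K s (g s)" for s
      unfolding d_def using strongly_cont_linear[OF K] by (simp add: linear_diff bounded_linear.linear)
    have Kdi: "locally_integrable (\<lambda>s. K s (d s))"
      unfolding Kd by (rule locally_integrable_diff[OF Kfi Kgi])
    have K'Id: "K' s (int0 d s) = K' s (int0 f s) - K' s (int0 g s)" for s
      unfolding Id using strongly_cont_linear[OF K'] by (simp add: linear_diff bounded_linear.linear)
    have "E f = E f - E g"
      using cont[OF g] by simp
    also have "\<dots> = E d"
    proof -
      have "int0 (\<lambda>s. K s (d s)) t = int0 (\<lambda>s. K s (f s)) t - int0 (\<lambda>s. K s (g s)) t"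
        unfolding Kd by (rule int0_diff[OF Kfi Kgi])
      moreover have "int0 (\<lambda>s. K' s (int0 d s)) t
          = int0 (\<lambda>s. K' s (int0 f s)) t - int0 (\<lambda>s. K' s (int0 g s)) t"
        unfolding K'Id
        by (intro int0_diff locally_integrable_continuous strongly_cont_continuous[OF K'] continuous_int0 fi gi)
      moreover have "K t (int0 d t) = K t (int0 f t) - K t (int0 g t)"
        unfolding Id using strongly_cont_linear[OF K] by (simp add: linear_diff bounded_linear.linear)
      ultimately show ?thesis
        unfolding E_def by simp
    qed
    finally have Ed: "E f = E d" .
    have dh: "norm (d s) \<le> h s" if "\<bar>s\<bar> \<le> N" for s
      unfolding d_def by (rule h(2)) (use that in auto)
    have 0: "norm (int0 d s) \<le> e" if "\<bar>s\<bar> \<le> N" for s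
      using norm_int0_le[OF di h(1) that dh] h(3) by linarith
    have t: "\<bar>t\<bar> \<le> N"
      by (simp add: N_def)
    have 1: "norm (int0 (\<lambda>s. K s (d s)) t) \<le> C * e"
    proof -
      have "norm (int0 (\<lambda>s. K s (d s)) t) \<le> integral {- N..N} (\<lambda>s. C * h s)"
      proof (rule norm_int0_le[OF Kdi _ t])
        show "norm (K s (d s)) \<le> C * h s" if "\<bar>s\<bar> \<le> N" for s
          using C(2)[OF that, of "d s"] mult_left_mono[OF dh[OF that], of C] C(1) by linarith
        show "(\<lambda>s. C * h s) integrable_on {- N..N}"
          using integrable_cmul[OF h(1), of C] by simp
      qed
      also have "\<dots> \<le> C * e"
        using h(3) C(1) by simp
      finally show ?thesis .
    qed
    have 2: "norm (K t (int0 d t)) \<le> C * e"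
      using C(2)[OF t, of "int0 d t"] mult_left_mono[OF 0[OF t], of C] C(1) by linarith
    have 3: "norm (int0 (\<lambda>s. K' s (int0 d s)) t) \<le> C' * (2 * N) * e"
    proof -
      have "norm (int0 (\<lambda>s. K' s (int0 d s)) t) \<le> integral {- N..N} (\<lambda>s. C' * e)"
      proof (rule norm_int0_le[OF _ _ t])
        show "locally_integrable (\<lambda>s. K' s (int0 d s))"
          by (intro locally_integrable_continuous strongly_cont_continuous[OF K'] continuous_int0 di)
        show "norm (K' s (int0 d s)) \<le> C' * e" if "\<bar>s\<bar> \<le> N" for s
          using C'(2)[OF that, of "int0 d s"] mult_left_mono[OF 0[OF that], of C'] C'(1) by linarith
      qed (rule integrable_const_ivl)
      also have "\<dots> = C' * (2 * N) * e"
        by (simp add: N_def)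
      finally show ?thesis .
    qed
    have "norm (E d) \<le> norm (int0 (\<lambda>s. K s (d s)) t) + norm (K t (int0 d t))
        + norm (int0 (\<lambda>s. K' s (int0 d s)) t)"
      unfolding E_def by (intro order_trans[OF norm_triangle_ineq] add_right_mono norm_triangle_ineq4)
    then show ?thesis
      unfolding Ed c_def using 1 2 3 by (simp add: distrib_right)
  qed
  have "c > 0"
    using C(1) C'(1) by (simp add: c_def N_def add_pos_nonneg)
  have "norm (E f) \<le> 0"
  proof (rule field_le_epsilon)
    fix e :: real assume "e > 0"
    then show "norm (E f) \<le> 0 + e"
      using E[of "e / c"] \<open>c > 0\<close> by simp
  qed
  then show ?thesis
    by (simp add: E_def algebra_simps)
qed

section \<open>From indicators and simple functions to locally integrable functions\<close>

lemma L1_approximable_add: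
  assumes f: "L1_approximable f" and g: "L1_approximable g"
  shows "L1_approximable (\<lambda>s. f s + g s)"
  unfolding L1_approximable_def
proof (intro allI impI)
  fix a b e :: real assume "e > 0"
  then have e: "e / 2 > 0" by simp
  obtain u h where u: "continuous_on UNIV u" and h: "h integrable_on {a..b}"
    "\<And>s. s \<in> {a..b} \<Longrightarrow> norm (f s - u s) \<le> h s" "integral {a..b} h < e / 2"
    using L1_approximableE[OF f e] by metis
  obtain v k where v: "continuous_on UNIV v" and k: "k integrable_on {a..b}"
    "\<And>s. s \<in> {a..b} \<Longrightarrow> norm (g s - v s) \<le> k s" "integral {a..b} k < e / 2"
    using L1_approximableE[OF g e] by metis
  have "norm (f s + g s - (u s + v s)) \<le> h s + k s" if "s \<in> {a..b}" for s
    using norm_triangle_ineq[of "f s - u s" "g s - v s"] h(2)[OF that] k(2)[OF that]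
    by (simp add: algebra_simps)
  moreover have "continuous_on UNIV (\<lambda>s. u s + v s)"
    by (intro continuous_intros u v)
  moreover have "(\<lambda>s. h s + k s) integrable_on {a..b}" "integral {a..b} (\<lambda>s. h s + k s) < e"
    using h k by (simp_all add: integrable_add Henstock_Kurzweil_Integration.integral_add)
  ultimately show "\<exists>g' h. continuous_on UNIV g' \<and> h integrable_on {a..b} \<and>
      (\<forall>s\<in>{a..b}. norm (f s + g s - g' s) \<le> h s) \<and> integral {a..b} h < e"
    by (intro exI[of _ "\<lambda>s. u s + v s"] exI[of _ "\<lambda>s. h s + k s"]) blast
qed

lemma L1_approximable_sum:
  "finite I \<Longrightarrow> (\<And>i. i \<in> I \<Longrightarrow> L1_approximable (f i)) \<Longrightarrow> L1_approximable (\<lambda>s. \<Sum>i\<in>I. f i s)"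
  by (induction I rule: finite_induct) (auto intro: L1_approximable_continuous L1_approximable_add)

lemma integral_AE_dominated_tendsto_0:
  fixes h :: "nat \<Rightarrow> real \<Rightarrow> real"
  assumes h: "\<And>n. h n integrable_on {a..b}" and w: "w integrable_on {a..b}"
    and le: "\<And>n x. x \<in> {a..b} \<Longrightarrow> \<bar>h n x\<bar> \<le> w x"
    and N: "negligible N" and lim: "\<And>x. x \<notin> N \<Longrightarrow> (\<lambda>n. h n x) \<longlonglongrightarrow> 0"
  shows "(\<lambda>n. integral {a..b} (h n)) \<longlonglongrightarrow> 0"
proof -
  define h' where "h' n x = (if x \<in> N then 0 else h n x)" for n x
  have eq: "h' n x = h n x" if "x \<in> {a..b} - N" for n x
    using that by (simp add: h'_def)
  have "(\<lambda>n. integral {a..b} (h' n)) \<longlonglongrightarrow> integral {a..b} (\<lambda>_. 0)"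
  proof (rule dominated_convergence[OF _ w])
    show "h' n integrable_on {a..b}" for n
      by (rule integrable_spike[OF h N eq])
    show "norm (h' n x) \<le> w x" if "x \<in> {a..b}" for n x
      using le[OF that, of n] by (auto simp: h'_def)
    show "(\<lambda>n. h' n x) \<longlonglongrightarrow> 0" for x
      using lim[of x] by (cases "x \<in> N") (simp_all add: h'_def)
  qed
  moreover have "integral {a..b} (h' n) = integral {a..b} (h n)" for n
    by (rule integral_spike[OF N]) (simp add: eq)
  ultimately show ?thesis
    by simp
qed

lemma ex_less_of_tendsto_0:
  assumes "X \<longlonglongrightarrow> (0::real)" "e > 0"
  shows "\<exists>n. X n < e"
proof -
  have "eventually (\<lambda>n. X n < e) sequentially"
    by (rule order_tendstoD(2)[OF assms])
  then show ?thesis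
    by (auto simp: eventually_sequentially)
qed

lemma L1_approximable_indicator:
  assumes S: "S \<in> sets lebesgue"
  shows "L1_approximable (indicator S :: real \<Rightarrow> real)"
  unfolding L1_approximable_def
proof (intro allI impI)
  fix a b e :: real assume "e > 0"
  have "(indicator S :: real \<Rightarrow> real) measurable_on UNIV"
    by (rule lebesgue_measurable_imp_measurable_on_real) (use S in auto)
  then obtain N g where N: "negligible N" and g: "\<And>n. continuous_on UNIV (g n)"
    and lim: "\<And>x. x \<notin> N \<Longrightarrow> (\<lambda>n. g n x) \<longlonglongrightarrow> (indicator S x :: real)"
    unfolding measurable_on_def by auto
  \<comment> \<open>Clipping to [0, 1] does not disturb the limit, since an indicator takes its
    values there, and it provides the constant majorant 1 for dominated convergence.\<close>
  define u where "u n x = max 0 (min 1 (g n x))" for n :: nat and x :: real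
  define h where "h n x = norm (indicator S x - u n x)" for n x
  have u: "continuous_on UNIV (u n)" for n
    unfolding u_def by (intro continuous_intros g)
  have h1: "\<bar>h n x\<bar> \<le> 1" for n x
    by (auto simp: h_def u_def indicator_def)
  have hm: "h n \<in> borel_measurable lebesgue" for n
  proof -
    have "u n \<in> borel_measurable lebesgue"
      using u by (simp add: borel_measurable_continuous_onI measurable_completion)
    then show ?thesis
      unfolding h_def using S by measurable
  qed
  have h: "h n integrable_on {a..b}" for n
    by (rule measurable_bounded_by_integrable_imp_integrable_real[where g = "\<lambda>_. 1"])
      (auto simp: h1 intro: measurable_restrict_space1 hm)
  have "(\<lambda>n. integral {a..b} (h n)) \<longlonglongrightarrow> 0"
  proof (rule integral_AE_dominated_tendsto_0[OF h _ h1 N])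
    fix x assume "x \<notin> N"
    then have "(\<lambda>n. norm (indicator S x - max 0 (min 1 (g n x))))
        \<longlonglongrightarrow> norm (indicator S x - max 0 (min 1 (indicator S x :: real)))"
      by (intro tendsto_intros lim)
    then show "(\<lambda>n. h n x) \<longlonglongrightarrow> 0"
      by (simp add: h_def u_def indicator_def split: if_splits)
  qed auto
  then obtain n where n: "integral {a..b} (h n) < e"
    using \<open>e > 0\<close> by (metis ex_less_of_tendsto_0)
  show "\<exists>g h. continuous_on UNIV g \<and> h integrable_on {a..b} \<and>
      (\<forall>s\<in>{a..b}. norm (indicator S s - g s :: real) \<le> h s) \<and> integral {a..b} h < e"
    by (rule exI[of _ "u n"], rule exI[of _ "h n"]) (use u h n in \<open>simp add: h_def\<close>)
qed

lemma L1_approximable_simple: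
  fixes s :: "real \<Rightarrow> 'a::real_normed_vector"
  assumes s: "simple_function lebesgue s"
  shows "L1_approximable s"
proof -
  have fin: "finite (range s)"
    using s by (simp add: simple_function_def)
  have eq: "s x = (\<Sum>y\<in>range s. indicator (s -` {y}) x *\<^sub>R y)" for x
  proof -
    have "(\<Sum>y\<in>range s. indicator (s -` {y}) x *\<^sub>R y) = (\<Sum>y\<in>{s x}. indicator (s -` {y}) x *\<^sub>R y)"
      by (rule sum.mono_neutral_right[OF fin]) (auto simp: indicator_def)
    then show ?thesis by simp
  qed
  have "L1_approximable (\<lambda>x. indicator (s -` {y}) x *\<^sub>R y)" for y
  proof (rule L1_approximable_strongly_cont[of "\<lambda>_ r. r *\<^sub>R y"])
    show "strongly_cont (\<lambda>_::real. \<lambda>r. r *\<^sub>R y)"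
      by (intro strongly_cont_const bounded_linear_scaleR_left)
    have "s -` {y} \<in> sets lebesgue"
    proof (cases "y \<in> range s")
      case True
      then show ?thesis
        using s by (auto simp: simple_function_def)
    next
      case False
      then have "s -` {y} = {}" by auto
      then show ?thesis by simp
    qed
    then show "L1_approximable (indicator (s -` {y}) :: real \<Rightarrow> real)"
      by (rule L1_approximable_indicator)
  qed
  then have "L1_approximable (\<lambda>x. \<Sum>y\<in>range s. indicator (s -` {y}) x *\<^sub>R y)"
    by (intro L1_approximable_sum fin)
  then show ?thesis
    by (subst (asm) eq[symmetric])
qed

lemma strongly_measurableE:
  assumes "strongly_measurable f"
  obtains s N where "\<And>n. simple_function lebesgue (s n)" "negligible N"
    "\<And>t. t \<notin> N \<Longrightarrow> (\<lambda>n. s n t) \<longlonglongrightarrow> f t"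
proof -
  obtain s where s: "\<And>n. simple_function lebesgue (s n)" "AE t in lebesgue. (\<lambda>n. s n t) \<longlonglongrightarrow> f t"
    using assms unfolding strongly_measurable_def by blast
  then obtain N where N: "N \<in> null_sets lebesgue" "{t \<in> space lebesgue. \<not> (\<lambda>n. s n t) \<longlonglongrightarrow> f t} \<subseteq> N"
    by (auto elim: AE_E simp: eventually_ae_filter)
  show ?thesis
    by (rule that[of s N]) (use s N in \<open>auto simp: negligible_iff_null_sets\<close>)
qed

text \<open>In a nonseparable space the difference of two Borel measurable maps may fail to be
  measurable. The detour through simple functions avoids such differences: pairs of simple functions
  are simple, and only real functions are passed to the limit.\<close>

lemma borel_measurable_norm_diff_simple:
  fixes f :: "real \<Rightarrow> 'a::real_normed_vector"
  assumes f: "strongly_measurable f" and r: "simple_function lebesgue r"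
  shows "(\<lambda>x. norm (f x - r x)) \<in> borel_measurable lebesgue"
proof -
  obtain s N where s: "\<And>n. simple_function lebesgue (s n)" and N: "negligible N"
    and lim: "\<And>t. t \<notin> N \<Longrightarrow> (\<lambda>n. s n t) \<longlonglongrightarrow> f t"
    using strongly_measurableE[OF f] by metis
  have Ns: "N \<in> null_sets lebesgue"
    using N by (simp add: negligible_iff_null_sets)
  define u where "u n x = (if x \<in> N then 0 else norm (s n x - r x))" for n x
  define v where "v x = (if x \<in> N then 0 else norm (f x - r x))" for x
  have "(\<lambda>x. norm (s n x - r x)) \<in> borel_measurable lebesgue" for n
  proof -
    have "simple_function lebesgue (\<lambda>x. (s n x, r x))"
      by (rule simple_function_Pair[OF s r])
    then have "simple_function lebesgue ((\<lambda>(p, q). norm (p - q)) \<circ> (\<lambda>x. (s n x, r x)))"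
      by (rule simple_function_compose)
    then show ?thesis
      by (auto simp: o_def intro: borel_measurable_simple_function)
  qed
  then have u: "u n \<in> borel_measurable lebesgue" for n
    unfolding u_def using Ns by (intro measurable_If_set) auto
  have "v \<in> borel_measurable lebesgue"
  proof (rule borel_measurable_LIMSEQ_real[OF _ u])
    show "(\<lambda>n. u n x) \<longlonglongrightarrow> v x" for x
      unfolding u_def v_def using lim[of x] by (auto intro!: tendsto_intros)
  qed
  moreover have "AE x in lebesgue. v x = norm (f x - r x)"
    by (rule AE_I'[OF Ns]) (auto simp: v_def)
  ultimately show ?thesis
    by (rule borel_measurable_AE)
qed

lemma borel_measurable_norm_strongly_measurable:
  "strongly_measurable f \<Longrightarrow> (\<lambda>x. norm (f x)) \<in> borel_measurable lebesgue"
  using borel_measurable_norm_diff_simple[of f "\<lambda>_. 0"] by simp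

lemma L1_loc_approximable:
  fixes f :: "real \<Rightarrow> 'a::real_normed_vector"
  assumes "f \<in> L1_loc"
  shows "L1_approximable f"
  unfolding L1_approximable_def
proof (intro allI impI)
  fix a b e :: real assume "e > 0"
  have f: "strongly_measurable f" and int: "set_integrable lebesgue {a..b} (\<lambda>t. norm (f t))"
    using assms by (auto simp: L1_loc_def)
  obtain s N where s: "\<And>n. simple_function lebesgue (s n)" and N: "negligible N"
    and lim: "\<And>t. t \<notin> N \<Longrightarrow> (\<lambda>n. s n t) \<longlonglongrightarrow> f t"
    using strongly_measurableE[OF f] by metis
  \<comment> \<open>Strong measurability gives simple functions without an integrable majorant;
    cutting them off at twice the norm of \<open>f\<close> yields the majorant
    \<open>3 * norm (f x)\<close> for the error. The factor 2 leaves room: where \<open>f x\<close>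
    is nonzero the cut is eventually inactive, and where \<open>f x = 0\<close> it forces
    \<open>r n x = 0\<close>.\<close>
  define r where "r n x = (if norm (s n x) \<le> 2 * norm (f x) then s n x else 0)" for n x
  define d where "d n x = norm (f x - r n x)" for n x
  have r: "simple_function lebesgue (r n)" for n
  proof -
    have "(\<lambda>x. norm (s n x)) \<in> borel_measurable lebesgue"
      using simple_function_compose[OF s[of n], of norm]
      by (auto simp: o_def intro: borel_measurable_simple_function)
    then have "{x \<in> space lebesgue. norm (s n x) \<le> 2 * norm (f x)} \<in> sets lebesgue"
      using borel_measurable_norm_strongly_measurable[OF f] by measurable
    then show ?thesis
      unfolding r_def by (intro simple_function_If s) auto
  qed
  have dle: "\<bar>d n x\<bar> \<le> 3 * norm (f x)" for n x
    using norm_triangle_ineq4[of "f x" "r n x"] by (auto simp: d_def r_def)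
  have w: "(\<lambda>x. 3 * norm (f x)) integrable_on {a..b}"
    using integrable_cmul[OF set_lebesgue_integral_eq_integral(1)[OF int], of 3] by simp
  have "d n integrable_on {a..b}" for n
    by (rule measurable_bounded_by_integrable_imp_integrable_real[OF _ w dle])
      (auto simp: d_def intro!: measurable_restrict_space1 borel_measurable_norm_diff_simple f r)
  moreover have "(\<lambda>n. d n x) \<longlonglongrightarrow> 0" if "x \<notin> N" for x
  proof (cases "f x = 0")
    case True
    then have "d n x = 0" for n
      by (auto simp: d_def r_def)
    then show ?thesis by simp
  next
    case False
    have "(\<lambda>n. norm (s n x)) \<longlonglongrightarrow> norm (f x)"
      by (intro tendsto_norm lim that)
    then have "eventually (\<lambda>n. norm (s n x) < 2 * norm (f x)) sequentially"
      using False by (intro order_tendstoD) auto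
    then have "eventually (\<lambda>n. norm (f x - s n x) = d n x) sequentially"
      by eventually_elim (simp add: d_def r_def)
    moreover have "(\<lambda>n. norm (f x - s n x)) \<longlonglongrightarrow> norm (f x - f x)"
      by (intro tendsto_intros lim that)
    ultimately show ?thesis
      by (simp add: Lim_transform_eventually)
  qed
  ultimately have "(\<lambda>n. integral {a..b} (d n)) \<longlonglongrightarrow> 0"
    by (rule integral_AE_dominated_tendsto_0[OF _ w dle N])
  then obtain n where n: "integral {a..b} (d n) < e / 2"
    using ex_less_of_tendsto_0 half_gt_zero[OF \<open>e > 0\<close>] by metis
  have e: "e / 2 > 0"
    using \<open>e > 0\<close> by simp
  obtain g h where g: "continuous_on UNIV g" and h: "h integrable_on {a..b}"
    "\<And>x. x \<in> {a..b} \<Longrightarrow> norm (r n x - g x) \<le> h x" "integral {a..b} h < e / 2"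
    using L1_approximableE[OF L1_approximable_simple[OF r] e] by metis
  have "norm (f x - g x) \<le> d n x + h x" if "x \<in> {a..b}" for x
    using norm_triangle_ineq[of "f x - r n x" "r n x - g x"] h(2)[OF that] by (simp add: d_def)
  moreover have "(\<lambda>x. d n x + h x) integrable_on {a..b}" "integral {a..b} (\<lambda>x. d n x + h x) < e"
    using \<open>d n integrable_on {a..b}\<close> h n by (simp_all add: integrable_add Henstock_Kurzweil_Integration.integral_add)
  ultimately show "\<exists>g h. continuous_on UNIV g \<and> h integrable_on {a..b} \<and>
      (\<forall>x\<in>{a..b}. norm (f x - g x) \<le> h x) \<and> integral {a..b} h < e"
    using g by blast
qed

lemma M_exp_bound:
  assumes "f \<in> M_exp \<nu>"
  obtains K where "K \<ge> 0" "\<And>t. norm (f t) \<le> K * exp (\<nu> * \<bar>t\<bar>)"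
proof -
  obtain K where K: "\<And>t. exp (- \<nu> * \<bar>t\<bar>) * norm (f t) \<le> K"
    using assms unfolding M_exp_def bdd_above_def by blast
  have "norm (f t) \<le> K * exp (\<nu> * \<bar>t\<bar>)" for t
    using K[of t] by (simp add: exp_minus field_simps)
  moreover have "K \<ge> 0"
    using K[of 0] order_trans[OF norm_ge_zero[of "f 0"]] by simp
  ultimately show ?thesis
    using that by blast
qed

lemma M_exp_L1_loc:
  assumes f: "f \<in> M_exp \<nu>"
  shows "f \<in> L1_loc"
proof -
  have sm: "strongly_measurable f"
    using f by (simp add: M_exp_def)
  obtain K where K: "K \<ge> 0" "\<And>t. norm (f t) \<le> K * exp (\<nu> * \<bar>t\<bar>)"
    using M_exp_bound[OF f] by metis
  have "set_integrable lebesgue {a..b} (\<lambda>t. norm (f t))" for a b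
  proof (rule measurable_bounded_by_integrable_imp_absolutely_integrable)
    show "(\<lambda>t. norm (f t)) \<in> borel_measurable (lebesgue_on {a..b})"
      by (intro measurable_restrict_space1 borel_measurable_norm_strongly_measurable sm)
    show "(\<lambda>t. K * exp (\<nu> * \<bar>t\<bar>)) integrable_on {a..b}"
      by (intro integrable_continuous_real continuous_intros)
  qed (use K in auto)
  with sm show ?thesis
    by (simp add: L1_loc_def)
qed

section \<open>Laplace transforms\<close>

lemma integrable_exp_decay:
  fixes g :: "real \<Rightarrow> 'a::banach"
  assumes g: "locally_integrable g" and \<delta>: "\<delta> > 0" and c: "c \<ge> 0"
    and le: "\<And>t. t \<ge> 0 \<Longrightarrow> norm (g t) \<le> K * exp (- \<delta> * t)"
  shows "g integrable_on {c..}" "norm (integral {c..} g) \<le> K * (exp (- \<delta> * c) / \<delta>)"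
proof -
  have hi: "((\<lambda>t. K * exp (- \<delta> * t)) has_integral K * (exp (- \<delta> * c) / \<delta>)) {c..}"
    by (rule has_integral_mult_right[OF has_integral_exp_minus_to_infinity[OF \<delta>]])
  have le': "norm (g t) \<le> K * exp (- \<delta> * t)" if "t \<in> {c..}" for t
    using le[of t] that c by simp
  show gi: "g integrable_on {c..}"
  proof (rule integrable_on_all_intervals_integrable_bound[OF _ le'])
    fix a b :: real
    have "{c..} \<inter> cbox a b = {max c a..b}"
      by auto
    then have "g integrable_on ({c..} \<inter> cbox a b)"
      using locally_integrableD[OF g] by simp
    then show "(\<lambda>x. if x \<in> {c..} then g x else 0) integrable_on cbox a b"
      by (simp only: integrable_restrict_Int)
    show "(\<lambda>t. K * exp (- \<delta> * t)) integrable_on {c..}"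
      using hi by blast
  qed
  show "norm (integral {c..} g) \<le> K * (exp (- \<delta> * c) / \<delta>)"
    using integral_norm_bound_integral[OF gi has_integral_integrable[OF hi] le'] integral_unique[OF hi]
    by simp
qed

lemma exp_decay_tendsto_0: "\<delta> > 0 \<Longrightarrow> ((\<lambda>c::real. exp (- \<delta> * c)) \<longlongrightarrow> 0) at_top"
  by (rule filterlim_compose[OF exp_at_bot filterlim_tendsto_neg_mult_at_bot[OF tendsto_const _ filterlim_ident]]) simp

text \<open>Operator relations are available on bounded intervals. This limit carries them over to
  integrals on the half line, in particular to Laplace transforms.\<close>

lemma int0_tendsto_at_top:
  fixes g :: "real \<Rightarrow> 'a::banach"
  assumes g: "locally_integrable g" and \<delta>: "\<delta> > 0"
    and le: "\<And>t. t \<ge> 0 \<Longrightarrow> norm (g t) \<le> K * exp (- \<delta> * t)"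
  shows "(int0 g \<longlongrightarrow> integral {0..} g) at_top"
proof -
  note ed = integrable_exp_decay[OF g \<delta> _ le]
  have eq: "norm (int0 g c - integral {0..} g) \<le> K * (exp (- \<delta> * c) / \<delta>)" if "c \<ge> 0" for c
  proof -
    have "integral ({0..c} \<union> {c..}) g = integral {0..c} g + integral {c..} g"
    proof (rule Henstock_Kurzweil_Integration.integral_Un)
      show "negligible ({0..c} \<inter> {c..})"
        by (rule negligible_subset[OF negligible_sing[of c]]) auto
    qed (use locally_integrableD[OF g] ed that in auto)
    moreover have "{0..c} \<union> {c..} = {0..}"
      using that by auto
    ultimately have "int0 g c - integral {0..} g = - integral {c..} g"
      using that by (simp add: integral_from_0_def)
    then show ?thesis
      using ed(2)[OF that] by simp
  qed
  have "((\<lambda>c. int0 g c - integral {0..} g) \<longlongrightarrow> 0) at_top"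
  proof (rule Lim_null_comparison)
    show "eventually (\<lambda>c. norm (int0 g c - integral {0..} g) \<le> K * (exp (- \<delta> * c) / \<delta>)) at_top"
      using eventually_ge_at_top[of 0] by eventually_elim (rule eq)
    have "((\<lambda>c. exp (- \<delta> * c)) \<longlongrightarrow> 0) at_top"
      by (rule exp_decay_tendsto_0[OF \<delta>])
    then have "((\<lambda>c. K * (exp (- \<delta> * c) / \<delta>)) \<longlongrightarrow> K * (0 / \<delta>)) at_top"
      using \<delta> by (intro tendsto_intros) auto
    then show "((\<lambda>c. K * (exp (- \<delta> * c) / \<delta>)) \<longlongrightarrow> 0) at_top"
      by simp
  qed
  then show ?thesis
    by (simp add: LIM_zero_iff)
qed

section \<open>Laplace transforms as limits of truncated transforms\<close>

abbreviation decay :: "complex \<Rightarrow> real \<Rightarrow> complex" where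
  "decay z t \<equiv> exp (- (z * complex_of_real t))"

lemma norm_exp_scaleC: "norm (decay z t *\<^sub>C x) = exp (- Re z * t) * norm x"
  by (simp add: norm_scaleC)

lemma norm_exp_scaleC_le:
  assumes "t \<ge> 0" "norm x \<le> K * exp (\<mu> * \<bar>t\<bar>)"
  shows "norm (decay z t *\<^sub>C x) \<le> K * exp (- (Re z - \<mu>) * t)"
proof -
  have "norm (decay z t *\<^sub>C x) \<le> exp (- Re z * t) * (K * exp (\<mu> * \<bar>t\<bar>))"
    unfolding norm_exp_scaleC using assms(2) by simp
  also have "\<dots> = K * (exp (- Re z * t) * exp (\<mu> * t))"
    using assms(1) by simp
  also have "exp (- Re z * t) * exp (\<mu> * t) = exp (- (Re z - \<mu>) * t)"
    unfolding exp_add[symmetric] by (simp add: algebra_simps)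
  finally show ?thesis .
qed

lemma continuous_exp_mult: "continuous_on UNIV (\<lambda>t. decay z t)"
  by (intro continuous_intros)

lemma decay_locally_integrable:
  fixes f :: "real \<Rightarrow> 'a::complex_banach"
  assumes "L1_approximable f"
  shows "locally_integrable (\<lambda>t. decay z t *\<^sub>C f t)"
  by (rule L1_approximable_locally_integrable[OF
        L1_approximable_strongly_cont[OF strongly_cont_scaleC[OF continuous_exp_mult] assms]])

lemma laplace_tendsto:
  fixes f :: "real \<Rightarrow> 'a::complex_banach"
  assumes f: "L1_approximable f" and le: "\<And>t. norm (f t) \<le> K * exp (\<mu> * \<bar>t\<bar>)" and z: "\<mu> < Re z"
  shows "(int0 (\<lambda>t. decay z t *\<^sub>C f t) \<longlongrightarrow> laplace f z) at_top"
  unfolding laplace_def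
proof (rule int0_tendsto_at_top)
  show "locally_integrable (\<lambda>t. decay z t *\<^sub>C f t)"
    by (rule decay_locally_integrable[OF f])
  show "Re z - \<mu> > 0"
    using z by simp
qed (rule norm_exp_scaleC_le[OF _ le])

text \<open>Substituting \<open>- t\<close> for t turns the transform of the reflected function at z
  into an integral over the negative half line with parameter \<open>- z\<close>. The minus sign in
  the limit comes from the orientation of \<open>int0\<close> there.\<close>

lemma laplace_reflect_tendsto:
  fixes f :: "real \<Rightarrow> 'a::complex_banach"
  assumes f: "L1_approximable f" and le: "\<And>t. norm (f t) \<le> K * exp (\<mu> * \<bar>t\<bar>)" and z: "\<mu> < Re z"
  shows "(int0 (\<lambda>t. decay (- z) t *\<^sub>C f t) \<longlongrightarrow> - laplace (\<lambda>t. f (- t)) z) at_bot"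
proof -
  define g where "g t = decay (- z) t *\<^sub>C f t" for t
  have gi: "locally_integrable g"
    unfolding g_def by (rule decay_locally_integrable[OF f])
  have "(int0 (\<lambda>t. g (- t)) \<longlongrightarrow> integral {0..} (\<lambda>t. g (- t))) at_top"
  proof (rule int0_tendsto_at_top)
    show "locally_integrable (\<lambda>t. g (- t))"
      unfolding locally_integrable_def
    proof (intro allI)
      fix a b :: real
      show "(\<lambda>t. g (- t)) integrable_on {a..b}"
        using Henstock_Kurzweil_Integration.integrable_reflect_real[of g "- a" "- b"]
          locally_integrableD[OF gi] by simp
    qed
    show "Re z - \<mu> > 0"
      using z by simp
    show "norm (g (- t)) \<le> K * exp (- (Re z - \<mu>) * t)" if "t \<ge> 0" for t
      using norm_exp_scaleC_le[OF that, of "f (- t)" K \<mu> z] le[of "- t"] by (simp add: g_def)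
  qed
  moreover have "int0 (\<lambda>t. g (- t)) = (\<lambda>t. - int0 g (- t))"
    by (rule ext, rule int0_reflect)
  moreover have "integral {0..} (\<lambda>t. g (- t)) = laplace (\<lambda>t. f (- t)) z"
    by (simp add: laplace_def g_def)
  ultimately have "((\<lambda>t. - int0 g (- t)) \<longlongrightarrow> laplace (\<lambda>t. f (- t)) z) at_top"
    by simp
  from tendsto_minus[OF this] have "((\<lambda>t. int0 g (- t)) \<longlongrightarrow> - laplace (\<lambda>t. f (- t)) z) at_top"
    by simp
  then have "(int0 g \<longlongrightarrow> - laplace (\<lambda>t. f (- t)) z) at_bot"
    by (simp add: filterlim_at_bot_mirror)
  then show ?thesis
    by (simp add: g_def[abs_def])
qed

text \<open>In the variable \<open>x = exp (- t)\<close> all moments of \<open>d\<close> vanish, hence by Bernstein's theorem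
  all integrals against continuous functions of \<open>x\<close>, in particular against bump functions.\<close>

lemma laplace_eq_0_imp:
  fixes d :: "real \<Rightarrow> 'a::complex_banach"
  assumes d: "continuous_on UNIV d" and K: "K \<ge> 0"
    and le: "\<And>t. t \<ge> 0 \<Longrightarrow> norm (d t) \<le> K * exp (\<mu> * t)"
    and L: "\<And>z. z > \<sigma> \<Longrightarrow> laplace d (complex_of_real z) = 0"
    and t0: "t0 \<ge> 0"
  shows "d t0 = 0"
proof -
  \<comment> \<open>Above \<sigma>, so that the transform vanishes at \<open>z1 + k\<close> for
    every natural k; above \<mu>, so that the weighted function \<open>w\<close> decays with rate
    \<delta>; above 0, so that the weight \<open>h\<close> below is integrable.\<close>
  define z1 where "z1 = max (max \<sigma> \<mu>) 0 + 1"
  define \<delta> where "\<delta> = z1 - \<mu>"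
  have z1: "z1 > \<sigma>" "z1 > 0" and \<delta>: "\<delta> > 0"
    by (auto simp: z1_def \<delta>_def)
  define w where "w t = exp (- z1 * t) *\<^sub>R d t" for t
  have wc: "continuous_on UNIV w"
    unfolding w_def by (intro continuous_intros d)
  have wle: "norm (w t) \<le> K * exp (- \<delta> * t)" if "t \<ge> 0" for t
  proof -
    have "norm (w t) \<le> exp (- z1 * t) * (K * exp (\<mu> * t))"
      using le[OF that] by (simp add: w_def)
    also have "\<dots> = K * exp (- \<delta> * t)"
      by (simp add: \<delta>_def exp_add[symmetric] algebra_simps)
    finally show ?thesis .
  qed
  define I where "I \<phi> = integral {0..} (\<lambda>t. \<phi> (exp (- t)) *\<^sub>R w t)" for \<phi> :: "real \<Rightarrow> real"
  have x01: "exp (- t) \<in> {0..1}" if "t \<ge> 0" for t :: real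
    using that by simp
  have Ic: "continuous_on UNIV (\<lambda>t. \<phi> (exp (- t)) *\<^sub>R w t)" if "continuous_on UNIV \<phi>" for \<phi> :: "real \<Rightarrow> real"
    by (intro continuous_intros wc continuous_on_compose2[OF that]) auto
  have Ib: "norm (\<phi> (exp (- t)) *\<^sub>R w t) \<le> (C * K) * exp (- \<delta> * t)"
    if "\<And>x. x \<in> {0..1} \<Longrightarrow> \<bar>\<phi> x\<bar> \<le> C" "t \<ge> 0" for \<phi> :: "real \<Rightarrow> real" and C t
    using mult_mono[OF that(1)[OF x01[OF that(2)]] wle[OF that(2)]] that(1)[of 0] by (simp add: mult.assoc)
  have bnd: "\<exists>C. \<forall>x\<in>{0..1}. \<bar>\<phi> x\<bar> \<le> C" if "continuous_on UNIV \<phi>" for \<phi> :: "real \<Rightarrow> real"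
  proof -
    have "bounded (\<phi> ` {0..1})"
      by (intro compact_imp_bounded compact_continuous_image continuous_on_subset[OF that]) auto
    then show ?thesis
      unfolding bounded_iff by auto
  qed
  have Ii: "(\<lambda>t. \<phi> (exp (- t)) *\<^sub>R w t) integrable_on {0..}" if c: "continuous_on UNIV \<phi>" for \<phi> :: "real \<Rightarrow> real"
  proof -
    obtain C where C: "\<And>x. x \<in> {0..1} \<Longrightarrow> \<bar>\<phi> x\<bar> \<le> C"
      using bnd[OF c] by blast
    show ?thesis
      by (rule integrable_exp_decay(1)[OF locally_integrable_continuous[OF Ic[OF c]] \<delta> order_refl Ib[of \<phi>, OF C]])
  qed
  have Ile: "norm (I \<phi>) \<le> C * K / \<delta>"
    if c: "continuous_on UNIV \<phi>" and C: "\<And>x. x \<in> {0..1} \<Longrightarrow> \<bar>\<phi> x\<bar> \<le> C" for \<phi> C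
    using integrable_exp_decay(2)[OF locally_integrable_continuous[OF Ic[OF c]] \<delta> order_refl Ib[of \<phi>, OF C]]
    by (simp add: I_def)
  have Idiff: "I (\<lambda>x. \<phi> x - \<psi> x) = I \<phi> - I \<psi>" if "continuous_on UNIV \<phi>" "continuous_on UNIV \<psi>" for \<phi> \<psi>
    using Henstock_Kurzweil_Integration.integral_diff[OF Ii[OF that(1)] Ii[OF that(2)]]
    by (simp add: I_def scaleR_diff_left)
  \<comment> \<open>Induction on m removes one factor \<open>1 - x\<close> at a time. At m = 0 the
    integral is the transform of \<open>d\<close> at \<open>z1 + k\<close>. These products are, up
    to binomial coefficients, the Bernstein polynomials.\<close>
  have mono: "I (\<lambda>x. x ^ k * (1 - x) ^ m) = 0" for k m
  proof (induction m arbitrary: k)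
    case 0
    have "exp (- t) ^ k *\<^sub>R w t = exp (- (complex_of_real (z1 + real k) * complex_of_real t)) *\<^sub>C d t" for t
    proof -
      have "exp (- t) ^ k * exp (- z1 * t) = exp (- ((z1 + real k) * t))"
        by (simp add: exp_of_nat_mult[symmetric] exp_add[symmetric] algebra_simps)
      moreover have "exp (- (complex_of_real (z1 + real k) * complex_of_real t)) = complex_of_real (exp (- ((z1 + real k) * t)))"
        by (simp flip: exp_of_real)
      ultimately show ?thesis
        by (simp add: w_def scaleC_of_real)
    qed
    then have "I (\<lambda>x. x ^ k) = laplace d (complex_of_real (z1 + real k))"
      by (simp add: I_def laplace_def)
    also have "\<dots> = 0"
      by (rule L) (use z1 in simp)
    finally show ?case by simp
  next
    case (Suc m)
    have "I (\<lambda>x. x ^ k * (1 - x) ^ Suc m) = I (\<lambda>x. x ^ k * (1 - x) ^ m - x ^ Suc k * (1 - x) ^ m)"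
      by (simp add: algebra_simps)
    also have "\<dots> = 0"
      by (subst Idiff) (auto intro!: continuous_intros simp: Suc.IH simp del: power_Suc)
    finally show ?case .
  qed
  have bern: "I (\<lambda>x. \<Sum>k\<le>n. c k * Bernstein n k x) = 0" for n and c :: "nat \<Rightarrow> real"
  proof -
    have cB: "continuous_on UNIV (\<lambda>x::real. x ^ k * (1 - x) ^ m)" for k m :: nat
      by (intro continuous_intros)
    have "I (\<lambda>x. \<Sum>k\<le>n. c k * Bernstein n k x)
      = integral {0..} (\<lambda>t. \<Sum>k\<le>n. (c k * real (n choose k)) *\<^sub>R ((exp (- t) ^ k * (1 - exp (- t)) ^ (n - k)) *\<^sub>R w t))"
      by (simp add: I_def Bernstein_def scaleR_sum_left mult.assoc)
    also have "\<dots> = (\<Sum>k\<le>n. integral {0..} (\<lambda>t. (c k * real (n choose k)) *\<^sub>R ((exp (- t) ^ k * (1 - exp (- t)) ^ (n - k)) *\<^sub>R w t)))"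
      by (rule Henstock_Kurzweil_Integration.integral_sum)
        (rule finite_atMost, rule integrable_cmul[OF Ii[OF cB]])
    also have "\<dots> = (\<Sum>k\<le>n. (c k * real (n choose k)) *\<^sub>R I (\<lambda>x. x ^ k * (1 - x) ^ (n - k)))"
      by (simp only: I_def Henstock_Kurzweil_Integration.integral_cmul)
    finally show ?thesis
      by (simp add: mono)
  qed
  have I0: "I \<phi> = 0" if c: "continuous_on UNIV \<phi>" for \<phi>
  proof -
    have "norm (I \<phi>) \<le> 0 + e" if "e > 0" for e
    proof -
      \<comment> \<open>Chosen such that \<open>e' * K / \<delta>\<close> equals
        \<open>e * (K / (K + 1))\<close>, which is at most e; adding 1 covers the case K =
        0.\<close>
      define e' where "e' = e * \<delta> / (K + 1)"
      have e': "e' > 0"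
        using that \<delta> K by (simp add: e'_def)
      obtain N where N: "\<And>n x. N \<le> n \<Longrightarrow> x \<in> {0..1} \<Longrightarrow> \<bar>\<phi> x - (\<Sum>k\<le>n. \<phi> (real k / real n) * Bernstein n k x)\<bar> < e'"
        using Bernstein_Weierstrass[OF continuous_on_subset[OF c subset_UNIV] e'] by metis
      define p where "p x = (\<Sum>k\<le>N. \<phi> (real k / real N) * Bernstein N k x)" for x
      have pc: "continuous_on UNIV p"
        unfolding p_def Bernstein_def by (intro continuous_intros)
      have "I \<phi> = I (\<lambda>x. \<phi> x - p x)"
        using Idiff[OF c pc] bern[where n = N and c = "\<lambda>k. \<phi> (real k / real N)"] by (simp add: p_def[abs_def])
      also have "norm \<dots> \<le> e' * K / \<delta>"
        by (rule Ile) (use N[OF order_refl] c pc in \<open>auto intro!: continuous_intros less_imp_le simp: p_def\<close>)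
      also have "e' * K / \<delta> = e * (K / (K + 1))"
        using \<delta> by (simp add: e'_def)
      also have "\<dots> \<le> e * 1"
        using K that by (intro mult_left_mono) auto
      finally show ?thesis by simp
    qed
    then have "norm (I \<phi>) \<le> 0"
      by (rule field_le_epsilon)
    then show ?thesis by simp
  qed
  have "norm (d t0) \<le> 0 + e" if e: "e > 0" for e
  proof -
    define x0 where "x0 = exp (- t0)"
    have "continuous (at x0) (\<lambda>x. d (- ln x))"
    proof (rule continuous_at_compose[unfolded o_def, of x0 "\<lambda>x. - ln x" d])
      show "continuous (at x0) (\<lambda>x. - ln x)"
        by (intro continuous_intros) (simp add: x0_def)
      show "continuous (at (- ln x0)) d"
        using d by (simp add: continuous_on_eq_continuous_at)
    qed
    then obtain r where r: "r > 0" "\<And>x. \<bar>x - x0\<bar> < r \<Longrightarrow> norm (d (- ln x) - d t0) < e"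
      using e unfolding continuous_at_eps_delta dist_norm by (auto simp: x0_def)
    have near: "norm (d t - d t0) \<le> e" if "\<bar>exp (- t) - x0\<bar> < r" for t
      using r(2)[OF that] by simp
    \<comment> \<open>A tent around \<open>x0\<close> that is positive only where \<open>d\<close>
      differs from \<open>d t0\<close> by at most e. Testing \<open>d\<close> with it gives 0, so
      \<open>H *\<^sub>R d t0\<close> has norm at most e times the total mass H of the
      weight.\<close>
    define \<phi> where "\<phi> x = max 0 (r - \<bar>x - x0\<bar>)" for x
    have c: "continuous_on UNIV \<phi>"
      unfolding \<phi>_def by (intro continuous_intros)
    define h where "h t = \<phi> (exp (- t)) * exp (- z1 * t)" for t
    have hc: "continuous_on UNIV h"
      unfolding h_def by (intro continuous_intros continuous_on_compose2[OF c]) auto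
    have hnn: "h t \<ge> 0" for t
      by (simp add: h_def \<phi>_def)
    have hle: "norm (h t) \<le> r * exp (- z1 * t)" for t
      using r(1) by (auto simp: h_def \<phi>_def intro!: mult_right_mono)
    have hi: "h integrable_on {0..}"
      by (rule integrable_exp_decay(1)[OF locally_integrable_continuous[OF hc] z1(2) order_refl hle])
    define H where "H = integral {0..} h"
    have "0 < H"
    proof -
      \<comment> \<open>An interval to the right of \<open>t0\<close> stays inside the half line
        even for t0 = 0. The weight is continuous, nonnegative and nonzero at \<open>t0\<close>, so
        its integral there is positive.\<close>
      have hi1: "h integrable_on {t0..t0 + 1}"
        by (rule locally_integrableD[OF locally_integrable_continuous[OF hc]])
      have "integral {t0..t0 + 1} h \<noteq> 0"
      proof
        assume *: "integral {t0..t0 + 1} h = 0"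
        have "h t0 = 0"
          using integral_eq_0_iff[of t0 "t0 + 1" h] continuous_on_subset[OF hc subset_UNIV] hnn * by auto
        then show False
          using r(1) by (simp add: h_def \<phi>_def x0_def)
      qed
      moreover have "integral {t0..t0 + 1} h \<ge> 0"
        by (intro Henstock_Kurzweil_Integration.integral_nonneg hi1 hnn)
      moreover have "integral {t0..t0 + 1} h \<le> H"
        unfolding H_def by (rule integral_subset_le[OF _ hi1 hi]) (use t0 hnn in auto)
      ultimately show ?thesis by linarith
    qed
    have hd: "h t *\<^sub>R d t = \<phi> (exp (- t)) *\<^sub>R w t" for t
      by (simp add: h_def w_def)
    have hdi: "(\<lambda>t. h t *\<^sub>R d t) integrable_on {0..}"
      unfolding hd by (rule Ii[OF c])
    have hd0: "((\<lambda>t. h t *\<^sub>R d t0) has_integral H *\<^sub>R d t0) {0..}"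
      unfolding H_def by (rule has_integral_scaleR_left[OF integrable_integral[OF hi]])
    have "integral {0..} (\<lambda>t. h t *\<^sub>R d t) = 0"
      unfolding hd using I0[OF c] by (simp add: I_def)
    then have "H *\<^sub>R d t0 = - integral {0..} (\<lambda>t. h t *\<^sub>R d t - h t *\<^sub>R d t0)"
      using Henstock_Kurzweil_Integration.integral_diff[OF hdi has_integral_integrable[OF hd0]] integral_unique[OF hd0] by simp
    then have "norm (H *\<^sub>R d t0) = norm (integral {0..} (\<lambda>t. h t *\<^sub>R d t - h t *\<^sub>R d t0))"
      by simp
    also have "\<dots> \<le> integral {0..} (\<lambda>t. e *\<^sub>R h t)"
    proof (rule integral_norm_bound_integral)
      show "(\<lambda>t. h t *\<^sub>R d t - h t *\<^sub>R d t0) integrable_on {0..}"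
        by (rule integrable_diff[OF hdi has_integral_integrable[OF hd0]])
      show "(\<lambda>t. e *\<^sub>R h t) integrable_on {0..}"
        by (rule integrable_cmul[OF hi])
      fix t :: real
      show "norm (h t *\<^sub>R d t - h t *\<^sub>R d t0) \<le> e *\<^sub>R h t"
      proof (cases "\<bar>exp (- t) - x0\<bar> < r")
        case True
        have "norm (h t *\<^sub>R d t - h t *\<^sub>R d t0) = h t * norm (d t - d t0)"
          using hnn[of t] by (simp flip: scaleR_diff_right)
        also have "\<dots> \<le> h t * e"
          by (rule mult_left_mono[OF near[OF True] hnn])
        finally show ?thesis
          by (simp add: mult.commute)
      next
        case False
        then have "h t = 0"
          by (simp add: h_def \<phi>_def)
        then show ?thesis by simp
      qed
    qed
    also have "\<dots> = e * H"
      by (simp add: H_def)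
    finally show ?thesis
      using \<open>0 < H\<close> by (simp add: mult.commute)
  qed
  then have "norm (d t0) \<le> 0"
    by (rule field_le_epsilon)
  then show ?thesis by simp
qed

section \<open>Mild solutions for a group\<close>

lemma bounded_clinearD:
  assumes "bounded_clinear L"
  shows "bounded_linear L" "L (c *\<^sub>C x) = c *\<^sub>C L x"
  using assms by (auto simp: bounded_clinear_def)

lemma exp_has_vector_derivative:
  "((\<lambda>t. exp (z * complex_of_real t)) has_vector_derivative z * exp (z * complex_of_real t)) (at t)"
  by (rule has_vector_derivative_real_field) (auto intro!: derivative_eq_intros)

text \<open>Hille's theorem on closed operators and integrals, in graph form: integrals of pairs are
  computed componentwise and remain in a closed subspace.\<close>

lemma int0_in_closed_graph:
  fixes f g :: "real \<Rightarrow> 'a::banach"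
  assumes "subspace \<Gamma>" "closed \<Gamma>" and f: "locally_integrable f" and g: "locally_integrable g"
    and "\<And>s. (f s, g s) \<in> \<Gamma>"
  shows "(int0 f t, int0 g t) \<in> \<Gamma>"
  using int0_in_closed_subspace[OF int0_Pair(1)[OF f g] assms(1,2,5)] int0_Pair(2)[OF f g] by simp

text \<open>The estimate uses only the segment between 0 and t, parametrized by the distance from 0.
  On it |t - s| = |t| - |s|, which the exponential bound for convolutions exploits.\<close>

lemma norm_int0_le_directed:
  fixes g :: "real \<Rightarrow> 'a::banach"
  assumes g: "locally_integrable g" and h: "h integrable_on {0..\<bar>t\<bar>}"
    and le: "\<And>s. s \<in> {0..\<bar>t\<bar>} \<Longrightarrow> norm (g (sgn t * s)) \<le> h s"
  shows "norm (int0 g t) \<le> integral {0..\<bar>t\<bar>} h"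
proof (cases "0 \<le> t")
  case True
  have "norm (integral {0..t} g) \<le> integral {0..t} h"
  proof (rule integral_norm_bound_integral[OF locally_integrableD[OF g]])
    show "norm (g s) \<le> h s" if "s \<in> {0..t}" for s
      using le[of s] that by (cases "t = 0") (auto simp: sgn_real_def)
  qed (use h True in simp)
  then show ?thesis
    using True by (simp add: integral_from_0_def)
next
  case False
  have "(\<lambda>s. g (- s)) integrable_on {0..- t}"
    using Henstock_Kurzweil_Integration.integrable_reflect_real[of g 0 t]
      locally_integrableD[OF g] by simp
  then have "norm (integral {0..- t} (\<lambda>s. g (- s))) \<le> integral {0..- t} h"
  proof (rule integral_norm_bound_integral)
    show "norm (g (- s)) \<le> h s" if "s \<in> {0..- t}" for s
      using le[of s] that False by (simp add: sgn_real_def)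
  qed (use h False in simp)
  then show ?thesis
    using False Henstock_Kurzweil_Integration.integral_reflect_real[of 0 t g]
    by (simp add: integral_from_0_def)
qed

locale c0_group_generator =
  fixes T :: "real \<Rightarrow> 'a::complex_banach \<Rightarrow> 'a" and D :: "'a set" and G :: "'a \<Rightarrow> 'a"
    and M \<omega> :: real
  assumes gen: "generates_C0_group D G T"
    and onorm_le: "\<And>t. onorm (T t) \<le> M * exp (\<omega> * \<bar>t\<bar>)"
begin

section \<open>The group and the graph of its generator\<close>

lemma T_clinear: "bounded_clinear (T t)"
  and T_0 [simp]: "T 0 x = x"
  and T_add: "T (s + t) x = T s (T t x)"
  and T_cont: "continuous_on UNIV (\<lambda>t. T t x)"
  using gen by (auto simp: generates_C0_group_def C0_group_def)

lemma T_linear: "bounded_linear (T t)" and T_scaleC: "T t (c *\<^sub>C x) = c *\<^sub>C T t x"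
  using bounded_clinearD[OF T_clinear] by auto

lemmas T_minus_right = linear_diff[OF bounded_linear.linear[OF T_linear]]
  and T_zero_right = linear_0[OF bounded_linear.linear[OF T_linear]]
  and T_plus_right = linear_add[OF bounded_linear.linear[OF T_linear]]
  and T_scaleR_right = linear_scale[OF bounded_linear.linear[OF T_linear]]

lemma T_inverse [simp]: "T t (T (- t) x) = x" "T (- t) (T t x) = x"
  by (simp_all flip: T_add)

lemma norm_T_le: "norm (T t x) \<le> M * exp (\<omega> * \<bar>t\<bar>) * norm x"
  by (rule order_trans[OF onorm[OF T_linear] mult_right_mono[OF onorm_le norm_ge_zero]])

lemma T_strongly_cont: "strongly_cont T"
  by (rule strongly_contI[OF T_linear T_cont norm_T_le]) (intro continuous_intros)

lemma T_neg_strongly_cont: "strongly_cont (\<lambda>t. T (- t))"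
  by (rule strongly_cont_reparam[OF T_strongly_cont]) (intro continuous_intros)

lemma generator_iff: "x \<in> D \<and> G x = z \<longleftrightarrow> ((\<lambda>t. T t x) has_vector_derivative z) (at 0)"
  using gen by (simp add: generates_C0_group_def has_vector_derivative_quotient)

lemma orbit_has_vector_derivative:
  assumes "x \<in> D"
  shows "((\<lambda>t. T t x) has_vector_derivative T t (G x)) (at t)"
proof -
  have "((\<lambda>t. T t x) has_vector_derivative G x) (at (t - t))"
    using assms generator_iff[of x "G x"] by simp
  moreover have "((\<lambda>s. s - t) has_vector_derivative 1) (at t)"
    by (auto intro!: derivative_eq_intros)
  ultimately have "((\<lambda>t. T t x) \<circ> (\<lambda>s. s - t) has_vector_derivative 1 *\<^sub>R G x) (at t)"
    by (intro vector_diff_chain_at) auto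
  then have "((\<lambda>s. T t (T (s - t) x)) has_vector_derivative T t (G x)) (at t)"
    by (intro bounded_linear.has_vector_derivative[OF T_linear]) (simp add: o_def)
  then show ?thesis
    by (simp flip: T_add)
qed

text \<open>Not the resolvent, despite the letter: \<open>R t\<close> is the once integrated group.
  It maps every vector into the domain of the generator and takes over the smoothing that is often
  done with resolvents.\<close>

definition R :: "real \<Rightarrow> 'a \<Rightarrow> 'a" where "R t x = int0 (\<lambda>s. T s x) t"

lemma T_locally_integrable: "locally_integrable (\<lambda>s. T s x)"
  by (rule locally_integrable_continuous[OF T_cont])

lemma R_linear: "bounded_linear (R t)"
proof (rule bounded_linear_intro)
  show "R t (x + y) = R t x + R t y" for x y
    unfolding R_def
    by (subst int0_add[symmetric, OF T_locally_integrable T_locally_integrable])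
      (simp add: T_plus_right)
  show "R t (r *\<^sub>R x) = r *\<^sub>R R t x" for r x
    unfolding R_def
    by (subst int0_linear[symmetric, OF bounded_linear_scaleR_right T_locally_integrable])
      (simp add: T_scaleR_right)
  show "norm (R t x) \<le> norm x * integral {- \<bar>t\<bar>..\<bar>t\<bar>} (\<lambda>s. M * exp (\<omega> * \<bar>s\<bar>))" for x
  proof -
    have "norm (R t x) \<le> integral {- \<bar>t\<bar>..\<bar>t\<bar>} (\<lambda>s. M * exp (\<omega> * \<bar>s\<bar>) * norm x)"
      unfolding R_def
      by (intro norm_int0_le T_locally_integrable norm_T_le order_refl integrable_continuous_real continuous_intros)
    then show ?thesis
      by (simp add: mult.commute)
  qed
qed

lemma R_scaleC: "R t (c *\<^sub>C x) = c *\<^sub>C R t x"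
  unfolding R_def T_scaleC
  by (rule int0_linear[OF bounded_bilinear.bounded_linear_right[OF bounded_bilinear_scaleC] T_locally_integrable])

lemma R_has_vector_derivative: "((\<lambda>t. R t x) has_vector_derivative T t x) (at t)"
  unfolding R_def by (rule int0_has_vector_derivative[OF T_cont])

lemma R_strongly_cont: "strongly_cont R"
  unfolding strongly_cont_def
proof (intro conjI allI R_linear)
  show "continuous_on UNIV (\<lambda>t. R t x)" for x
    unfolding R_def by (rule continuous_int0[OF T_locally_integrable])
  show "\<exists>C. \<forall>t x. \<bar>t\<bar> \<le> N \<longrightarrow> norm (R t x) \<le> C * norm x" for N
  proof (intro exI allI impI)
    fix t x assume t: "\<bar>t\<bar> \<le> N"
    have "norm (R t x) \<le> integral {- N..N} (\<lambda>s. M * exp (\<omega> * \<bar>s\<bar>) * norm x)"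
      unfolding R_def
      by (intro norm_int0_le T_locally_integrable norm_T_le t integrable_continuous_real continuous_intros)
    then show "norm (R t x) \<le> integral {- N..N} (\<lambda>s. M * exp (\<omega> * \<bar>s\<bar>)) * norm x"
      by simp
  qed
qed

text \<open>Shifting the integration variable gives
  \<open>T h (R t x) = R (h + t) x - R h x\<close>, which is differentiable in h even if the orbit
  of x is not.\<close>

lemma R_generator: "R t x \<in> D \<and> G (R t x) = T t x - x"
  unfolding generator_iff
proof -
  have "T h (R t x) = R (h + t) x - R h x" for h
  proof -
    have "T h (R t x) = int0 (\<lambda>s. T (h + s) x) t"
      unfolding R_def T_add by (rule int0_linear[symmetric, OF T_linear T_locally_integrable])
    also have "\<dots> = R (h + t) x - R (h + 0) x"
    proof (rule int0_vector_derivative)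
      fix s
      have "((\<lambda>t. R t x) \<circ> (\<lambda>s. h + s) has_vector_derivative 1 *\<^sub>R T (h + s) x) (at s)"
        by (rule vector_diff_chain_at[OF _ R_has_vector_derivative]) (auto intro!: derivative_eq_intros)
      then show "((\<lambda>s. R (h + s) x) has_vector_derivative T (h + s) x) (at s)"
        by (simp add: o_def)
    qed
    finally show ?thesis by simp
  qed
  moreover have "((\<lambda>h. R (h + t) x - R h x) has_vector_derivative T t x - x) (at 0)"
  proof (rule has_vector_derivative_diff)
    have "((\<lambda>t. R t x) \<circ> (\<lambda>s. s + t) has_vector_derivative 1 *\<^sub>R T (0 + t) x) (at 0)"
      by (rule vector_diff_chain_at[OF _ R_has_vector_derivative]) (auto intro!: derivative_eq_intros)
    then show "((\<lambda>h. R (h + t) x) has_vector_derivative T t x) (at 0)"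
      by (simp add: o_def)
    show "((\<lambda>h. R h x) has_vector_derivative x) (at 0)"
      using R_has_vector_derivative[of x 0] by simp
  qed
  ultimately show "((\<lambda>h. T h (R t x)) has_vector_derivative T t x - x) (at 0)"
    by simp
qed

text \<open>The graph of the generator. It turns out to be a closed complex subspace, so relations
  written as membership in it survive sums, integrals and limits together with their domain
  conditions.\<close>

definition \<Gamma> :: "('a \<times> 'a) set" where "\<Gamma> = {(x, z). x \<in> D \<and> G x = z}"

text \<open>The integrated orbit equation involves only the bounded operators \<open>T t\<close> and
  \<open>R t\<close>. Closedness and linearity of the graph can be read off from it.\<close>

lemma \<Gamma>_iff: "(x, z) \<in> \<Gamma> \<longleftrightarrow> (\<forall>t. T t x - x = R t z)"
proof
  assume "(x, z) \<in> \<Gamma>"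
  then have "((\<lambda>t. T t x) has_vector_derivative T t z) (at t)" for t
    using orbit_has_vector_derivative[of x t] by (auto simp: \<Gamma>_def)
  then have "int0 (\<lambda>t. T t z) t = T t x - T 0 x" for t
    by (rule int0_vector_derivative)
  then show "\<forall>t. T t x - x = R t z"
    by (simp add: R_def)
next
  assume "\<forall>t. T t x - x = R t z"
  then have eq: "T t x = x + R t z" for t
    by (simp add: algebra_simps)
  have "((\<lambda>t. x + R t z) has_vector_derivative 0 + T 0 z) (at 0)"
    by (intro has_vector_derivative_add has_vector_derivative_const R_has_vector_derivative)
  then show "(x, z) \<in> \<Gamma>"
    unfolding \<Gamma>_def using generator_iff[of x z] by (simp add: eq)
qed

lemma \<Gamma>_closed: "closed \<Gamma>"
proof -
  have eq: "\<Gamma> = {p. \<forall>t. T t (fst p) - fst p = R t (snd p)}"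
    using \<Gamma>_iff by auto
  show ?thesis
    unfolding eq
    by (intro closed_Collect_all closed_Collect_eq continuous_intros
        bounded_linear.continuous_on[OF T_linear] bounded_linear.continuous_on[OF R_linear])
qed

lemma \<Gamma>_scaleC: "(x, z) \<in> \<Gamma> \<Longrightarrow> (c *\<^sub>C x, c *\<^sub>C z) \<in> \<Gamma>"
  by (simp add: \<Gamma>_iff T_scaleC R_scaleC flip: scaleC_simps(6))

lemma \<Gamma>_add: "(x, z) \<in> \<Gamma> \<Longrightarrow> (x', z') \<in> \<Gamma> \<Longrightarrow> (x + x', z + z') \<in> \<Gamma>"
  by (simp add: \<Gamma>_iff T_plus_right
      linear_add[OF bounded_linear.linear[OF R_linear], symmetric] algebra_simps)

lemma \<Gamma>_subspace: "subspace \<Gamma>"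
proof (rule subspaceI)
  show "0 \<in> \<Gamma>"
    using \<Gamma>_iff[of 0 0] T_zero_right linear_0[OF bounded_linear.linear[OF R_linear]]
    by (simp add: zero_prod_def)
  show "x + y \<in> \<Gamma>" if "x \<in> \<Gamma>" "y \<in> \<Gamma>" for x y
    using that \<Gamma>_add[of "fst x" "snd x" "fst y" "snd y"] by (simp add: plus_prod_def)
  show "c *\<^sub>R x \<in> \<Gamma>" if "x \<in> \<Gamma>" for c x
    using that \<Gamma>_scaleC[of "fst x" "snd x" "complex_of_real c"] by (simp add: scaleR_prod_def scaleC_of_real)
qed

lemma \<Gamma>_diff: "(x, z) \<in> \<Gamma> \<Longrightarrow> (x', z') \<in> \<Gamma> \<Longrightarrow> (x - x', z - z') \<in> \<Gamma>"
  using subspace_diff[OF \<Gamma>_subspace, of "(x, z)" "(x', z')"] by simp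

lemmas int0_\<Gamma> = int0_in_closed_graph[OF \<Gamma>_subspace \<Gamma>_closed]

text \<open>The convolution of the group with F. Factoring out \<open>T t\<close>, possible because
  negative times are available, leaves an integrand independent of t, so that continuity in t is
  immediate.\<close>

definition conv :: "(real \<Rightarrow> 'a) \<Rightarrow> real \<Rightarrow> 'a" where
  "conv F t = T t (int0 (\<lambda>s. T (- s) (F s)) t)"

lemma T_neg_approximable: "L1_approximable F \<Longrightarrow> L1_approximable (\<lambda>s. T (- s) (F s))"
  by (rule L1_approximable_strongly_cont[OF T_neg_strongly_cont])

lemma conv_eq:
  assumes F: "L1_approximable F"
  shows "locally_integrable (\<lambda>s. T (t - s) (F s))" "conv F t = int0 (\<lambda>s. T (t - s) (F s)) t"
proof -
  have eq: "(\<lambda>s. T (t - s) (F s)) = (\<lambda>s. T t (T (- s) (F s)))"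
    by (simp flip: T_add)
  note l = L1_approximable_locally_integrable[OF T_neg_approximable[OF F]]
  show "locally_integrable (\<lambda>s. T (t - s) (F s))"
    unfolding eq by (rule locally_integrable_linear[OF T_linear l])
  show "conv F t = int0 (\<lambda>s. T (t - s) (F s)) t"
    unfolding eq conv_def by (rule int0_linear[symmetric, OF T_linear l])
qed

lemma conv_cont:
  assumes F: "L1_approximable F"
  shows "continuous_on UNIV (conv F)"
  unfolding conv_def[abs_def]
  by (rule strongly_cont_continuous[OF T_strongly_cont
        continuous_int0[OF L1_approximable_locally_integrable[OF T_neg_approximable[OF F]]]])

text \<open>Since \<open>T (t - s) = T t \<circ> T (- s)\<close>, integrating the convolution is an integration by parts
  for the pair \<open>R\<close>, \<open>T\<close>; no interchange of integrals is needed.\<close>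

lemma int0_conv_generator:
  assumes F: "L1_approximable F"
  shows "(int0 (conv F) t, conv F t - int0 F t) \<in> \<Gamma>"
proof -
  define f where "f s = T (- s) (F s)" for s
  have f_eq: "(\<lambda>s. T (- s) (F s)) = f"
    by (simp add: f_def[abs_def])
  have f: "L1_approximable f"
    unfolding f_def by (rule T_neg_approximable[OF F])
  have fi: "locally_integrable f" and Fi: "locally_integrable F"
    using f F by (auto intro: L1_approximable_locally_integrable)
  have "int0 (\<lambda>s. R s (f s)) t = R t (int0 f t) - int0 (\<lambda>s. T s (int0 f s)) t"
    by (rule int0_by_parts[OF R_strongly_cont T_strongly_cont R_has_vector_derivative f])
  then have eq: "int0 (conv F) t = R t (int0 f t) - int0 (\<lambda>s. R s (f s)) t"
    by (simp add: conv_def[abs_def] f_eq)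
  \<comment> \<open>This pair and the pair \<open>2\<close> below both contain
    \<open>- int0 f t\<close> in the second component; it cancels in their difference.\<close>
  have 1: "(R t (int0 f t), conv F t - int0 f t) \<in> \<Gamma>"
    using R_generator[of t "int0 f t"] by (simp add: \<Gamma>_def conv_def f_eq)
  have "(R s (f s), F s - f s) \<in> \<Gamma>" for s
    using R_generator[of s "f s"] by (simp add: \<Gamma>_def f_def)
  then have "(int0 (\<lambda>s. R s (f s)) t, int0 (\<lambda>s. F s - f s) t) \<in> \<Gamma>"
    by (intro int0_\<Gamma> locally_integrable_diff Fi fi
        L1_approximable_locally_integrable[OF L1_approximable_strongly_cont[OF R_strongly_cont f]])
  then have 2: "(int0 (\<lambda>s. R s (f s)) t, int0 F t - int0 f t) \<in> \<Gamma>"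
    by (simp add: int0_diff[OF Fi fi])
  from \<Gamma>_diff[OF 1 2] show ?thesis
    by (simp add: eq)
qed

section \<open>Mild solutions: integrated equation, regularity, uniqueness\<close>

definition mild :: "(real \<Rightarrow> 'a) \<Rightarrow> 'a \<Rightarrow> real \<Rightarrow> 'a" where
  "mild F p t = T t p + conv F t"

lemma mild_cont: "L1_approximable F \<Longrightarrow> continuous_on UNIV (mild F p)"
  unfolding mild_def[abs_def] by (intro continuous_on_add T_cont conv_cont)

lemma int0_mild_generator:
  assumes F: "L1_approximable F"
  shows "(int0 (mild F p) t, mild F p t - p - int0 F t) \<in> \<Gamma>"
proof -
  have "(R t p, T t p - p) \<in> \<Gamma>"
    using R_generator[of t p] by (simp add: \<Gamma>_def)
  from \<Gamma>_add[OF this int0_conv_generator[OF F, of t]]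
  have "(R t p + int0 (conv F) t, T t p - p + (conv F t - int0 F t)) \<in> \<Gamma>" .
  moreover have "int0 (mild F p) t = R t p + int0 (conv F) t"
    unfolding mild_def[abs_def] R_def
    by (rule int0_add[OF T_locally_integrable locally_integrable_continuous[OF conv_cont[OF F]]])
  ultimately show ?thesis
    by (simp add: mild_def algebra_simps)
qed

text \<open>Since the generator maps the integral of the mild solution to that of \<open>g\<close>,
  the integrated equation becomes \<open>mild F p t = p + int0 g t + int0 F t\<close>, whose right
  side can be differentiated.\<close>

lemma mild_has_vector_derivative:
  assumes F: "continuous_on UNIV F" and g: "continuous_on UNIV g"
    and gr: "\<And>t. (mild F p t, g t) \<in> \<Gamma>"
  shows "(mild F p has_vector_derivative g t + F t) (at t)"
proof -
  have Fa: "L1_approximable F"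
    by (rule L1_approximable_continuous[OF F])
  have "(int0 (mild F p) t, int0 g t) \<in> \<Gamma>" for t
    by (rule int0_\<Gamma>[OF locally_integrable_continuous[OF mild_cont[OF Fa]] locally_integrable_continuous[OF g] gr])
  then have "int0 g t = mild F p t - p - int0 F t" for t
    using int0_mild_generator[OF Fa, of p t] by (simp add: \<Gamma>_def)
  then have eq: "mild F p = (\<lambda>t. p + int0 g t + int0 F t)"
    by (auto simp: algebra_simps)
  show ?thesis
    unfolding eq
    using has_vector_derivative_add[OF has_vector_derivative_add[OF has_vector_derivative_const
          int0_has_vector_derivative[OF g]] int0_has_vector_derivative[OF F]]
    by simp
qed

lemma T_\<Gamma>: "(x, z) \<in> \<Gamma> \<Longrightarrow> (T t x, T t z) \<in> \<Gamma>"
proof -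
  assume "(x, z) \<in> \<Gamma>"
  then have "T t (T s x - x) = T t (R s z)" for s
    by (simp add: \<Gamma>_iff)
  moreover have "T t (R s z) = R s (T t z)" for s
    unfolding R_def
    by (subst int0_linear[symmetric, OF T_linear T_locally_integrable]) (simp add: add.commute flip: T_add)
  moreover have "T t (T s x) = T s (T t x)" for s
    by (simp add: add.commute flip: T_add)
  ultimately show ?thesis
    by (simp add: \<Gamma>_iff T_minus_right)
qed

text \<open>Meant for sources with values in Y, for which (0, f s) lies in the domain of the
  generator. The group maps the graph into itself, and the integral does not leave it.\<close>

lemma conv_in_domain_of_domain_valued:
  assumes F: "L1_approximable F" and g: "L1_approximable g" and gr: "\<And>s. (F s, g s) \<in> \<Gamma>"
  shows "(conv F t, conv g t) \<in> \<Gamma>"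
  unfolding conv_eq(2)[OF F] conv_eq(2)[OF g]
  by (intro int0_\<Gamma> conv_eq(1) F g T_\<Gamma> gr)

text \<open>Smoothness in time replaces smoothness in space: integration by parts puts the
  derivative on \<open>F\<close> and the smoothing integrated group in place of the group.\<close>

lemma conv_in_domain_of_C1:
  assumes F': "continuous_on UNIV F'" and d: "\<And>t. (F has_vector_derivative F' t) (at t)"
  shows "(conv F t, T t (F 0) + conv F' t - F t) \<in> \<Gamma>"
proof -
  have Fc: "continuous_on UNIV F"
    using d by (auto intro!: continuous_at_imp_continuous_on has_vector_derivative_continuous)
  have Fa: "L1_approximable F" and F'a: "L1_approximable F'"
    using Fc F' by (auto intro: L1_approximable_continuous)
  \<comment> \<open>The antiderivative of \<open>\<lambda>s. T (- s) x\<close> that vanishes at s =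
    0. Its values lie in the domain of the generator.\<close>
  define K where "K s = (\<lambda>x. - R (- s) x)" for s
  have Kc: "strongly_cont K"
    unfolding K_def
    by (rule strongly_cont_compose[OF strongly_cont_const[OF bounded_linear_minus[OF bounded_linear_ident]]
          strongly_cont_reparam[OF R_strongly_cont]]) (intro continuous_intros)
  have Kd: "((\<lambda>s. K s x) has_vector_derivative T (- s) x) (at s)" for s x
  proof -
    have "((\<lambda>t. R t x) \<circ> uminus has_vector_derivative (- 1) *\<^sub>R T (- s) x) (at s)"
      by (rule vector_diff_chain_at[OF _ R_has_vector_derivative]) (auto intro!: derivative_eq_intros)
    from has_vector_derivative_minus[OF this] show ?thesis
      by (simp add: K_def o_def)
  qed
  have "int0 (\<lambda>s. K s (F' s)) t = K t (int0 F' t) - int0 (\<lambda>s. T (- s) (int0 F' s)) t"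
    by (rule int0_by_parts[OF Kc T_neg_strongly_cont Kd F'a])
  moreover have I: "int0 F' s = F s - F 0" for s
    by (rule int0_vector_derivative[OF d])
  moreover have "int0 (\<lambda>s. T (- s) (F s - F 0)) t = int0 (\<lambda>s. T (- s) (F s)) t - int0 (\<lambda>s. T (- s) (F 0)) t"
    unfolding T_minus_right
    by (intro int0_diff L1_approximable_locally_integrable T_neg_approximable Fa L1_approximable_continuous continuous_on_const)
  moreover have "int0 (\<lambda>s. T (- s) (F 0)) t = K t (F 0) - K 0 (F 0)"
    by (rule int0_vector_derivative[OF Kd])
  moreover have "K 0 (F 0) = 0" "K t (F t - F 0) = K t (F t) - K t (F 0)"
    unfolding K_def by (simp_all add: R_def[of 0] linear_diff[OF bounded_linear.linear[OF R_linear]])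
  ultimately have c: "int0 (\<lambda>s. T (- s) (F s)) t = K t (F t) - int0 (\<lambda>s. K s (F' s)) t"
    by simp
  have KG: "(K s x, x - T (- s) x) \<in> \<Gamma>" for s x
    using R_generator[of "- s" x] \<Gamma>_scaleC[of "R (- s) x" "T (- s) x - x" "- 1"]
    by (simp add: \<Gamma>_def K_def scaleC_simps scaleC_one)
  have TFi: "locally_integrable (\<lambda>s. T (- s) (F' s))"
    by (rule L1_approximable_locally_integrable[OF T_neg_approximable[OF F'a]])
  have F'i: "locally_integrable F'"
    by (rule locally_integrable_continuous[OF F'])
  have "(int0 (\<lambda>s. K s (F' s)) t, int0 (\<lambda>s. F' s - T (- s) (F' s)) t) \<in> \<Gamma>"
    by (intro int0_\<Gamma> KG locally_integrable_diff TFi F'i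
        L1_approximable_locally_integrable[OF L1_approximable_strongly_cont[OF Kc F'a]])
  then have "(int0 (\<lambda>s. K s (F' s)) t, F t - F 0 - int0 (\<lambda>s. T (- s) (F' s)) t) \<in> \<Gamma>"
    by (simp add: int0_diff[OF F'i TFi] I)
  from T_\<Gamma>[OF \<Gamma>_diff[OF KG[of t "F t"] this], of t]
  have "(conv F t, T t (F t - T (- t) (F t) - (F t - F 0 - int0 (\<lambda>s. T (- s) (F' s)) t))) \<in> \<Gamma>"
    by (simp add: conv_def c)
  then show ?thesis
    by (simp add: T_minus_right conv_def algebra_simps T_plus_right)
qed

text \<open>Transporting the solution back along the group gives \<open>T (- s) (V s)\<close>, whose
  derivative is 0 by the product rule. Hence it keeps its initial value 0, and \<open>T t\<close> is
  injective.\<close>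

lemma homogeneous_unique:
  assumes V: "\<And>t. (V has_vector_derivative V' t) (at t)" and gr: "\<And>t. (V t, V' t) \<in> \<Gamma>" and 0: "V 0 = 0"
  shows "V t = 0"
proof -
  have "((\<lambda>s. T (- s) (V s)) has_vector_derivative - T (- t) (V' t) + T (- t) (V' t)) (at t)" for t
  proof (rule strongly_cont_product_rule[OF T_neg_strongly_cont _ V])
    have "((\<lambda>s. T s (V t)) \<circ> uminus has_vector_derivative (- 1) *\<^sub>R T (- t) (V' t)) (at t)"
    proof (rule vector_diff_chain_at)
      show "((\<lambda>s. T s (V t)) has_vector_derivative T (- t) (V' t)) (at (- t))"
        using orbit_has_vector_derivative[of "V t" "- t"] gr[of t] by (auto simp: \<Gamma>_def)
    qed (auto intro!: derivative_eq_intros)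
    then show "((\<lambda>s. T (- s) (V t)) has_vector_derivative - T (- t) (V' t)) (at t)"
      by (simp add: o_def)
  qed
  then have "int0 (\<lambda>t. - T (- t) (V' t) + T (- t) (V' t)) t = T (- t) (V t) - T (- 0) (V 0)"
    by (rule int0_vector_derivative)
  moreover have "int0 (\<lambda>t. - T (- t) (V' t) + T (- t) (V' t)) t = 0"
    by (simp add: integral_from_0_def)
  ultimately have "T (- t) (V t) = 0"
    using 0 by simp
  then have "T t (T (- t) (V t)) = 0"
    by (simp add: T_zero_right)
  then show ?thesis by simp
qed

text \<open>By uniqueness an eigenvector has the orbit exp(z t) V. In one of the two time directions
  this grows faster than the bound for the group allows.\<close>

lemma no_eigenvalue:
  assumes gr: "(V, z *\<^sub>C V) \<in> \<Gamma>" and z: "\<omega> < \<bar>Re z\<bar>"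
  shows "V = 0"
proof (rule ccontr)
  assume "V \<noteq> 0"
  define e where "e t = exp (z * complex_of_real t)" for t
  have ed: "(e has_vector_derivative z * e t) (at t)" for t
    unfolding e_def by (rule exp_has_vector_derivative)
  have "T t V = e t *\<^sub>C V" for t
  proof -
    have "((\<lambda>s. e s *\<^sub>C V - T s V) has_vector_derivative (z * e t) *\<^sub>C V - T t (z *\<^sub>C V)) (at t)" for t
    proof (rule has_vector_derivative_diff)
      show "((\<lambda>s. e s *\<^sub>C V) has_vector_derivative (z * e t) *\<^sub>C V) (at t)"
        by (rule bounded_linear.has_vector_derivative[OF
              bounded_bilinear.bounded_linear_left[OF bounded_bilinear_scaleC] ed])
      show "((\<lambda>s. T s V) has_vector_derivative T t (z *\<^sub>C V)) (at t)"
        using orbit_has_vector_derivative[of V t] gr by (auto simp: \<Gamma>_def)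
    qed
    moreover have "(e t *\<^sub>C V - T t V, (z * e t) *\<^sub>C V - T t (z *\<^sub>C V)) \<in> \<Gamma>" for t
      using \<Gamma>_diff[OF \<Gamma>_scaleC[OF gr, of "e t"] T_\<Gamma>[OF gr, of t]] by (simp add: scaleC_scaleC mult.commute)
    ultimately have "e t *\<^sub>C V - T t V = 0"
      by (rule homogeneous_unique) (simp add: e_def scaleC_one)
    then show ?thesis by simp
  qed
  then have "norm (e t *\<^sub>C V) \<le> M * exp (\<omega> * \<bar>t\<bar>) * norm V" for t
    using norm_T_le[of t V] by simp
  then have e: "exp (Re z * t) \<le> M * exp (\<omega> * \<bar>t\<bar>)" for t
    using \<open>V \<noteq> 0\<close> by (simp add: norm_scaleC e_def)
  define c where "c = \<bar>Re z\<bar> - \<omega>"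
  have c: "c > 0"
    using z by (simp add: c_def)
  have "exp (c * s) \<le> M" if "s \<ge> 0" for s
  proof -
    have "exp (\<bar>Re z\<bar> * s) \<le> M * exp (\<omega> * s)"
      \<comment> \<open>The direction of time is chosen according to the sign of Re z.\<close>
      using e[of "if Re z \<ge> 0 then s else - s"] that by (auto split: if_splits)
    then show ?thesis
      by (simp add: c_def left_diff_distrib exp_diff field_simps)
  qed
  \<comment> \<open>At s = |M| / c the inequality 1 + c s \<le> exp (c s) yields 1 + |M| \<le>
    M.\<close>
  then have "1 + c * (\<bar>M\<bar> / c) \<le> M"
    by (rule order_trans[OF exp_ge_add_one_self]) (use c in simp)
  then show False
    using c by simp
qed

text \<open>Integration by parts against the exponential weight converts the relation for the
  integral of the mild solution into one for its truncated transform. No growth bound is involved,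
  and \<tau> may have either sign.\<close>

lemma truncated_laplace_generator:
  fixes F :: "real \<Rightarrow> 'a" and z :: complex
  assumes F: "L1_approximable F"
  defines "E \<equiv> \<lambda>t. decay z t"
  shows "(int0 (\<lambda>t. E t *\<^sub>C mild F p t) \<tau>,
      E \<tau> *\<^sub>C mild F p \<tau> + z *\<^sub>C int0 (\<lambda>t. E t *\<^sub>C mild F p t) \<tau> - p - int0 (\<lambda>t. E t *\<^sub>C F t) \<tau>) \<in> \<Gamma>"
proof -
  define E' where "E' t = - z * E t" for t
  have Ec: "continuous_on UNIV E" and E'c: "continuous_on UNIV E'"
    unfolding E_def E'_def by (intro continuous_intros)+
  have Ed: "(E has_vector_derivative E' t) (at t)" for t
    unfolding E_def E'_def using exp_has_vector_derivative[of "- z" t] by simp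
  have Ed': "((\<lambda>s. E s *\<^sub>C x) has_vector_derivative E' t *\<^sub>C x) (at t)" for t and x :: 'a
    by (rule bounded_linear.has_vector_derivative[OF
          bounded_bilinear.bounded_linear_left[OF bounded_bilinear_scaleC] Ed])
  have parts: "int0 (\<lambda>s. E s *\<^sub>C f s) t = E t *\<^sub>C int0 f t - int0 (\<lambda>s. E' s *\<^sub>C int0 f s) t"
    if "L1_approximable f" for f :: "real \<Rightarrow> 'a" and t
    by (rule int0_by_parts[OF strongly_cont_scaleC[OF Ec] strongly_cont_scaleC[OF E'c] Ed' that])
  have li: "locally_integrable (\<lambda>s. E' s *\<^sub>C f s)" if "continuous_on UNIV f" for f :: "real \<Rightarrow> 'a"
    by (rule locally_integrable_continuous[OF strongly_cont_continuous[OF strongly_cont_scaleC[OF E'c] that]])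
  define U where "U = mild F p"
  have Uc: "continuous_on UNIV U"
    unfolding U_def by (rule mild_cont[OF F])
  have Ua: "L1_approximable U"
    by (rule L1_approximable_continuous[OF Uc])
  define J where "J t = int0 F t" for t
  have Jc: "continuous_on UNIV J"
    unfolding J_def[abs_def] by (rule continuous_int0[OF L1_approximable_locally_integrable[OF F]])
  have V: "(int0 U t, U t - p - J t) \<in> \<Gamma>" for t
    unfolding U_def J_def by (rule int0_mild_generator[OF F])
  have Hc: "continuous_on UNIV (\<lambda>s. U s - p - J s)"
    by (intro continuous_intros Uc Jc)
  have "(int0 (\<lambda>s. E' s *\<^sub>C int0 U s) \<tau>, int0 (\<lambda>s. E' s *\<^sub>C (U s - p - J s)) \<tau>) \<in> \<Gamma>"
    by (intro int0_\<Gamma> li Hc continuous_int0 locally_integrable_continuous Uc \<Gamma>_scaleC V)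
  from \<Gamma>_diff[OF \<Gamma>_scaleC[OF V[of \<tau>], of "E \<tau>"] this]
  have 1: "(int0 (\<lambda>s. E s *\<^sub>C U s) \<tau>, E \<tau> *\<^sub>C (U \<tau> - p - J \<tau>) - int0 (\<lambda>s. E' s *\<^sub>C (U s - p - J s)) \<tau>) \<in> \<Gamma>"
    by (simp add: parts[OF Ua])
  have "int0 (\<lambda>s. E' s *\<^sub>C (U s - p - J s)) \<tau>
    = int0 (\<lambda>s. E' s *\<^sub>C U s) \<tau> - int0 (\<lambda>s. E' s *\<^sub>C p) \<tau> - int0 (\<lambda>s. E' s *\<^sub>C J s) \<tau>"
    unfolding scaleC_simps
    by (subst int0_diff int0_diff[OF li li] | intro locally_integrable_diff li Uc Jc continuous_on_const refl)+
  moreover have "int0 (\<lambda>s. E' s *\<^sub>C p) \<tau> = E \<tau> *\<^sub>C p - E 0 *\<^sub>C p"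
    by (rule int0_vector_derivative[OF Ed'])
  moreover have "E 0 *\<^sub>C p = p"
    by (simp add: E_def scaleC_one)
  moreover have "int0 (\<lambda>s. E s *\<^sub>C F s) \<tau> = E \<tau> *\<^sub>C J \<tau> - int0 (\<lambda>s. E' s *\<^sub>C J s) \<tau>"
    unfolding J_def by (rule parts[OF F])
  moreover have "int0 (\<lambda>s. E' s *\<^sub>C U s) \<tau> = - z *\<^sub>C int0 (\<lambda>s. E s *\<^sub>C U s) \<tau>"
  proof -
    have "int0 (\<lambda>s. (- z) *\<^sub>C (E s *\<^sub>C U s)) \<tau> = (- z) *\<^sub>C int0 (\<lambda>s. E s *\<^sub>C U s) \<tau>"
      by (rule int0_linear[OF bounded_bilinear.bounded_linear_right[OF bounded_bilinear_scaleC]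
            locally_integrable_continuous[OF strongly_cont_continuous[OF strongly_cont_scaleC[OF Ec] Uc]]])
    then show ?thesis
      by (simp add: E'_def scaleC_scaleC)
  qed
  ultimately have "E \<tau> *\<^sub>C (U \<tau> - p - J \<tau>) - int0 (\<lambda>s. E' s *\<^sub>C (U s - p - J s)) \<tau>
     = E \<tau> *\<^sub>C U \<tau> + z *\<^sub>C int0 (\<lambda>s. E s *\<^sub>C U s) \<tau> - p - int0 (\<lambda>s. E s *\<^sub>C F s) \<tau>"
    by (simp only: scaleC_simps(3,6)) (simp add: algebra_simps)
  with 1 show ?thesis
    by (simp add: U_def)
qed

text \<open>Closedness of the graph allows the limit in the truncated relation; the boundary term is
  assumed to vanish. Here \<open>B\<close> is a limit filter: \<open>at_top\<close> gives
  transforms, and \<open>at_bot\<close> those of reflected functions.\<close>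

lemma laplace_generator:
  assumes F: "L1_approximable F" and nb: "B \<noteq> bot"
    and U: "((\<lambda>\<tau>. decay z \<tau> *\<^sub>C mild F p \<tau>) \<longlongrightarrow> 0) B"
    and u: "(int0 (\<lambda>t. decay z t *\<^sub>C mild F p t) \<longlongrightarrow> u) B"
    and f: "(int0 (\<lambda>t. decay z t *\<^sub>C F t) \<longlongrightarrow> f) B"
  shows "(u, z *\<^sub>C u - p - f) \<in> \<Gamma>"
proof -
  have "((\<lambda>\<tau>. (int0 (\<lambda>t. decay z t *\<^sub>C mild F p t) \<tau>,
      decay z \<tau> *\<^sub>C mild F p \<tau>
      + z *\<^sub>C int0 (\<lambda>t. decay z t *\<^sub>C mild F p t) \<tau> - p
      - int0 (\<lambda>t. decay z t *\<^sub>C F t) \<tau>))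
     \<longlongrightarrow> (u, 0 + z *\<^sub>C u - p - f)) B"
    by (intro tendsto_Pair tendsto_diff tendsto_add tendsto_const U u f
        bounded_linear.tendsto[OF bounded_bilinear.bounded_linear_right[OF bounded_bilinear_scaleC]])
  then have "(u, 0 + z *\<^sub>C u - p - f) \<in> \<Gamma>"
    by (rule Lim_in_closed_set[OF \<Gamma>_closed _ nb, rotated]) (simp add: truncated_laplace_generator[OF F])
  then show ?thesis by simp
qed

text \<open>For s between 0 and t the integrand is at most |M| K exp (\<omega> |t|) exp ((\<mu> -
  \<omega>) |s|). Integrating the last factor restores the rate \<mu>, at the price of the
  denominator \<mu> - \<omega>.\<close>

lemma norm_conv_le:
  assumes F: "L1_approximable F" and K: "\<And>t. norm (F t) \<le> K * exp (\<mu> * \<bar>t\<bar>)" and \<mu>: "\<omega> < \<mu>"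
  shows "norm (conv F t) \<le> \<bar>M\<bar> * K / (\<mu> - \<omega>) * exp (\<mu> * \<bar>t\<bar>)"
proof -
  define c where "c = \<mu> - \<omega>"
  define h where "h s = \<bar>M\<bar> * K * exp (\<omega> * \<bar>t\<bar>) * exp (c * s)" for s
  define H where "H s = \<bar>M\<bar> * K * exp (\<omega> * \<bar>t\<bar>) * exp (c * s) / c" for s
  have c: "c > 0"
    using \<mu> by (simp add: c_def)
  have K0: "K \<ge> 0"
    using order_trans[OF norm_ge_zero K[of 0]] by simp
  have "(H has_vector_derivative h s) (at s within S)" for s S
    unfolding H_def h_def has_real_derivative_iff_has_vector_derivative[symmetric]
    using c by (auto intro!: derivative_eq_intros)
  then have hI: "(h has_integral H \<bar>t\<bar> - H 0) {0..\<bar>t\<bar>}"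
    by (rule fundamental_theorem_of_calculus[OF abs_ge_zero])
  have "norm (conv F t) \<le> integral {0..\<bar>t\<bar>} h"
    unfolding conv_eq(2)[OF F]
  proof (rule norm_int0_le_directed[OF conv_eq(1)[OF F] has_integral_integrable[OF hI]])
    fix s assume s: "s \<in> {0..\<bar>t\<bar>}"
    have ab: "\<bar>t - sgn t * s\<bar> = \<bar>t\<bar> - s" "\<bar>sgn t * s\<bar> \<le> s" "s = 0 \<or> \<bar>sgn t * s\<bar> = s"
      using s by (auto simp: sgn_real_def)
    have "norm (T (t - sgn t * s) (F (sgn t * s))) \<le> M * exp (\<omega> * \<bar>t - sgn t * s\<bar>) * norm (F (sgn t * s))"
      by (rule norm_T_le)
    also have "\<dots> \<le> \<bar>M\<bar> * exp (\<omega> * (\<bar>t\<bar> - s)) * (K * exp (\<mu> * \<bar>sgn t * s\<bar>))"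
      unfolding ab(1) by (intro mult_mono K) auto
    also have "exp (\<mu> * \<bar>sgn t * s\<bar>) = exp (\<mu> * s)"
      using ab(3) by auto
    also have "\<bar>M\<bar> * exp (\<omega> * (\<bar>t\<bar> - s)) * (K * exp (\<mu> * s)) = h s"
      by (simp add: h_def c_def algebra_simps exp_add[symmetric])
    finally show "norm (T (t - sgn t * s) (F (sgn t * s))) \<le> h s" .
  qed
  also have "\<dots> = H \<bar>t\<bar> - H 0"
    by (rule integral_unique[OF hI])
  also have "\<dots> \<le> H \<bar>t\<bar>"
    using c K0 by (simp add: H_def)
  also have "H \<bar>t\<bar> = \<bar>M\<bar> * K / (\<mu> - \<omega>) * exp (\<mu> * \<bar>t\<bar>)"
    by (simp add: H_def c_def algebra_simps exp_add[symmetric])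
  finally show ?thesis .
qed

end

section \<open>Closed operators\<close>

text \<open>By Baire's theorem some set \<open>{x. norm (L x) \<le> n}\<close> is dense near a point, so every vector
  can be approximated to relative precision \<open>1 / 2\<close> with control of \<open>L\<close>; iterating this gives the bound.\<close>

lemma closed_graph_bounded_aux:
  fixes L :: "'a::banach \<Rightarrow> 'b::banach"
  assumes S: "subspace S" "closed S"
    and add: "\<And>x y. x \<in> S \<Longrightarrow> y \<in> S \<Longrightarrow> L (x + y) = L x + L y"
    and scale: "\<And>r x. x \<in> S \<Longrightarrow> L (r *\<^sub>R x) = r *\<^sub>R L x"
  obtains c where "c \<ge> 0"
    "\<And>y. y \<in> S \<Longrightarrow> \<exists>x\<in>S. norm (y - x) \<le> norm y / 2 \<and> norm (L x) \<le> c * norm y"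
proof -
  define F where "F n = {x \<in> S. norm (L x) \<le> real n}" for n :: nat
  \<comment> \<open>Baire's theorem is used in the relative topology of S, which is completely
    metrizable since S is closed.\<close>
  let ?X = "top_of_set S"
  have diff: "L (x - y) = L x - L y" if "x \<in> S" "y \<in> S" for x y
    using add[of "x - y" y] that subspace_diff[OF S(1)] by simp
  have L0: "L 0 = 0"
    using scale[of 0 0] subspace_0[OF S(1)] by simp
  have FS: "closure (F n) \<subseteq> S" for n
    by (rule closure_minimal) (auto simp: F_def S)
  have "S \<subseteq> (\<Union>n. closure (F n))"
  proof
    fix x assume "x \<in> S"
    obtain n where "norm (L x) \<le> real n"
      using real_arch_simple by blast
    then have "x \<in> F n"
      using \<open>x \<in> S\<close> by (simp add: F_def)
    then show "x \<in> (\<Union>n. closure (F n))"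
      using closure_subset by blast
  qed
  then have "(\<Union>n. closure (F n)) = S"
    using FS by blast
  moreover have "?X interior_of S = S"
    by (metis interior_of_topspace topspace_euclidean_subtopology)
  moreover have "S \<noteq> {}"
    using subspace_0[OF S(1)] by auto
  moreover have "?X interior_of (\<Union> (range (\<lambda>n. closure (F n)))) = {}"
    if "\<And>n. ?X interior_of (closure (F n)) = {}"
  proof (rule Baire_category_alt)
    show "completely_metrizable_space ?X \<or> locally_compact_space ?X \<and> regular_space ?X"
      using completely_metrizable_space_closedin[OF completely_metrizable_space_euclidean, of S] S(2) by simp
    show "closedin ?X W \<and> ?X interior_of W = {}" if "W \<in> range (\<lambda>n. closure (F n))" for W
      using that \<open>\<And>n. ?X interior_of (closure (F n)) = {}\<close> FS by (auto intro!: closed_subset)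
  qed simp
  ultimately obtain n where "?X interior_of (closure (F n)) \<noteq> {}"
    by auto
  then obtain x0 U where U: "openin ?X U" "x0 \<in> U" "U \<subseteq> closure (F n)"
    unfolding interior_of_def by auto
  obtain r where r: "r > 0" "ball x0 r \<inter> S \<subseteq> U"
    using U(1,2) unfolding openin_contains_ball by blast
  have x0S: "x0 \<in> S"
    using U FS by blast
  \<comment> \<open>Both \<open>x0 + y\<close> and \<open>x0\<close> are limits of points of
    \<open>F n\<close>. The difference of two such points approximates y, and L is at most 2 n in
    norm on it.\<close>
  have near: "\<exists>x\<in>S. norm (y - x) < e \<and> norm (L x) \<le> 2 * real n" if y: "y \<in> S" "norm y < r" and e: "e > 0" for y e
  proof -
    have "x0 + y \<in> ball x0 r \<inter> S"
      using y x0S subspace_add[OF S(1)] by (simp add: dist_norm)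
    then have "x0 + y \<in> closure (F n)" "x0 \<in> closure (F n)"
      using r(2) U by blast+
    then obtain p q where p: "p \<in> F n" "dist p (x0 + y) < e / 2" and q: "q \<in> F n" "dist q x0 < e / 2"
      using e unfolding closure_approachable by (meson half_gt_zero)
    have "norm (y - (p - q)) \<le> dist p (x0 + y) + dist q x0"
      using norm_triangle_ineq4[of "q - x0" "p - (x0 + y)"] by (simp add: dist_norm algebra_simps)
    moreover have "norm (L (p - q)) \<le> 2 * real n"
      using p(1) q(1) norm_triangle_ineq4[of "L p" "L q"] by (simp add: F_def diff)
    moreover have "p - q \<in> S"
      using p(1) q(1) subspace_diff[OF S(1)] by (simp add: F_def)
    ultimately show ?thesis
      using p(2) q(2) by (intro bexI[of _ "p - q"]) auto
  qed
  show ?thesis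
  proof (rule that[of "4 * real n / r"])
    show "4 * real n / r \<ge> 0"
      using r(1) by simp
    fix y assume y: "y \<in> S"
    show "\<exists>x\<in>S. norm (y - x) \<le> norm y / 2 \<and> norm (L x) \<le> 4 * real n / r * norm y"
    proof (cases "y = 0")
      case True
      then show ?thesis
        using L0 y by (intro bexI[of _ 0]) auto
    next
      case False
      \<comment> \<open>Scales y to norm r/2, inside the ball. Scaling back turns the precision r/4
        into half the norm of y, and the bound 2 n into 4 n / r times the norm of y.\<close>
      define k where "k = r / 2 / norm y"
      have k: "k > 0"
        using False r(1) by (simp add: k_def)
      have "norm (k *\<^sub>R y) < r"
        using False r(1) by (simp add: k_def)
      moreover have "r / 4 > 0"
        using r(1) by simp
      ultimately obtain x where x: "x \<in> S" "norm (k *\<^sub>R y - x) < r / 4" "norm (L x) \<le> 2 * real n"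
        using near[of "k *\<^sub>R y" "r / 4"] subspace_scale[OF S(1) y] by blast
      have "y - (1 / k) *\<^sub>R x = (1 / k) *\<^sub>R (k *\<^sub>R y - x)"
        using k by (simp add: scaleR_diff_right)
      then have "norm (y - (1 / k) *\<^sub>R x) = norm (k *\<^sub>R y - x) / k"
        using k by (simp del: scaleR_diff_right scaleR_right_diff_distrib)
      also have "\<dots> \<le> (r / 4) / k"
        using x(2) k by (intro divide_right_mono) auto
      also have "\<dots> = norm y / 2"
        using r(1) False by (simp add: k_def)
      finally have 1: "norm (y - (1 / k) *\<^sub>R x) \<le> norm y / 2" .
      have "norm (L ((1 / k) *\<^sub>R x)) = norm (L x) / k"
        using scale[OF x(1)] k by simp
      also have "\<dots> \<le> (2 * real n) / k"
        using x(3) k by (intro divide_right_mono) auto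
      also have "\<dots> = 4 * real n / r * norm y"
        using r(1) False by (simp add: k_def)
      finally show ?thesis
        using 1 subspace_scale[OF S(1) x(1)] by blast
    qed
  qed
qed

lemma closed_graph_bounded:
  fixes L :: "'a::banach \<Rightarrow> 'b::banach"
  assumes S: "subspace S" "closed S"
    and add: "\<And>x y. x \<in> S \<Longrightarrow> y \<in> S \<Longrightarrow> L (x + y) = L x + L y"
    and scale: "\<And>r x. x \<in> S \<Longrightarrow> L (r *\<^sub>R x) = r *\<^sub>R L x"
    and gr: "closed {(x, L x) | x. x \<in> S}"
  obtains K where "\<And>x. x \<in> S \<Longrightarrow> norm (L x) \<le> K * norm x"
proof -
  obtain c where c: "c \<ge> 0"
    "\<And>y. y \<in> S \<Longrightarrow> \<exists>x\<in>S. norm (y - x) \<le> norm y / 2 \<and> norm (L x) \<le> c * norm y"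
    using closed_graph_bounded_aux[OF S add scale] by metis
  define f where "f y = (SOME x. x \<in> S \<and> norm (y - x) \<le> norm y / 2 \<and> norm (L x) \<le> c * norm y)" for y
  have f: "f y \<in> S" "norm (y - f y) \<le> norm y / 2" "norm (L (f y)) \<le> c * norm y" if "y \<in> S" for y
  proof -
    have "\<exists>x. x \<in> S \<and> norm (y - x) \<le> norm y / 2 \<and> norm (L x) \<le> c * norm y"
      using c(2)[OF that] by blast
    from someI_ex[OF this] show "f y \<in> S" "norm (y - f y) \<le> norm y / 2" "norm (L (f y)) \<le> c * norm y"
      by (auto simp: f_def)
  qed
  show ?thesis
  \<comment> \<open>The factor 2 is the sum of the geometric series with ratio 1/2.\<close>
  proof (rule that[of "2 * c"])
    fix y assume y: "y \<in> S"
    \<comment> \<open>The residual after k approximation steps. It tends to 0 geometrically, while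
      the images under L of the corrections form an absolutely convergent series; the closed graph
      identifies its sum with L y.\<close>
    define \<rho> where "\<rho> k = ((\<lambda>x. x - f x) ^^ k) y" for k
    have \<rho>S: "\<rho> k \<in> S" for k
      by (induction k) (auto simp: \<rho>_def y f(1) subspace_diff[OF S(1)])
    have \<rho>Suc: "\<rho> (Suc k) = \<rho> k - f (\<rho> k)" for k
      by (simp add: \<rho>_def)
    have \<rho>le: "norm (\<rho> k) \<le> norm y * (1 / 2) ^ k" for k
    proof (induction k)
      case (Suc k)
      have "norm (\<rho> (Suc k)) \<le> norm (\<rho> k) / 2"
        unfolding \<rho>Suc by (rule f(2)[OF \<rho>S])
      then show ?case
        using Suc by simp
    qed (simp add: \<rho>_def)
    have part: "y - \<rho> k \<in> S \<and> L (y - \<rho> k) = (\<Sum>i<k. L (f (\<rho> i)))" for k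
    proof (induction k)
      case 0
      then show ?case
        using subspace_0[OF S(1)] scale[of 0 0] by (simp add: \<rho>_def)
    next
      case (Suc k)
      have eq: "y - \<rho> (Suc k) = (y - \<rho> k) + f (\<rho> k)"
        by (simp add: \<rho>Suc)
      show ?case
        unfolding eq using Suc add[of "y - \<rho> k" "f (\<rho> k)"] f(1)[OF \<rho>S] subspace_add[OF S(1)] by simp
    qed
    have Lle: "norm (L (f (\<rho> i))) \<le> (c * norm y) * (1 / 2) ^ i" for i
      using order_trans[OF f(3)[OF \<rho>S] mult_left_mono[OF \<rho>le c(1)]] by (simp add: mult.assoc)
    have geo: "summable (\<lambda>i. (c * norm y) * (1 / 2) ^ i)"
      by (intro summable_mult summable_geometric) simp
    have sm: "summable (\<lambda>i. L (f (\<rho> i)))"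
      by (rule summable_comparison_test'[OF geo]) (use Lle in auto)
    have "(\<lambda>k. L (y - \<rho> k)) \<longlonglongrightarrow> (\<Sum>i. L (f (\<rho> i)))"
      using summable_LIMSEQ[OF sm] part by simp
    moreover have "(\<lambda>k. y - \<rho> k) \<longlonglongrightarrow> y - 0"
    proof (intro tendsto_diff tendsto_const, rule Lim_null_comparison)
      show "eventually (\<lambda>k. norm (\<rho> k) \<le> norm y * (1 / 2) ^ k) sequentially"
        using \<rho>le by simp
      show "(\<lambda>k. norm y * (1 / 2) ^ k) \<longlonglongrightarrow> 0"
        by (intro tendsto_mult_right_zero LIMSEQ_power_zero) simp
    qed
    ultimately have "(\<lambda>k. (y - \<rho> k, L (y - \<rho> k))) \<longlonglongrightarrow> (y - 0, \<Sum>i. L (f (\<rho> i)))"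
      by (intro tendsto_Pair)
    moreover have "(y - \<rho> k, L (y - \<rho> k)) \<in> {(x, L x) | x. x \<in> S}" for k
      using part by blast
    ultimately have "(y - 0, \<Sum>i. L (f (\<rho> i))) \<in> {(x, L x) | x. x \<in> S}"
      by (intro Lim_in_closed_set[OF gr always_eventually trivial_limit_sequentially]) auto
    then have "norm (L y) = norm (\<Sum>i. L (f (\<rho> i)))"
      by simp
    also have "\<dots> \<le> (\<Sum>i. (c * norm y) * (1 / 2) ^ i)"
      by (rule norm_suminf_le[OF Lle geo])
    also have "\<dots> = (c * norm y) * (\<Sum>i. (1 / 2) ^ i)"
      by (rule suminf_mult) (simp add: summable_geometric)
    also have "\<dots> = 2 * c * norm y"
      by (simp add: suminf_geometric)
    finally show "norm (L y) \<le> 2 * c * norm y" .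
  qed
qed

section \<open>Closed operators and integrals\<close>

lemma csubspace_imp_subspace: "csubspace S \<Longrightarrow> subspace S"
  by (auto simp: csubspace_def subspace_def scaleR_scaleC)

lemma closed_operatorD:
  assumes "closed_operator D L"
  shows "subspace D" "\<And>x c. x \<in> D \<Longrightarrow> c *\<^sub>C x \<in> D"
    and "\<And>x y. x \<in> D \<Longrightarrow> y \<in> D \<Longrightarrow> L (x + y) = L x + L y"
    and "\<And>x c. x \<in> D \<Longrightarrow> L (c *\<^sub>C x) = c *\<^sub>C L x"
    and "\<And>x r. x \<in> D \<Longrightarrow> L (r *\<^sub>R x) = r *\<^sub>R L x"
    and "\<And>x y. x \<in> D \<Longrightarrow> y \<in> D \<Longrightarrow> L (x - y) = L x - L y"
    and "closed {(x, L x) | x. x \<in> D}" "subspace {(x, L x) | x. x \<in> D}"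
proof -
  show 1: "subspace D" and c: "\<And>x c. x \<in> D \<Longrightarrow> c *\<^sub>C x \<in> D"
    and a: "\<And>x y. x \<in> D \<Longrightarrow> y \<in> D \<Longrightarrow> L (x + y) = L x + L y"
    and s: "\<And>x c. x \<in> D \<Longrightarrow> L (c *\<^sub>C x) = c *\<^sub>C L x"
    and "closed {(x, L x) | x. x \<in> D}"
    using assms by (auto simp: closed_operator_def csubspace_imp_subspace csubspace_def)
  show r: "\<And>x r. x \<in> D \<Longrightarrow> L (r *\<^sub>R x) = r *\<^sub>R L x"
    using s by (simp add: scaleR_scaleC)
  show "L (x - y) = L x - L y" if "x \<in> D" "y \<in> D" for x y
    using a[of "x - y" y] that subspace_diff[OF 1] by simp
  show "subspace {(x, L x) | x. x \<in> D}"
  proof (rule subspaceI)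
    show "0 \<in> {(x, L x) | x. x \<in> D}"
      using subspace_0[OF 1] r[of 0 0] by (auto simp: zero_prod_def)
    show "p + q \<in> {(x, L x) | x. x \<in> D}" if "p \<in> {(x, L x) | x. x \<in> D}" "q \<in> {(x, L x) | x. x \<in> D}" for p q
      using that subspace_add[OF 1] a by force
    show "k *\<^sub>R p \<in> {(x, L x) | x. x \<in> D}" if "p \<in> {(x, L x) | x. x \<in> D}" for k p
      using that subspace_scale[OF 1] r by force
  qed
qed

lemma int0_closed_operator:
  fixes f :: "real \<Rightarrow> 'a::complex_banach"
  assumes L: "closed_operator D L" and f: "continuous_on UNIV f" and Lf: "continuous_on UNIV (\<lambda>s. L (f s))"
    and D: "\<And>s. f s \<in> D"
  shows "int0 f t \<in> D" "L (int0 f t) = int0 (\<lambda>s. L (f s)) t"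
proof -
  have "(int0 f t, int0 (\<lambda>s. L (f s)) t) \<in> {(x, L x) | x. x \<in> D}"
    by (rule int0_in_closed_graph[OF closed_operatorD(8,7)[OF L]
          locally_integrable_continuous[OF f] locally_integrable_continuous[OF Lf]]) (use D in blast)
  then show "int0 f t \<in> D" "L (int0 f t) = int0 (\<lambda>s. L (f s)) t"
    by auto
qed

text \<open>Cauchy's formula for repeated integrals: the boundary term of the integration by parts
  vanishes because the kernel is 0 at s = t.\<close>

lemma int0_kernel:
  fixes f :: "real \<Rightarrow> 'a::banach"
  assumes f: "L1_approximable f"
  shows "int0 (\<lambda>s. (t - s) *\<^sub>R f s) t = int0 (int0 f) t"
proof -
  have "int0 (\<lambda>s. (t - s) *\<^sub>R f s) t = (t - t) *\<^sub>R int0 f t - int0 (\<lambda>s. (- 1) *\<^sub>R int0 f s) t"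
  proof (rule int0_by_parts[OF strongly_cont_scaleR strongly_cont_scaleR _ f])
    show "((\<lambda>s. (t - s) *\<^sub>R x) has_vector_derivative (- 1) *\<^sub>R x) (at s)" for x :: 'a and s
      by (rule bounded_linear.has_vector_derivative[OF bounded_linear_scaleR_left])
        (auto intro!: derivative_eq_intros)
  qed (auto intro!: continuous_intros)
  moreover have "int0 (\<lambda>s. (- 1) *\<^sub>R int0 f s) t = (- 1) *\<^sub>R int0 (int0 f) t"
    by (rule int0_linear[OF bounded_linear_scaleR_right
          locally_integrable_continuous[OF continuous_int0[OF L1_approximable_locally_integrable[OF f]]]])
  ultimately show ?thesis by simp
qed

section \<open>The integrated second order problem\<close>

locale second_order_problem =
  fixes j :: "'y::complex_banach \<Rightarrow> 'x::complex_banach"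
    and domA domB :: "'x set" and A B :: "'x \<Rightarrow> 'x"
    and T :: "real \<Rightarrow> 'y \<times> 'x \<Rightarrow> 'y \<times> 'x"
    and M \<omega> :: real
  assumes closed_A: "closed_operator domA A"
    and closed_B: "closed_operator domB B"
    and embedding: "continuous_embedding j"
    and domA_subset: "domA \<subseteq> dom_square domB B \<inter> range j"
    and B_domA: "B ` domA \<subseteq> range j"
    and range_j_domB: "range j \<subseteq> domB"
    and generates: "generates_C0_group (domG j domA) (opG j A B) T"
    and onorm_T_le: "\<And>t. onorm (T t) \<le> M * exp (\<omega> * \<bar>t\<bar>)"
begin

sublocale c0_group_generator T "domG j domA" "opG j A B" M \<omega>
  by unfold_locales (fact generates onorm_T_le)+

section \<open>Algebra and boundedness of the embedding and the two operators\<close>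

lemma j_linear: "bounded_linear j" and j_scaleC: "j (c *\<^sub>C v) = c *\<^sub>C j v" and inj_j: "inj j"
  using embedding bounded_clinearD[of j] by (auto simp: continuous_embedding_def)

lemmas j_add = linear_add[OF bounded_linear.linear[OF j_linear]]
  and j_diff = linear_diff[OF bounded_linear.linear[OF j_linear]]
  and j_zero = linear_0[OF bounded_linear.linear[OF j_linear]]
  and j_scaleR = linear_scale[OF bounded_linear.linear[OF j_linear]]

lemma range_j: "subspace (range j)"
  by (intro linear_subspace_image bounded_linear.linear j_linear subspace_UNIV)

lemma j_inv [simp]: "inv j (j v) = v"
  by (simp add: inj_j)

lemma j_domB [simp]: "j v \<in> domB"
  using range_j_domB by auto

lemma domA_D: "x \<in> domA \<Longrightarrow> x \<in> domB" "x \<in> domA \<Longrightarrow> B x \<in> domB" "x \<in> domA \<Longrightarrow> x \<in> range j"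
  "x \<in> domA \<Longrightarrow> B x \<in> range j"
  using domA_subset B_domA by (auto simp: dom_square_def)

lemmas B_add = closed_operatorD(3)[OF closed_B] and B_scaleC = closed_operatorD(4)[OF closed_B]
  and B_scaleR = closed_operatorD(5)[OF closed_B] and B_diff = closed_operatorD(6)[OF closed_B]
lemmas A_add = closed_operatorD(3)[OF closed_A] and A_scaleC = closed_operatorD(4)[OF closed_A]
  and A_scaleR = closed_operatorD(5)[OF closed_A] and A_diff = closed_operatorD(6)[OF closed_A]
lemmas domA_sub = closed_operatorD(1)[OF closed_A] and domB_sub = closed_operatorD(1)[OF closed_B]
lemmas int0_A = int0_closed_operator[OF closed_A] and int0_B = int0_closed_operator[OF closed_B]

text \<open>The closed graph theorem: the composition is defined on all of Y, and its graph is the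
  preimage of the graph of \<open>B\<close> under a continuous map.\<close>

lemma Bj_linear: "bounded_linear (\<lambda>v. B (j v))"
proof -
  have add: "B (j (v + w)) = B (j v) + B (j w)" for v w
    by (simp add: j_add B_add)
  have scale: "B (j (r *\<^sub>R v)) = r *\<^sub>R B (j v)" for r v
    by (simp add: j_scaleR B_scaleR)
  have "closed {(v, B (j v)) | v. v \<in> UNIV}"
  proof -
    have "{(v, B (j v)) | v. v \<in> UNIV} = (\<lambda>p. (j (fst p), snd p)) -` {(x, B x) | x. x \<in> domB}"
      by (auto simp: prod_eq_iff)
    moreover have "closed \<dots>"
      by (intro closed_vimage closed_operatorD(7)[OF closed_B] continuous_intros bounded_linear.continuous_on[OF j_linear])
    ultimately show ?thesis by simp
  qed
  then obtain K where "\<And>v. v \<in> UNIV \<Longrightarrow> norm (B (j v)) \<le> K * norm v"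
    using closed_graph_bounded[of UNIV "\<lambda>v. B (j v)"] add scale by (metis closed_UNIV subspace_UNIV)
  then show ?thesis
    by (intro bounded_linear_intro[of _ K] add scale) (simp add: mult.commute)
qed

text \<open>The embedding of dom(A), with its graph norm, into Y is bounded by the closed graph
  theorem. The Banach space dom(A) is represented by the graph of \<open>A\<close>, a closed
  subspace of X \<times> X.\<close>

lemma inv_j_bound_domA:
  obtains K where "\<And>x. x \<in> domA \<Longrightarrow> norm (inv j x) \<le> K * norm (x, A x)"
proof -
  let ?S = "{(x, A x) | x. x \<in> domA}"
  have jinv: "j (inv j x) = x" if "x \<in> domA" for x
    using domA_D(3)[OF that] by (rule f_inv_into_f)
  have cl: "closed {(p, inv j (fst p)) | p. p \<in> ?S}"
  proof -
    have iff: "v = inv j x \<longleftrightarrow> x = j v" if "x \<in> domA" for x v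
      using jinv[OF that] by auto
    have "{(p, inv j (fst p)) | p. p \<in> ?S} = fst -` ?S \<inter> {q. fst (fst q) = j (snd q)}"
      by (intro set_eqI) (auto simp: iff jinv)
    also have "closed \<dots>"
      by (intro closed_Int closed_vimage closed_operatorD(7)[OF closed_A] closed_Collect_eq
          continuous_intros bounded_linear.continuous_on[OF j_linear])
    finally show ?thesis .
  qed
  have add: "inv j (fst (p + q)) = inv j (fst p) + inv j (fst q)" if "p \<in> ?S" "q \<in> ?S" for p q
    using that jinv by (intro injD[OF inj_j]) (auto simp: j_add subspace_add[OF domA_sub])
  have scale: "inv j (fst (r *\<^sub>R p)) = r *\<^sub>R inv j (fst p)" if "p \<in> ?S" for p r
    using that jinv by (intro injD[OF inj_j]) (auto simp: j_scaleR subspace_scale[OF domA_sub])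
  obtain K where K: "\<And>p. p \<in> ?S \<Longrightarrow> norm (inv j (fst p)) \<le> K * norm p"
    by (rule closed_graph_bounded[OF closed_operatorD(8,7)[OF closed_A] add scale cl]) (assumption | rule that)+
  show ?thesis
  proof (rule that)
    show "norm (inv j x) \<le> K * norm (x, A x)" if "x \<in> domA" for x
      using K[of "(x, A x)"] that by auto
  qed
qed

text \<open>Writing the first row in X removes \<open>inv j\<close>. The vector
  \<open>w - B (j v)\<close> lies in the range of \<open>j\<close> because \<open>B\<close> maps
  dom(A) there.\<close>

lemma \<Gamma>_iff_block:
  "((v, w), (a, b)) \<in> \<Gamma> \<longleftrightarrow>
    j v \<in> domA \<and> w \<in> range j \<and> j a = w - B (j v) \<and> b = A (j v) + B (B (j v)) - B w"
proof (cases "j v \<in> domA \<and> w \<in> range j")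
  case True
  then have "w - B (j v) \<in> range j"
    using domA_D(4) subspace_diff[OF range_j] by blast
  then have "j (inv j (w - B (j v))) = w - B (j v)"
    by (rule f_inv_into_f)
  then have "inv j (w - B (j v)) = a \<longleftrightarrow> j a = w - B (j v)"
    by (metis j_inv)
  then show ?thesis
    using True unfolding \<Gamma>_def by (auto simp: domG_def opG_def)
next
  case False
  then show ?thesis
    unfolding \<Gamma>_def by (auto simp: domG_def)
qed

text \<open>The equation of integral mild solutions with repeated integrals and an arbitrary
  inhomogeneity H. It is linear in (u, H), so the parts of the solution formula can be treated one
  by one.\<close>

definition integrated_solution :: "(real \<Rightarrow> 'x) \<Rightarrow> (real \<Rightarrow> 'x) \<Rightarrow> bool" where
  "integrated_solution u H \<longleftrightarrow> continuous_on UNIV u \<and> (\<forall>t. int0 u t \<in> domB) \<and> (\<forall>t. int0 (int0 u) t \<in> domA) \<and>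
     continuous_on UNIV (\<lambda>t. B (int0 u t)) \<and> continuous_on UNIV (\<lambda>t. A (int0 (int0 u) t)) \<and>
     (\<forall>t. u t + 2 *\<^sub>R B (int0 u t) = A (int0 (int0 u) t) + H t)"

lemma integrated_solution_combine:
  assumes u: "integrated_solution u H" and w: "integrated_solution w H'"
  shows "integrated_solution (\<lambda>t. u t + r *\<^sub>R w t) (\<lambda>t. H t + r *\<^sub>R H' t)"
proof -
  have uc: "continuous_on UNIV u" and wc: "continuous_on UNIV w"
    using u w by (auto simp: integrated_solution_def)
  have comb: "int0 (\<lambda>t. f t + r *\<^sub>R g t) = (\<lambda>t. int0 f t + r *\<^sub>R int0 g t)"
    if f: "continuous_on UNIV f" and g: "continuous_on UNIV g" for f g :: "real \<Rightarrow> 'x"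
  proof
    fix t
    note li = locally_integrable_continuous[OF g]
    have "int0 (\<lambda>s. r *\<^sub>R g s) t = r *\<^sub>R int0 g t"
      by (rule int0_linear[OF bounded_linear_scaleR_right li])
    then show "int0 (\<lambda>t. f t + r *\<^sub>R g t) t = int0 f t + r *\<^sub>R int0 g t"
      using int0_add[OF locally_integrable_continuous[OF f] locally_integrable_linear[OF bounded_linear_scaleR_right li]]
      by simp
  qed
  have Ic: "continuous_on UNIV (int0 u)" "continuous_on UNIV (int0 w)"
    by (intro continuous_int0 locally_integrable_continuous uc wc)+
  note I1 = comb[OF uc wc] and I2 = comb[OF Ic]
  have uB: "int0 u t \<in> domB" "int0 (int0 u) t \<in> domA" and wB: "int0 w t \<in> domB" "int0 (int0 w) t \<in> domA" for t
    using u w by (auto simp: integrated_solution_def)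
  have rB: "r *\<^sub>R int0 w t \<in> domB" "r *\<^sub>R int0 (int0 w) t \<in> domA" for t
    using wB subspace_scale[OF domB_sub] subspace_scale[OF domA_sub] by auto
  have B': "B (int0 u t + r *\<^sub>R int0 w t) = B (int0 u t) + r *\<^sub>R B (int0 w t)" for t
    using B_add[OF uB(1) rB(1)] B_scaleR[OF wB(1)] by simp
  have A': "A (int0 (int0 u) t + r *\<^sub>R int0 (int0 w) t) = A (int0 (int0 u) t) + r *\<^sub>R A (int0 (int0 w) t)" for t
    using A_add[OF uB(2) rB(2)] A_scaleR[OF wB(2)] by simp
  have eq: "u t + r *\<^sub>R w t + 2 *\<^sub>R B (int0 u t + r *\<^sub>R int0 w t)
     = A (int0 (int0 u) t + r *\<^sub>R int0 (int0 w) t) + (H t + r *\<^sub>R H' t)" for t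
  proof -
    have "u t + 2 *\<^sub>R B (int0 u t) = A (int0 (int0 u) t) + H t"
      "w t + 2 *\<^sub>R B (int0 w t) = A (int0 (int0 w) t) + H' t"
      using u w by (auto simp: integrated_solution_def)
    then have "(u t + 2 *\<^sub>R B (int0 u t)) + r *\<^sub>R (w t + 2 *\<^sub>R B (int0 w t))
       = (A (int0 (int0 u) t) + H t) + r *\<^sub>R (A (int0 (int0 w) t) + H' t)"
      by simp
    then show ?thesis
      unfolding A' B' by (simp add: algebra_simps)
  qed
  show ?thesis
    unfolding integrated_solution_def I1 I2
  proof (intro conjI allI)
    show "continuous_on UNIV (\<lambda>t. u t + r *\<^sub>R w t)"
      by (intro continuous_intros uc wc)
    show "int0 u t + r *\<^sub>R int0 w t \<in> domB" "int0 (int0 u) t + r *\<^sub>R int0 (int0 w) t \<in> domA" for t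
      by (intro subspace_add[OF domB_sub] subspace_add[OF domA_sub] uB rB)+
    show "continuous_on UNIV (\<lambda>t. B (int0 u t + r *\<^sub>R int0 w t))"
      "continuous_on UNIV (\<lambda>t. A (int0 (int0 u) t + r *\<^sub>R int0 (int0 w) t))"
      unfolding A' B' using u w by (auto simp: integrated_solution_def intro!: continuous_intros)
    show "u t + r *\<^sub>R w t + 2 *\<^sub>R B (int0 u t + r *\<^sub>R int0 w t)
     = A (int0 (int0 u) t + r *\<^sub>R int0 (int0 w) t) + (H t + r *\<^sub>R H' t)" for t
      by (rule eq)
  qed
qed

text \<open>A homogeneous solution \<open>u\<close> is integrated three times: then the state with components
  \<open>W\<^sub>3\<close> and \<open>W\<^sub>2 + B W\<^sub>3\<close>, where \<open>W\<^sub>k\<close> is the \<open>k\<close>-fold integral, is a classical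
  solution of the first order system.\<close>

lemma integrated_solution_zero:
  assumes u: "integrated_solution u (\<lambda>_. 0)"
  shows "u t = 0"
proof -
  have uc: "continuous_on UNIV u" and "\<And>t. int0 u t \<in> domB" and "\<And>t. int0 (int0 u) t \<in> domA"
    and "continuous_on UNIV (\<lambda>t. B (int0 u t))" and "continuous_on UNIV (\<lambda>t. A (int0 (int0 u) t))"
    and "\<And>t. u t + 2 *\<^sub>R B (int0 u t) = A (int0 (int0 u) t)"
    using u by (auto simp: integrated_solution_def)
  moreover define W where "W = int0 u"
  moreover define W2 where "W2 = int0 W"
  moreover define W3 where "W3 = int0 W2"
  ultimately have W: "\<And>t. W t \<in> domB" and W2: "\<And>t. W2 t \<in> domA"
    and BW: "continuous_on UNIV (\<lambda>t. B (W t))" and AW2: "continuous_on UNIV (\<lambda>t. A (W2 t))"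
    and eq: "\<And>t. u t + 2 *\<^sub>R B (W t) = A (W2 t)"
    by auto
  have Wc1: "continuous_on UNIV W"
    unfolding W_def by (intro continuous_int0 locally_integrable_continuous uc)
  have "continuous_on UNIV W2"
    unfolding W2_def by (intro continuous_int0 locally_integrable_continuous Wc1)
  note Wc = Wc1 this
  have Wd: "(W has_vector_derivative u t) (at t)" "(W2 has_vector_derivative W t) (at t)"
    "(W3 has_vector_derivative W2 t) (at t)" for t
    using int0_has_vector_derivative[OF uc] int0_has_vector_derivative[OF Wc(1)]
      int0_has_vector_derivative[OF Wc(2)]
    by (simp_all add: W_def W2_def W3_def)
  have BW2: "B (W2 t) = int0 (\<lambda>s. B (W s)) t" for t
    unfolding W2_def by (rule int0_B(2)[OF Wc(1) BW W])
  have BW2c: "continuous_on UNIV (\<lambda>t. B (W2 t))"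
    unfolding BW2 by (intro continuous_int0 locally_integrable_continuous BW)
  have W3: "W3 t \<in> domA" and AW3: "A (W3 t) = int0 (\<lambda>s. A (W2 s)) t" for t
    unfolding W3_def by (rule int0_A(1)[OF Wc(2) AW2 W2], rule int0_A(2)[OF Wc(2) AW2 W2])
  have BW3: "B (W3 t) = int0 (\<lambda>s. B (W2 s)) t" for t
    unfolding W3_def by (rule int0_B(2)[OF Wc(2) BW2c domA_D(1)[OF W2]])
  have "W t + 2 *\<^sub>R B (W2 t) = A (W3 t)" for t
  proof -
    have "int0 (\<lambda>s. u s + 2 *\<^sub>R B (W s)) t = int0 u t + int0 (\<lambda>s. 2 *\<^sub>R B (W s)) t"
      by (intro int0_add locally_integrable_continuous continuous_intros uc BW)
    moreover have "int0 (\<lambda>s. 2 *\<^sub>R B (W s)) t = 2 *\<^sub>R B (W2 t)"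
      unfolding BW2 by (rule int0_linear[OF bounded_linear_scaleR_right locally_integrable_continuous[OF BW]])
    moreover have "int0 (\<lambda>s. u s + 2 *\<^sub>R B (W s)) t = A (W3 t)"
      by (simp only: eq AW3)
    ultimately show ?thesis
      by (simp only: W_def)
  qed
  \<comment> \<open>Arranged to match the second row of the block operator at \<open>V\<close>, in
    which \<open>B (B (W3 t))\<close> cancels.\<close>
  then have AB: "A (W3 t) - B (W2 t) = W t + B (W2 t)" for t
    by (metis add_diff_cancel_right' add.assoc scaleR_2)
  obtain K where K: "\<And>x. x \<in> domA \<Longrightarrow> norm (inv j x) \<le> K * norm (x, A x)"
    using inv_j_bound_domA by blast
  \<comment> \<open>The state is differentiated in Y \<times> X, so its first component must be a C1
    curve in Y and not merely in X. The second integral is continuous in the graph norm of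
    \<open>A\<close>, hence in Y; this is why a third integration is made.\<close>
  define v where "v t = inv j (W2 t)" for t
  have jv: "j (v t) = W2 t" for t
    unfolding v_def by (rule f_inv_into_f[OF domA_D(3)[OF W2]])
  have vc: "continuous_on UNIV v"
    unfolding continuous_on_def
  proof
    fix t :: real
    have eq: "v s - v t = inv j (W2 s - W2 t)" for s
      by (rule injD[OF inj_j])
        (simp add: j_diff jv f_inv_into_f[OF domA_D(3)[OF subspace_diff[OF domA_sub W2 W2]]])
    have "((\<lambda>s. norm (W2 s - W2 t, A (W2 s) - A (W2 t))) \<longlongrightarrow> norm (W2 t - W2 t, A (W2 t) - A (W2 t))) (at t)"
      using Wc(2) AW2 unfolding continuous_on_def by (intro tendsto_intros) auto
    then have lim: "((\<lambda>s. K * norm (W2 s - W2 t, A (W2 s) - A (W2 t))) \<longlongrightarrow> 0) (at t)"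
      by (intro tendsto_mult_right_zero) (simp add: zero_prod_def[symmetric])
    have le: "norm (v s - v t) \<le> K * norm (W2 s - W2 t, A (W2 s) - A (W2 t))" for s
      unfolding eq using K[OF subspace_diff[OF domA_sub W2 W2], of s t] by (simp add: A_diff[OF W2 W2])
    have "((\<lambda>s. v s - v t) \<longlongrightarrow> 0) (at t)"
      by (rule Lim_null_comparison[OF always_eventually[OF allI] lim]) (rule le)
    then show "(v \<longlongrightarrow> v t) (at t)"
      by (simp add: LIM_zero_iff)
  qed
  have jv3: "j (int0 v t) = W3 t" for t
    unfolding W3_def using int0_linear[OF j_linear locally_integrable_continuous[OF vc], of t] by (simp add: jv)
  define V where "V t = (int0 v t, W2 t + B (W3 t))" for t
  define V' where "V' t = (v t, W t + B (W2 t))" for t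
  have "V t = 0" for t
  proof (rule homogeneous_unique)
    show "(V has_vector_derivative V' t) (at t)" for t
      unfolding V_def V'_def BW3
      by (intro has_vector_derivative_Pair has_vector_derivative_add Wd int0_has_vector_derivative vc BW2c)
    show "(V t, V' t) \<in> \<Gamma>" for t
      unfolding V_def V'_def \<Gamma>_iff_block jv3
    proof (intro conjI W3)
      show "W2 t + B (W3 t) \<in> range j"
        using subspace_add[OF range_j domA_D(3)[OF W2] domA_D(4)[OF W3]] .
      show "j (v t) = W2 t + B (W3 t) - B (W3 t)"
        by (simp add: jv)
      show "W t + B (W2 t) = A (W3 t) + B (B (W3 t)) - B (W2 t + B (W3 t))"
        by (simp add: B_add[OF domA_D(1)[OF W2] domA_D(2)[OF W3]] AB[symmetric])
    qed
    show "V 0 = 0"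
      by (simp add: V_def W2_def BW3 zero_prod_def)
  qed
  then have "W3 = (\<lambda>_. 0)"
    by (auto simp: V_def zero_prod_def jv3[symmetric] j_zero)
  then have "W2 = (\<lambda>_. 0)"
    using Wd(3) vector_derivative_unique_at[OF _ has_vector_derivative_const] by fastforce
  then have "W = (\<lambda>_. 0)"
    using Wd(2) vector_derivative_unique_at[OF _ has_vector_derivative_const] by fastforce
  then show ?thesis
    using Wd(1) vector_derivative_unique_at[OF _ has_vector_derivative_const] by fastforce
qed

lemma integrated_solution_unique:
  assumes "integrated_solution u H" "integrated_solution w H"
  shows "u = w"
proof
  fix t
  have "integrated_solution (\<lambda>t. u t + (- 1) *\<^sub>R w t) (\<lambda>t. 0)"
    using integrated_solution_combine[OF assms, of "- 1"] by simp
  from integrated_solution_zero[OF this, of t] show "u t = w t"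
    by simp
qed

lemma integral_mild_solution_iff_integrated_solution:
  assumes f: "L1_approximable f"
  shows "integral_mild_solution domA A domB B f x y u \<longleftrightarrow>
    integrated_solution u (\<lambda>t. x + t *\<^sub>R (y + 2 *\<^sub>R B x) + int0 (int0 f) t)"
proof (cases "continuous_on UNIV u")
  case True
  have "int0 (\<lambda>s. (t - s) *\<^sub>R u s) t = int0 (int0 u) t" for t
    by (rule int0_kernel[OF L1_approximable_continuous[OF True]])
  then show ?thesis
    unfolding integral_mild_solution_def integrated_solution_def C0_fun_def int0_kernel[OF f] by (simp add: add.assoc)
next
  case False
  then show ?thesis
    by (simp add: integral_mild_solution_def integrated_solution_def C0_fun_def)
qed

end

section \<open>Solution formula and classical solutions\<close>

lemma int0_const: "int0 (\<lambda>_. c) t = t *\<^sub>R (c::'a::banach)"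
proof -
  have "((\<lambda>t. t *\<^sub>R c) has_vector_derivative c) (at t)" for t
    by (auto intro!: derivative_eq_intros)
  from int0_vector_derivative[OF this, of t] show ?thesis by simp
qed

lemma bounded_linear_inject2: "bounded_linear (\<lambda>x::'b::real_normed_vector. (0::'a::real_normed_vector, x))"
  by (intro bounded_linear_Pair bounded_linear_ident bounded_linear_zero)

lemma L1_approximable_inject2: "L1_approximable f \<Longrightarrow> L1_approximable (\<lambda>s. (0, f s))"
  by (rule L1_approximable_strongly_cont[OF strongly_cont_const[OF bounded_linear_inject2]])

lemma int0_inject2:
  fixes f :: "real \<Rightarrow> 'b::banach"
  shows "locally_integrable f \<Longrightarrow> int0 (\<lambda>s. (0::'a::banach, f s)) t = (0, int0 f t)"
  by (rule int0_linear[OF bounded_linear_inject2])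

lemma C1_funI:
  assumes "\<And>t. (u has_vector_derivative u' t) (at t)" "continuous_on UNIV u'"
  shows "u \<in> C1_fun" "vderiv u = u'"
  using assms vector_derivative_at[OF assms(1)] by (auto simp: C1_fun_def C1_differentiable_on_def)

lemma C1_funD:
  assumes "u \<in> C1_fun"
  shows "(u has_vector_derivative vderiv u t) (at t)" "continuous_on UNIV (vderiv u)"
  using assms unfolding C1_fun_def C1_differentiable_on_eq by (auto simp: vector_derivative_works)

lemma int0_vderiv:
  fixes u :: "real \<Rightarrow> 'a::banach"
  assumes "u \<in> C1_fun"
  shows "int0 (vderiv u) t = u t - u 0"
  by (rule int0_vector_derivative[OF C1_funD(1)[OF assms]])

context second_order_problem
begin

lemma j_fst_linear: "bounded_linear (\<lambda>p. j (fst p))"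
  by (rule bounded_linear_compose[OF j_linear bounded_linear_fst])

text \<open>The graph relation is integrated once more. Write q1, q2 for the X components of the
  first and second integral of the state. The first rows give u = q1 - B(int u) and int u = q2 -
  B(int int u), the second row of the twice integrated relation gives q1; eliminating q1 and q2
  leaves the claim with 2B.\<close>

lemma integrated_solution_sine:
  assumes f: "L1_approximable f"
  shows "integrated_solution (\<lambda>t. j (fst (mild (\<lambda>s. (0, f s)) (0, y) t))) (\<lambda>t. t *\<^sub>R y + int0 (int0 f) t)"
proof -
  define F where "F s = (0::'y, f s)" for s
  have F: "L1_approximable F"
    unfolding F_def by (rule L1_approximable_inject2[OF f])
  define U where "U = mild F (0, y)"
  define P where "P = int0 U"
  define P2 where "P2 = int0 P"
  define u where "u t = j (fst (U t))" for t
  have Uc: "continuous_on UNIV U"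
    unfolding U_def by (rule mild_cont[OF F])
  have Pc: "continuous_on UNIV P"
    unfolding P_def by (rule continuous_int0[OF locally_integrable_continuous[OF Uc]])
  have fi: "locally_integrable f"
    by (rule L1_approximable_locally_integrable[OF f])
  have Ifc: "continuous_on UNIV (int0 f)"
    by (rule continuous_int0[OF fi])
  have IF: "int0 F t = (0, int0 f t)" for t
    unfolding F_def by (rule int0_inject2[OF fi])
  have G1: "(P t, U t - (0, y) - (0, int0 f t)) \<in> \<Gamma>" for t
    using int0_mild_generator[OF F, of "(0, y)" t] by (simp add: P_def U_def IF)
  have "(P2 t, int0 (\<lambda>s. U s - (0, y) - (0, int0 f s)) t) \<in> \<Gamma>" for t
    unfolding P2_def
    by (intro int0_\<Gamma> G1 locally_integrable_continuous continuous_intros Pc Uc Ifc)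
  moreover have "int0 (\<lambda>s. U s - (0, y) - (0, int0 f s)) t = P t - (0, t *\<^sub>R y) - (0, int0 (int0 f) t)" for t
  proof -
    have "int0 (\<lambda>s. U s - (0, y) - (0, int0 f s)) t
       = int0 (\<lambda>s. U s - (0, y)) t - int0 (\<lambda>s. (0, int0 f s)) t"
      by (intro int0_diff locally_integrable_continuous continuous_intros Uc Ifc)
    moreover have "int0 (\<lambda>s. U s - (0, y)) t = P t - int0 (\<lambda>s. (0, y)) t"
      unfolding P_def by (intro int0_diff locally_integrable_continuous continuous_intros Uc)
    ultimately show ?thesis
      by (simp add: int0_const int0_inject2[OF locally_integrable_continuous[OF Ifc]])
  qed
  ultimately have G2: "(P2 t, P t - (0, t *\<^sub>R y) - (0, int0 (int0 f) t)) \<in> \<Gamma>" for t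
    by simp
  have Iu: "int0 u = (\<lambda>t. j (fst (P t)))"
    unfolding u_def P_def
    by (rule ext, rule int0_linear[OF j_fst_linear locally_integrable_continuous[OF Uc]])
  have IIu: "int0 (\<lambda>t. j (fst (P t))) = (\<lambda>t. j (fst (P2 t)))"
    unfolding P2_def
    by (rule ext, rule int0_linear[OF j_fst_linear locally_integrable_continuous[OF Pc]])
  have "integrated_solution u (\<lambda>t. t *\<^sub>R y + int0 (int0 f) t)"
    unfolding integrated_solution_def Iu unfolding IIu
  proof (intro conjI allI)
    show uc: "continuous_on UNIV u"
      unfolding u_def by (intro bounded_linear.continuous_on[OF j_fst_linear] Uc)
    show dA: "j (fst (P2 t)) \<in> domA" for t
      using G2[of t] by (metis \<Gamma>_iff_block prod.collapse)
    show Bc: "continuous_on UNIV (\<lambda>t. B (j (fst (P t))))"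
      by (intro bounded_linear.continuous_on[OF Bj_linear] continuous_intros Pc)
    show eq: "u t + 2 *\<^sub>R B (j (fst (P t))) = A (j (fst (P2 t))) + (t *\<^sub>R y + int0 (int0 f) t)" for t
    proof -
      obtain p q p1 q1 p2 q2 where e: "U t = (p, q)" "P t = (p1, q1)" "P2 t = (p2, q2)"
        by (metis prod.exhaust)
      have 1: "j p = q1 - B (j p1)"
        using G1[of t] unfolding e by (simp add: \<Gamma>_iff_block)
      have 2: "j p2 \<in> domA" "q2 \<in> range j" "j p1 = q2 - B (j p2)"
        "q1 - t *\<^sub>R y - int0 (int0 f) t = A (j p2) + B (B (j p2)) - B q2"
        using G2[of t] unfolding e by (simp_all add: \<Gamma>_iff_block)
      have q: "q1 = A (j p2) + B (B (j p2)) - B q2 + (t *\<^sub>R y + int0 (int0 f) t)"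
        unfolding 2(4)[symmetric] by simp
      have "B (j p1) = B q2 - B (B (j p2))"
        unfolding 2(3) using 2(2) domA_D(2)[OF 2(1)] by (intro B_diff) auto
      then show ?thesis
        by (simp add: e u_def 1 scaleR_2 q)
    qed
    have "continuous_on UNIV (\<lambda>t. u t + 2 *\<^sub>R B (j (fst (P t))) - (t *\<^sub>R y + int0 (int0 f) t))"
      by (intro continuous_intros uc Bc continuous_int0 locally_integrable_continuous Ifc)
    then show "continuous_on UNIV (\<lambda>t. A (j (fst (P2 t))))"
      by (simp add: eq)
  qed simp
  then show ?thesis
    by (simp add: u_def[abs_def] U_def F_def[abs_def])
qed

definition cos_part :: "'x \<Rightarrow> real \<Rightarrow> 'x" where
  "cos_part x t = snd (T t (0, x)) - B (j (fst (T t (0, x))))"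

lemma cos_part_cont: "continuous_on UNIV (cos_part x)"
  unfolding cos_part_def[abs_def]
  by (intro continuous_intros T_cont bounded_linear.continuous_on[OF Bj_linear])

text \<open>This is the first row of the relation \<open>G (R t p) = T t p - p\<close> at p = (0,
  x).\<close>

lemma int0_cos_part: "int0 (cos_part x) t = j (fst (T t (0, x)))"
proof -
  have "(R t (0, x), T t (0, x) - (0, x)) \<in> \<Gamma>"
    using R_generator[of t "(0, x)"] by (simp add: \<Gamma>_def)
  moreover have R: "R t (0, x) = (int0 (\<lambda>s. fst (T s (0, x))) t, int0 (\<lambda>s. snd (T s (0, x))) t)"
    unfolding R_def
    by (simp add: prod_eq_iff int0_linear[OF bounded_linear_fst T_locally_integrable]
        int0_linear[OF bounded_linear_snd T_locally_integrable])
  ultimately have "j (fst (T t (0, x))) = int0 (\<lambda>s. snd (T s (0, x))) t - B (j (int0 (\<lambda>s. fst (T s (0, x))) t))"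
    by (cases "T t (0, x)") (simp add: \<Gamma>_iff_block)
  also have "B (j (int0 (\<lambda>s. fst (T s (0, x))) t)) = int0 (\<lambda>s. B (j (fst (T s (0, x))))) t"
    by (rule int0_linear[symmetric, OF Bj_linear locally_integrable_linear[OF bounded_linear_fst T_locally_integrable]])
  also have "int0 (\<lambda>s. snd (T s (0, x))) t - int0 (\<lambda>s. B (j (fst (T s (0, x))))) t = int0 (cos_part x) t"
    unfolding cos_part_def[abs_def]
    by (intro int0_diff[symmetric] locally_integrable_continuous continuous_intros T_cont
        bounded_linear.continuous_on[OF Bj_linear])
  finally show ?thesis ..
qed

text \<open>The same elimination as for the sine part, with one integration fewer, since the
  integral of the cosine part is already a first component of the group.\<close>

lemma integrated_solution_cos_part: "integrated_solution (cos_part x) (\<lambda>_. x)"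
proof -
  have I: "int0 (cos_part x) = (\<lambda>t. j (fst (T t (0, x))))"
    by (rule ext, rule int0_cos_part)
  have II: "int0 (\<lambda>t. j (fst (T t (0, x)))) = (\<lambda>t. j (fst (R t (0, x))))"
    unfolding R_def by (rule ext, rule int0_linear[OF j_fst_linear T_locally_integrable])
  have G: "(R t (0, x), T t (0, x) - (0, x)) \<in> \<Gamma>" for t
    using R_generator[of t "(0, x)"] by (simp add: \<Gamma>_def)
  show ?thesis
    unfolding integrated_solution_def I unfolding II
  proof (intro conjI allI cos_part_cont)
    show "j (fst (R t (0, x))) \<in> domA" for t
      using G[of t] by (metis \<Gamma>_iff_block prod.collapse)
    show Bc: "continuous_on UNIV (\<lambda>t. B (j (fst (T t (0, x)))))"
      by (intro bounded_linear.continuous_on[OF Bj_linear] continuous_intros T_cont)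
    show eq: "cos_part x t + 2 *\<^sub>R B (j (fst (T t (0, x)))) = A (j (fst (R t (0, x)))) + x" for t
    proof -
      obtain p q p1 q1 where e: "T t (0, x) = (p, q)" "R t (0, x) = (p1, q1)"
        by (metis prod.exhaust)
      have 1: "j p1 \<in> domA" "q1 \<in> range j" "j p = q1 - B (j p1)"
        "q - x = A (j p1) + B (B (j p1)) - B q1"
        using G[of t] unfolding e by (simp_all add: \<Gamma>_iff_block)
      have q: "q = A (j p1) + B (B (j p1)) - B q1 + x"
        unfolding 1(4)[symmetric] by simp
      have "B (j p) = B q1 - B (B (j p1))"
        unfolding 1(3) using 1(2) domA_D(2)[OF 1(1)] by (intro B_diff) auto
      then show ?thesis
        by (simp add: e cos_part_def scaleR_2 q)
    qed
    have "continuous_on UNIV (\<lambda>t. cos_part x t + 2 *\<^sub>R B (j (fst (T t (0, x)))) - x)"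
      by (intro continuous_intros cos_part_cont Bc)
    then show "continuous_on UNIV (\<lambda>t. A (j (fst (R t (0, x)))))"
      by (simp add: eq)
  qed simp
qed

section \<open>The solution formula in terms of the group\<close>

lemma mild_0: "L1_approximable F \<Longrightarrow> mild F p 0 = p"
  by (simp add: mild_def conv_def)

text \<open>For x outside Y there is no state with first component x, so the formula is not itself
  the first component of one mild solution. All its terms except the cosine part are, with initial
  state (0, y + 2Bx).\<close>

lemma sol_formula_eq:
  assumes f: "L1_approximable f"
  shows "sol_formula j B T f x y t = cos_part x t + j (fst (mild (\<lambda>s. (0, f s)) (0, y + 2 *\<^sub>R B x) t))"
proof -
  have "T t (0, y + 2 *\<^sub>R B x) = T t ((0, y) + 2 *\<^sub>R (0, B x))"
    by simp
  also have "\<dots> = T t (0, y) + 2 *\<^sub>R T t (0, B x)"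
    by (simp only: T_plus_right T_scaleR_right)
  finally have 1: "j (fst (T t (0, y + 2 *\<^sub>R B x))) = gen_sin j T t y + 2 *\<^sub>R j (T12 T t (B x))"
    by (simp add: gen_sin_def T12_def j_add j_scaleR)
  have 2: "j (fst (conv (\<lambda>s. (0, f s)) t)) = int0 (\<lambda>s. gen_sin j T (t - s) (f s)) t"
    unfolding conv_eq(2)[OF L1_approximable_inject2[OF f]] gen_sin_def T12_def
    by (rule int0_linear[symmetric, OF j_fst_linear conv_eq(1)[OF L1_approximable_inject2[OF f]]])
  have 3: "j (fst (mild (\<lambda>s. (0, f s)) (0, y + 2 *\<^sub>R B x) t))
    = gen_sin j T t y + 2 *\<^sub>R j (T12 T t (B x)) + int0 (\<lambda>s. gen_sin j T (t - s) (f s)) t"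
    by (simp only: mild_def fst_add j_add 1 2)
  show ?thesis
    unfolding sol_formula_def 3 by (simp add: gen_cos_def cos_part_def T12_def T22_def)
qed

lemma integrated_solution_sol_formula:
  assumes f: "L1_approximable f"
  shows "integrated_solution (sol_formula j B T f x y) (\<lambda>t. x + t *\<^sub>R (y + 2 *\<^sub>R B x) + int0 (int0 f) t)"
proof -
  have "sol_formula j B T f x y
      = (\<lambda>t. cos_part x t + 1 *\<^sub>R j (fst (mild (\<lambda>s. (0, f s)) (0, y + 2 *\<^sub>R B x) t)))"
    by (rule ext) (simp add: sol_formula_eq[OF f])
  moreover have "(\<lambda>t. x + t *\<^sub>R (y + 2 *\<^sub>R B x) + int0 (int0 f) t)
      = (\<lambda>t. x + 1 *\<^sub>R (t *\<^sub>R (y + 2 *\<^sub>R B x) + int0 (int0 f) t))"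
    by (simp add: add.assoc)
  ultimately show ?thesis
    using integrated_solution_combine[OF integrated_solution_cos_part[of x] integrated_solution_sine[OF f, of "y + 2 *\<^sub>R B x"], of 1] by simp
qed

lemma integral_mild_solution_sol_formula:
  assumes f: "f \<in> L1_loc"
  shows "is_the_unique (integral_mild_solution domA A domB B f x y) (sol_formula j B T f x y)"
  unfolding is_the_unique_def integral_mild_solution_iff_integrated_solution[OF L1_loc_approximable[OF f]]
  using integrated_solution_sol_formula[OF L1_loc_approximable[OF f]] integrated_solution_unique by blast

text \<open>Integrating the differential equation twice reduces uniqueness of classical solutions to
  that of the integrated problem.\<close>

lemma classical_solution_integrated_solution:
  assumes f: "continuous_on UNIV f" and x: "x \<in> domA" and w: "classical_solution domA A domB B f x y w"
  shows "integrated_solution w (\<lambda>t. x + t *\<^sub>R (y + 2 *\<^sub>R B x) + int0 (int0 f) t)"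
proof -
  have C: "w \<in> C1_fun" "vderiv w \<in> C1_fun" and wA: "\<And>t. w t \<in> domA" and w'B: "\<And>t. vderiv w t \<in> domB"
    and Ac: "continuous_on UNIV (\<lambda>t. A (w t))" and ic: "w 0 = x" "vderiv w 0 = y"
    and eq: "\<And>t. vderiv (vderiv w) t + 2 *\<^sub>R B (vderiv w t) - A (w t) = f t"
    using w by (auto simp: classical_solution_def C2_fun_def C0_fun_def)
  have wc: "continuous_on UNIV w"
    using C(1) by (simp add: C1_fun_def C1_differentiable_imp_continuous_on)
  note w'c = C1_funD(2)[OF C(1)] and w''c = C1_funD(2)[OF C(2)]
  \<comment> \<open>Continuity of \<open>B\<close> along the derivative is not part of the notion of
    a classical solution; it follows by solving the equation for this term, and it permits pulling
    \<open>B\<close> through the integral.\<close>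
  have B': "B (vderiv w t) = (1 / 2) *\<^sub>R (f t - vderiv (vderiv w) t + A (w t))" for t
  proof -
    have "2 *\<^sub>R B (vderiv w t) = f t - vderiv (vderiv w) t + A (w t)"
      using eq[of t] by (simp add: algebra_simps)
    from this[symmetric] show ?thesis
      by (simp only: scaleR_scaleR) simp
  qed
  have B'c: "continuous_on UNIV (\<lambda>t. B (vderiv w t))"
    unfolding B' by (intro continuous_intros f w''c Ac)
  have Bw: "B (w t) = int0 (\<lambda>s. B (vderiv w s)) t + B x" for t
  proof -
    have "B (w t) - B x = B (int0 (vderiv w) t)"
      by (simp only: B_diff[OF domA_D(1)[OF wA[of t]] domA_D(1)[OF x]] int0_vderiv[OF C(1)] ic)
    also have "\<dots> = int0 (\<lambda>s. B (vderiv w s)) t"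
      by (rule int0_B(2)[OF w'c B'c w'B])
    finally show ?thesis
      by (metis diff_add_cancel)
  qed
  have Bc: "continuous_on UNIV (\<lambda>t. B (w t))"
    unfolding Bw by (intro continuous_intros continuous_int0 locally_integrable_continuous B'c)
  have IB: "int0 w t \<in> domB" "B (int0 w t) = int0 (\<lambda>s. B (w s)) t" for t
    by (rule int0_B(1)[OF wc Bc domA_D(1)[OF wA]], rule int0_B(2)[OF wc Bc domA_D(1)[OF wA]])
  have IA: "int0 w t \<in> domA" "A (int0 w t) = int0 (\<lambda>s. A (w s)) t" for t
    by (rule int0_A(1)[OF wc Ac wA], rule int0_A(2)[OF wc Ac wA])
  have Iwc: "continuous_on UNIV (int0 w)"
    by (rule continuous_int0[OF locally_integrable_continuous[OF wc]])
  have IAc: "continuous_on UNIV (\<lambda>t. A (int0 w t))"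
    unfolding IA(2) by (rule continuous_int0[OF locally_integrable_continuous[OF Ac]])
  have IIA: "int0 (int0 w) t \<in> domA" "A (int0 (int0 w) t) = int0 (\<lambda>s. A (int0 w s)) t" for t
    by (rule int0_A(1)[OF Iwc IAc IA(1)], rule int0_A(2)[OF Iwc IAc IA(1)])
  have scale: "int0 (\<lambda>s. 2 *\<^sub>R g s) t = 2 *\<^sub>R int0 g t" if "continuous_on UNIV g" for g :: "real \<Rightarrow> 'x" and t
    by (rule int0_linear[OF bounded_linear_scaleR_right locally_integrable_continuous[OF that]])
  have first: "vderiv w t + 2 *\<^sub>R B (w t) = A (int0 w t) + (y + 2 *\<^sub>R B x + int0 f t)" for t
  proof -
    have "int0 (\<lambda>s. vderiv (vderiv w) s + 2 *\<^sub>R B (vderiv w s)) t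
        = int0 (vderiv (vderiv w)) t + int0 (\<lambda>s. 2 *\<^sub>R B (vderiv w s)) t"
      by (intro int0_add locally_integrable_continuous continuous_intros w''c B'c)
    also have "\<dots> = vderiv w t - y + 2 *\<^sub>R (B (w t) - B x)"
      unfolding scale[OF B'c] int0_vderiv[OF C(2)] by (simp add: Bw ic)
    finally have "vderiv w t - y + 2 *\<^sub>R (B (w t) - B x)
        = int0 (\<lambda>s. vderiv (vderiv w) s + 2 *\<^sub>R B (vderiv w s)) t" ..
    also have "(\<lambda>s. vderiv (vderiv w) s + 2 *\<^sub>R B (vderiv w s)) = (\<lambda>s. A (w s) + f s)"
      using eq by (auto simp: algebra_simps)
    also have "int0 (\<lambda>s. A (w s) + f s) t = A (int0 w t) + int0 f t"
      unfolding IA(2) by (intro int0_add locally_integrable_continuous Ac f)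
    finally show ?thesis
      by (simp add: algebra_simps)
  qed
  have second: "w t + 2 *\<^sub>R B (int0 w t) = A (int0 (int0 w) t) + (x + t *\<^sub>R (y + 2 *\<^sub>R B x) + int0 (int0 f) t)" for t
  proof -
    have Ifc: "continuous_on UNIV (int0 f)"
      by (rule continuous_int0[OF locally_integrable_continuous[OF f]])
    have "int0 (\<lambda>s. vderiv w s + 2 *\<^sub>R B (w s)) t = int0 (vderiv w) t + int0 (\<lambda>s. 2 *\<^sub>R B (w s)) t"
      by (intro int0_add locally_integrable_continuous continuous_intros w'c Bc)
    also have "\<dots> = w t - x + 2 *\<^sub>R B (int0 w t)"
      unfolding scale[OF Bc] int0_vderiv[OF C(1)] by (simp add: IB(2) ic)
    finally have "w t - x + 2 *\<^sub>R B (int0 w t) = int0 (\<lambda>s. vderiv w s + 2 *\<^sub>R B (w s)) t" ..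
    also have "(\<lambda>s. vderiv w s + 2 *\<^sub>R B (w s)) = (\<lambda>s. A (int0 w s) + (y + 2 *\<^sub>R B x + int0 f s))"
      by (rule ext, rule first)
    also have "int0 \<dots> t = int0 (\<lambda>s. A (int0 w s)) t + int0 (\<lambda>s. y + 2 *\<^sub>R B x + int0 f s) t"
      by (intro int0_add locally_integrable_continuous continuous_intros IAc Ifc)
    also have "int0 (\<lambda>s. y + 2 *\<^sub>R B x + int0 f s) t = int0 (\<lambda>s. y + 2 *\<^sub>R B x) t + int0 (int0 f) t"
      by (intro int0_add locally_integrable_continuous continuous_intros Ifc)
    finally show ?thesis
      by (simp add: IIA(2) int0_const algebra_simps)
  qed
  show ?thesis
    unfolding integrated_solution_def
  proof (intro conjI allI wc IB(1) IIA(1) second)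
    show "continuous_on UNIV (\<lambda>t. B (int0 w t))"
      unfolding IB(2) by (rule continuous_int0[OF locally_integrable_continuous[OF Bc]])
    show "continuous_on UNIV (\<lambda>t. A (int0 (int0 w) t))"
      unfolding IIA(2) by (rule continuous_int0[OF locally_integrable_continuous[OF IAc]])
  qed
qed

lemma \<Gamma>_inject2: "((0, j v), (v, - B (j v))) \<in> \<Gamma>"
  using subspace_0[OF domA_sub] A_scaleR[of 0 0] B_scaleR[of 0 0] subspace_0[OF domB_sub]
  by (simp add: \<Gamma>_iff_block j_zero)

text \<open>The first row of \<open>G (T t (0, j v)) = T t (G (0, j v))\<close>. For initial values
  in Y the cosine part thus is a first component of an orbit.\<close>

lemma cos_part_range_j: "cos_part (j v) t = j (fst (T t (v, - B (j v))))"
  using T_\<Gamma>[OF \<Gamma>_inject2[of v], of t]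
  by (cases "T t (0, j v)", cases "T t (v, - B (j v))") (simp add: \<Gamma>_iff_block cos_part_def)

text \<open>The last assumption isolates what the two kinds of smooth sources have in common: the
  convolution stays in the domain, with continuous image under the generator.\<close>

lemma sol_formula_classical:
  assumes f: "continuous_on UNIV f" and x: "x \<in> domA" and y: "y \<in> range j"
    and cg: "continuous_on UNIV k" "\<And>t. (conv (\<lambda>s. (0, f s)) t, k t) \<in> \<Gamma>"
  shows "sol_formula j B T f x y \<in> C2_fun \<inter> C1_Y j \<inter> C0_dom domA A \<and>
    is_the_unique (classical_solution domA A domB B f x y) (sol_formula j B T f x y)"
proof -
  have fa: "L1_approximable f"
    by (rule L1_approximable_continuous[OF f])
  define F where "F s = (0::'y, f s)" for s
  have Fc: "continuous_on UNIV F"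
    unfolding F_def by (intro continuous_intros f)
  have Fa: "L1_approximable F"
    by (rule L1_approximable_continuous[OF Fc])
  obtain v where v: "x = j v"
    using domA_D(3)[OF x] by auto
  define u where "u = sol_formula j B T f x y"
  define U where "U = mild F (v, y + B x)"
  have uU: "u t = j (fst (U t))" for t
  proof -
    \<comment> \<open>The initial value of the state with components u and u' + B u.\<close>
    have "(v, y + B x) = (v, - B x) + (0, y + 2 *\<^sub>R B x)"
      by (simp add: scaleR_2)
    then have "T t (v, y + B x) = T t (v, - B x) + T t (0, y + 2 *\<^sub>R B x)"
      by (simp only: T_plus_right)
    then show ?thesis
      by (simp add: u_def sol_formula_eq[OF fa] U_def mild_def v cos_part_range_j j_add F_def[abs_def])
  qed
  define p0 where "p0 = (v, y + B x)"
  obtain r where r: "(p0, r) \<in> \<Gamma>"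
  proof -
    have "y + B x \<in> range j"
      by (rule subspace_add[OF range_j y domA_D(4)[OF x]])
    then have "p0 \<in> domG j domA"
      using x by (simp add: domG_def p0_def v)
    then show ?thesis
      by (intro that) (simp add: \<Gamma>_def)
  qed
  define g where "g t = T t r + k t" for t
  have gc: "continuous_on UNIV g"
    unfolding g_def by (intro continuous_intros T_cont cg)
  have Ug: "(U t, g t) \<in> \<Gamma>" for t
    unfolding U_def mild_def g_def p0_def[symmetric]
    by (intro \<Gamma>_add T_\<Gamma>[OF r]) (use cg(2) in \<open>simp add: F_def[abs_def]\<close>)
  have U': "(U has_vector_derivative g t + F t) (at t)" for t
    unfolding U_def by (rule mild_has_vector_derivative[OF Fc gc Ug[unfolded U_def]])
  have Uc: "continuous_on UNIV U"
    unfolding U_def by (rule mild_cont[OF Fa])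
  have p': "((\<lambda>t. fst (U t)) has_vector_derivative fst (g t)) (at t)" for t
    using bounded_linear.has_vector_derivative[OF bounded_linear_fst U', of t] by (simp add: F_def)
  have q': "((\<lambda>t. snd (U t)) has_vector_derivative snd (g t) + f t) (at t)" for t
    using bounded_linear.has_vector_derivative[OF bounded_linear_snd U', of t] by (simp add: F_def)
  have blk: "j (fst (U t)) \<in> domA" "snd (U t) \<in> range j" "j (fst (g t)) = snd (U t) - B (j (fst (U t)))"
    "snd (g t) = A (j (fst (U t))) + B (B (j (fst (U t)))) - B (snd (U t))" for t
    using Ug[of t] by (cases "U t"; cases "g t"; simp add: \<Gamma>_iff_block)+
  have Bg: "B (j (fst (g t))) = B (snd (U t)) - B (B (j (fst (U t))))" for t
    unfolding blk(3) using blk(2)[of t] domA_D(2)[OF blk(1)[of t]] by (intro B_diff) auto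
  have u_eq: "u = (\<lambda>t. j (fst (U t)))"
    by (rule ext, rule uU)
  have u'c: "continuous_on UNIV (\<lambda>t. j (fst (g t)))"
    by (intro bounded_linear.continuous_on[OF j_linear] continuous_intros gc)
  have u'd: "(u has_vector_derivative j (fst (g t))) (at t)" for t
    unfolding u_eq by (rule bounded_linear.has_vector_derivative[OF j_linear p'])
  note u1 = C1_funI[OF u'd u'c]
  have Bgc: "continuous_on UNIV (\<lambda>t. B (j (fst (g t))))"
    by (intro bounded_linear.continuous_on[OF Bj_linear] continuous_intros gc)
  have u''c: "continuous_on UNIV (\<lambda>t. snd (g t) + f t - B (j (fst (g t))))"
    by (intro continuous_intros gc f Bgc)
  \<comment> \<open>The derivative of u is rewritten as
    \<open>snd (U t) - B (j (fst (U t)))\<close>, whose two summands are differentiable in X;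
    \<open>fst (g t)\<close> itself is known only to be continuous in Y.\<close>
  have u''d: "(vderiv u has_vector_derivative snd (g t) + f t - B (j (fst (g t)))) (at t)" for t
    unfolding u1(2) blk(3)[abs_def]
    by (intro has_vector_derivative_diff q') (simp only: blk(3)[symmetric] bounded_linear.has_vector_derivative[OF Bj_linear p'])
  note u2 = C1_funI[OF u''d u''c]
  note u1p = fun_cong[OF u1(2)] and u2p = fun_cong[OF u2(2)]
  have C2: "u \<in> C2_fun"
    using u1(1) u2(1) by (simp add: C2_fun_def)
  have Au: "A (u t) = snd (g t) + B (j (fst (g t)))" for t
    unfolding uU Bg blk(4) by simp
  have Auc: "continuous_on UNIV (\<lambda>t. A (u t))"
    unfolding Au by (intro continuous_intros gc Bgc)
  have uA: "u t \<in> domA" for t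
    unfolding uU by (rule blk(1))
  have "u \<in> C1_Y j"
    unfolding C1_Y_def u_eq
    using C1_funI(1)[OF p' continuous_on_fst[OF gc]] by (auto simp: o_def)
  moreover have "u \<in> C0_dom domA A"
    unfolding C0_dom_def graph_norm_def
  proof (intro CollectI conjI allI uA)
    fix t
    have uc: "continuous_on UNIV u"
      unfolding u_eq by (intro bounded_linear.continuous_on[OF j_linear] continuous_intros Uc)
    have "((\<lambda>s. norm (u s - u t) + norm (A (u s) - A (u t))) \<longlongrightarrow> norm (u t - u t) + norm (A (u t) - A (u t))) (at t)"
      using uc Auc unfolding continuous_on_def by (intro tendsto_intros) auto
    then show "((\<lambda>s. norm (u s - u t) + norm (A (u s - u t))) \<longlongrightarrow> 0) (at t)"
      by (simp add: A_diff[OF uA uA])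
  qed
  moreover have sol: "classical_solution domA A domB B f x y u"
    unfolding classical_solution_def
  proof (intro conjI allI C2 uA)
    show "vderiv u t \<in> domB" for t
      by (simp add: u1p)
    show "(\<lambda>t. A (u t)) \<in> C0_fun"
      by (simp add: C0_fun_def Auc)
    show "vderiv (vderiv u) t + 2 *\<^sub>R B (vderiv u t) - A (u t) = f t" for t
      unfolding u2p unfolding Au u1p by (simp add: scaleR_2)
    have U0: "U 0 = (v, y + B x)"
      unfolding U_def by (rule mild_0[OF Fa])
    show "u 0 = x"
      by (simp add: uU U0 v)
    show "vderiv u 0 = y"
      by (simp add: u1p blk(3) U0 v)
  qed
  moreover have "w = u" if "classical_solution domA A domB B f x y w" for w
    using integrated_solution_unique[OF classical_solution_integrated_solution[OF f x that] classical_solution_integrated_solution[OF f x sol]] .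
  ultimately show ?thesis
    using C2 unfolding u_def is_the_unique_def by blast
qed

lemma sol_formula_classical_C1:
  assumes f: "f \<in> C1_fun" and x: "x \<in> domA" and y: "y \<in> range j"
  shows "sol_formula j B T f x y \<in> C2_fun \<inter> C1_Y j \<inter> C0_dom domA A \<and>
    is_the_unique (classical_solution domA A domB B f x y) (sol_formula j B T f x y)"
proof -
  have fc: "continuous_on UNIV f"
    using f by (simp add: C1_fun_def C1_differentiable_imp_continuous_on)
  have Fd: "((\<lambda>s. (0::'y, f s)) has_vector_derivative (0, vderiv f t)) (at t)" for t
    by (intro has_vector_derivative_Pair has_vector_derivative_const C1_funD(1)[OF f])
  have F'c: "continuous_on UNIV (\<lambda>s. (0::'y, vderiv f s))"
    by (intro continuous_intros C1_funD(2)[OF f])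
  show ?thesis
    by (rule sol_formula_classical[OF fc x y _ conv_in_domain_of_C1[OF F'c Fd]])
      (intro continuous_intros T_cont fc conv_cont L1_approximable_continuous F'c)
qed

lemma sol_formula_classical_Y:
  assumes f: "f \<in> C0_Y j" and x: "x \<in> domA" and y: "y \<in> range j"
  shows "sol_formula j B T f x y \<in> C2_fun \<inter> C1_Y j \<inter> C0_dom domA A \<and>
    is_the_unique (classical_solution domA A domB B f x y) (sol_formula j B T f x y)"
proof -
  obtain g where g: "continuous_on UNIV g" and fg: "f = (\<lambda>s. j (g s))"
    using f by (auto simp: C0_Y_def C0_fun_def o_def)
  have fc: "continuous_on UNIV f"
    unfolding fg by (intro bounded_linear.continuous_on[OF j_linear] g)
  have Gc: "continuous_on UNIV (\<lambda>s. (g s, - B (j (g s))))"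
    by (intro continuous_intros g bounded_linear.continuous_on[OF Bj_linear])
  have "((0, f s), (g s, - B (j (g s)))) \<in> \<Gamma>" for s
    unfolding fg by (rule \<Gamma>_inject2)
  then have "(conv (\<lambda>s. (0, f s)) t, conv (\<lambda>s. (g s, - B (j (g s)))) t) \<in> \<Gamma>" for t
    by (intro conv_in_domain_of_domain_valued L1_approximable_continuous Gc continuous_intros fc)
  then show ?thesis
    by (rule sol_formula_classical[OF fc x y conv_cont[OF L1_approximable_continuous[OF Gc]]])
qed

end

section \<open>Laplace transform mild solutions\<close>

lemma norm_Pair_0 [simp]: "norm (0::'a::real_normed_vector, x::'b::real_normed_vector) = norm x"
  by (simp add: norm_Pair)

lemma C_expI:
  assumes "continuous_on UNIV u" "\<And>t. norm (u t) \<le> K * exp (\<mu> * \<bar>t\<bar>)"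
  shows "u \<in> C_exp \<mu>"
proof -
  have "exp (- \<mu> * \<bar>t\<bar>) * norm (u t) \<le> K" for t
    using assms(2)[of t] by (simp add: exp_minus field_simps)
  then have "bdd_above (range (\<lambda>t. exp (- \<mu> * \<bar>t\<bar>) * norm (u t)))"
    by (intro bdd_aboveI[of _ K]) blast
  with assms(1) show ?thesis
    by (simp add: C_exp_def)
qed

lemma C_expD:
  assumes "u \<in> C_exp \<mu>"
  obtains K where "K \<ge> 0" "continuous_on UNIV u" "\<And>t. norm (u t) \<le> K * exp (\<mu> * \<bar>t\<bar>)"
proof -
  obtain K where K: "\<And>t. exp (- \<mu> * \<bar>t\<bar>) * norm (u t) \<le> K"
    using assms unfolding C_exp_def bdd_above_def by blast
  have "norm (u t) \<le> K * exp (\<mu> * \<bar>t\<bar>)" for t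
    using K[of t] by (simp add: exp_minus field_simps)
  moreover have "K \<ge> 0"
    using K[of 0] order_trans[OF norm_ge_zero[of "u 0"]] by simp
  ultimately show ?thesis
    using that assms by (simp add: C_exp_def)
qed

lemma exp_abs_mono: "\<mu> \<le> \<nu> \<Longrightarrow> exp (\<mu> * \<bar>t\<bar>) \<le> exp (\<nu> * \<bar>t::real\<bar>)"
  by (simp add: mult_right_mono)

lemma exp_decay_tendsto:
  fixes f :: "real \<Rightarrow> 'a::complex_banach"
  assumes le: "\<And>t. norm (f t) \<le> K * exp (\<mu> * \<bar>t\<bar>)" and z: "\<mu> < Re z"
  shows "((\<lambda>t. decay z t *\<^sub>C f t) \<longlongrightarrow> 0) at_top"
    and "((\<lambda>t. decay (- z) t *\<^sub>C f t) \<longlongrightarrow> 0) at_bot"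
proof -
  have lim: "((\<lambda>t. K * exp (- (Re z - \<mu>) * t)) \<longlongrightarrow> 0) at_top"
    by (intro tendsto_mult_right_zero exp_decay_tendsto_0) (use z in simp)
  show "((\<lambda>t. decay z t *\<^sub>C f t) \<longlongrightarrow> 0) at_top"
  proof (rule Lim_null_comparison[OF _ lim])
    show "eventually (\<lambda>t. norm (decay z t *\<^sub>C f t) \<le> K * exp (- (Re z - \<mu>) * t)) at_top"
      using eventually_ge_at_top[of 0] by eventually_elim (rule norm_exp_scaleC_le[OF _ le])
  qed
  have le': "norm (f (- t)) \<le> K * exp (\<mu> * \<bar>t\<bar>)" for t
    using le[of "- t"] by simp
  have "((\<lambda>t. decay z t *\<^sub>C f (- t)) \<longlongrightarrow> 0) at_top"
  proof (rule Lim_null_comparison[OF _ lim])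
    show "eventually (\<lambda>t. norm (decay z t *\<^sub>C f (- t)) \<le> K * exp (- (Re z - \<mu>) * t)) at_top"
      using eventually_ge_at_top[of 0]
      by eventually_elim (rule norm_exp_scaleC_le[OF _ le'])
  qed
  then show "((\<lambda>t. decay (- z) t *\<^sub>C f t) \<longlongrightarrow> 0) at_bot"
    by (simp add: filterlim_at_bot_mirror)
qed

context second_order_problem
begin

section \<open>The quadratic pencil and the spectral equation of the block operator\<close>

lemma Qop_add:
  "v \<in> domA \<Longrightarrow> w \<in> domA \<Longrightarrow> Qop A B z (v + w) = Qop A B z v + Qop A B z w"
  by (simp add: Qop_def A_add B_add domA_D scaleC_add_right)

lemma Qop_scaleC: "v \<in> domA \<Longrightarrow> Qop A B z (c *\<^sub>C v) = c *\<^sub>C Qop A B z v"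
  by (simp add: Qop_def A_scaleC B_scaleC domA_D scaleC_add_right scaleC_simps scaleC_scaleC mult.commute)

lemma domA_scaleC: "v \<in> domA \<Longrightarrow> c *\<^sub>C v \<in> domA"
  by (rule closed_operatorD(2)[OF closed_A])

text \<open>The assumption says \<open>(z - G) (v, w) = (0, y)\<close>.\<close>

lemma \<Gamma>_imp_Qop:
  assumes "((v, w), (z *\<^sub>C v, z *\<^sub>C w - y)) \<in> \<Gamma>"
  shows "j v \<in> domA" "Qop A B z (j v) = y" "w = z *\<^sub>C j v + B (j v)"
proof -
  have 1: "j v \<in> domA" "w \<in> range j" "z *\<^sub>C j v = w - B (j v)"
    "z *\<^sub>C w - y = A (j v) + B (B (j v)) - B w"
    using assms by (simp_all add: \<Gamma>_iff_block j_scaleC)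
  show "j v \<in> domA" by (rule 1(1))
  show w: "w = z *\<^sub>C j v + B (j v)"
    using 1(3) by (simp add: algebra_simps)
  have "B w = z *\<^sub>C B (j v) + B (B (j v))"
    unfolding w by (simp only: B_add[OF closed_operatorD(2)[OF closed_B j_domB] domA_D(2)[OF 1(1)]]
        B_scaleC[OF j_domB])
  moreover have "z *\<^sub>C w = z\<^sup>2 *\<^sub>C j v + z *\<^sub>C B (j v)"
    unfolding w by (simp add: scaleC_add_right scaleC_scaleC power2_eq_square)
  moreover have "(2 * z) *\<^sub>C B (j v) = z *\<^sub>C B (j v) + z *\<^sub>C B (j v)"
    by (simp only: mult_2 scaleC_add_left)
  ultimately show "Qop A B z (j v) = y"
    using 1(4) by (simp add: Qop_def algebra_simps)
qed

lemma Qop_injective: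
  assumes v: "v \<in> domA" and Q: "Qop A B z v = 0" and z: "\<omega> < \<bar>Re z\<bar>"
  shows "v = 0"
proof -
  obtain p where p: "v = j p"
    using domA_D(3)[OF v] by auto
  \<comment> \<open>The first row of the eigenvalue equation dictates this second component.\<close>
  define w where "w = z *\<^sub>C v + B v"
  have zv: "z *\<^sub>C v \<in> range j"
    unfolding p using j_scaleC by (metis rangeI)
  have wj: "w \<in> range j"
    unfolding w_def by (rule subspace_add[OF range_j zv domA_D(4)[OF v]])
  have Bw: "B w = z *\<^sub>C B v + B (B v)"
    unfolding w_def by (simp only: B_add[OF domA_D(1)[OF domA_scaleC[OF v]] domA_D(2)[OF v]]
        B_scaleC[OF domA_D(1)[OF v]])
  have Av: "A v = z\<^sup>2 *\<^sub>C v + (2 * z) *\<^sub>C B v"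
    using Q by (simp add: Qop_def)
  have two: "(2 * z) *\<^sub>C B v = z *\<^sub>C B v + z *\<^sub>C B v"
    by (simp only: mult_2 scaleC_add_left)
  have "((p, w), z *\<^sub>C (p, w)) \<in> \<Gamma>"
    unfolding scaleC_prod_def fst_conv snd_conv \<Gamma>_iff_block
  proof (intro conjI)
    show "z *\<^sub>C w = A (j p) + B (B (j p)) - B w"
      unfolding Bw p[symmetric] Av
      by (simp add: w_def scaleC_add_right scaleC_scaleC power2_eq_square two)
  qed (use v wj in \<open>simp_all add: p j_scaleC w_def\<close>)
  then have "(p, w) = 0"
    by (rule no_eigenvalue[OF _ z])
  then show ?thesis
    by (simp add: p zero_prod_def j_zero)
qed

text \<open>The limits are hypotheses, so that the same argument serves z with \<open>at_top\<close>
  and \<open>- z\<close> with \<open>at_bot\<close>. The transform of the cosine part is z times the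
  first component Pc of a transformed state with \<open>Qop A B z (j Pc) = x\<close>; this is the
  origin of the term \<open>z *\<^sub>C x\<close>.\<close>

lemma sol_formula_laplace:
  assumes f: "L1_approximable f" and nb: "E \<noteq> bot"
    and Us: "((\<lambda>\<tau>. decay z \<tau> *\<^sub>C mild (\<lambda>s. (0, f s)) (0, y + 2 *\<^sub>R B x) \<tau>) \<longlongrightarrow> 0) E"
    and us: "(int0 (\<lambda>t. decay z t *\<^sub>C mild (\<lambda>s. (0, f s)) (0, y + 2 *\<^sub>R B x) t) \<longlongrightarrow> us) E"
    and Uc: "((\<lambda>\<tau>. decay z \<tau> *\<^sub>C mild (\<lambda>s. 0) (0, x) \<tau>) \<longlongrightarrow> 0) E"
    and uc: "(int0 (\<lambda>t. decay z t *\<^sub>C mild (\<lambda>s. 0) (0, x) t) \<longlongrightarrow> uc) E"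
    and ff: "(int0 (\<lambda>t. decay z t *\<^sub>C f t) \<longlongrightarrow> ff) E"
    and u: "(int0 (\<lambda>t. decay z t *\<^sub>C sol_formula j B T f x y t) \<longlongrightarrow> u) E"
  shows "u \<in> domA" "Qop A B z u = z *\<^sub>C x + 2 *\<^sub>R B x + y + ff"
proof -
  note eli = decay_locally_integrable[where z = z]
  have F: "L1_approximable (\<lambda>s. (0::'y, f s))"
    by (rule L1_approximable_inject2[OF f])
  have Z: "L1_approximable (\<lambda>s. 0 :: 'y \<times> 'x)"
    by (intro L1_approximable_continuous continuous_on_const)
  have eF: "int0 (\<lambda>t. decay z t *\<^sub>C (0::'y, f t)) = (\<lambda>\<tau>. (0, int0 (\<lambda>t. decay z t *\<^sub>C f t) \<tau>))"
    using int0_inject2[OF eli[OF f]] by (auto simp: scaleC_prod_def scaleC_simps)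
  have "(int0 (\<lambda>t. decay z t *\<^sub>C (0::'y, f t)) \<longlongrightarrow> (0, ff)) E"
    unfolding eF by (intro tendsto_Pair tendsto_const) (rule ff)
  from laplace_generator[OF F nb Us us this]
  have Gs: "(us, z *\<^sub>C us - (0, y + 2 *\<^sub>R B x) - (0, ff)) \<in> \<Gamma>" .
  have "(int0 (\<lambda>t. decay z t *\<^sub>C (0 :: 'y \<times> 'x)) \<longlongrightarrow> 0) E"
  proof -
    have "int0 (\<lambda>t. 0 :: 'y \<times> 'x) = (\<lambda>_. 0)"
      by (rule ext) (simp add: int0_const)
    then show ?thesis
      by (simp add: scaleC_simps)
  qed
  from laplace_generator[OF Z nb Uc uc this]
  have Gc: "(uc, z *\<^sub>C uc - (0, x)) \<in> \<Gamma>"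
    by simp
  obtain P Qs Pc Qc where e: "us = (P, Qs)" "uc = (Pc, Qc)"
    by (metis prod.exhaust)
  note s = \<Gamma>_imp_Qop[of P Qs z "y + 2 *\<^sub>R B x + ff"]
  have s: "j P \<in> domA" "Qop A B z (j P) = y + 2 *\<^sub>R B x + ff"
    using Gs s by (simp_all add: e scaleC_prod_def algebra_simps)
  have c: "j Pc \<in> domA" "Qop A B z (j Pc) = x" "Qc = z *\<^sub>C j Pc + B (j Pc)"
    using Gc \<Gamma>_imp_Qop[of Pc Qc z x] by (simp_all add: e scaleC_prod_def)
  define S where "S = mild (\<lambda>s. (0, f s)) (0, y + 2 *\<^sub>R B x)"
  define C where "C = mild (\<lambda>s. 0) (0, x)"
  have Sa: "L1_approximable S" and Ca: "L1_approximable C"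
    unfolding S_def C_def by (intro L1_approximable_continuous mild_cont F Z)+
  have C: "C t = T t (0, x)" for t
    by (simp add: C_def mild_def conv_def T_zero_right int0_const)
  \<comment> \<open>Sends a state to the combination that occurs in the cosine part. Boundedness of
    \<open>B \<circ> j\<close> makes it commute with integrals and limits.\<close>
  define H :: "'y \<times> 'x \<Rightarrow> 'x" where "H p = snd p - B (j (fst p))" for p
  have Hl: "bounded_linear H"
    unfolding H_def
    by (intro bounded_linear_sub bounded_linear_snd bounded_linear_compose[OF Bj_linear bounded_linear_fst])
  have "decay z t *\<^sub>C sol_formula j B T f x y t = H (decay z t *\<^sub>C C t) + j (fst (decay z t *\<^sub>C S t))" for t
    by (simp add: sol_formula_eq[OF f] S_def[symmetric] C H_def cos_part_def scaleC_prod_def j_scaleC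
        B_scaleC scaleC_add_right scaleC_simps)
  then have Ieq: "int0 (\<lambda>t. decay z t *\<^sub>C sol_formula j B T f x y t) \<tau>
     = H (int0 (\<lambda>t. decay z t *\<^sub>C C t) \<tau>) + j (fst (int0 (\<lambda>t. decay z t *\<^sub>C S t) \<tau>))" for \<tau>
    using int0_add[OF locally_integrable_linear[OF Hl eli[OF Ca]] locally_integrable_linear[OF j_fst_linear eli[OF Sa]], of \<tau>]
    by (simp add: int0_linear[OF Hl eli[OF Ca]] int0_linear[OF j_fst_linear eli[OF Sa]])
  have "int0 (\<lambda>t. decay z t *\<^sub>C sol_formula j B T f x y t)
     = (\<lambda>\<tau>. H (int0 (\<lambda>t. decay z t *\<^sub>C C t) \<tau>) + j (fst (int0 (\<lambda>t. decay z t *\<^sub>C S t) \<tau>)))"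
    by (rule ext) (rule Ieq)
  moreover have "((\<lambda>\<tau>. H (int0 (\<lambda>t. decay z t *\<^sub>C C t) \<tau>) + j (fst (int0 (\<lambda>t. decay z t *\<^sub>C S t) \<tau>))) \<longlongrightarrow> H uc + j (fst us)) E"
    using uc us unfolding C_def S_def
    by (intro tendsto_add bounded_linear.tendsto[OF Hl] bounded_linear.tendsto[OF j_fst_linear])
  ultimately have "(int0 (\<lambda>t. decay z t *\<^sub>C sol_formula j B T f x y t) \<longlongrightarrow> H uc + j (fst us)) E"
    by simp
  with u have "u = H uc + j (fst us)"
    by (rule tendsto_unique[OF nb])
  then have u: "u = z *\<^sub>C j Pc + j P"
    by (simp add: H_def e c(3))
  show "u \<in> domA"
    unfolding u by (intro subspace_add[OF domA_sub] domA_scaleC c(1) s(1))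
  show "Qop A B z u = z *\<^sub>C x + 2 *\<^sub>R B x + y + ff"
    unfolding u by (simp add: Qop_add domA_scaleC c s Qop_scaleC algebra_simps)
qed

section \<open>Growth bounds and existence\<close>

lemma norm_mild_le:
  assumes F: "L1_approximable F" and K: "\<And>t. norm (F t) \<le> K * exp (\<mu> * \<bar>t\<bar>)" and \<mu>: "\<omega> < \<mu>"
  shows "norm (mild F p t) \<le> (\<bar>M\<bar> * norm p + \<bar>M\<bar> * K / (\<mu> - \<omega>)) * exp (\<mu> * \<bar>t\<bar>)"
proof -
  have "norm (T t p) \<le> M * exp (\<omega> * \<bar>t\<bar>) * norm p"
    by (rule norm_T_le)
  also have "\<dots> \<le> \<bar>M\<bar> * exp (\<mu> * \<bar>t\<bar>) * norm p"
    using \<mu> by (intro mult_right_mono mult_mono exp_abs_mono) auto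
  finally have "norm (T t p) \<le> \<bar>M\<bar> * norm p * exp (\<mu> * \<bar>t\<bar>)"
    by (simp add: mult_ac)
  with norm_conv_le[OF F K \<mu>, of t] show ?thesis
    unfolding mild_def using norm_triangle_ineq[of "T t p" "conv F t"] by (simp add: distrib_right)
qed

lemma M_exp_bound_mono:
  assumes "f \<in> M_exp \<nu>" "\<nu> \<le> \<mu>"
  obtains K where "K \<ge> 0" "\<And>t. norm (f t) \<le> K * exp (\<mu> * \<bar>t\<bar>)"
proof -
  obtain K where K: "K \<ge> 0" "\<And>t. norm (f t) \<le> K * exp (\<nu> * \<bar>t\<bar>)"
    using M_exp_bound[OF assms(1)] by metis
  show ?thesis
    by (rule that[OF K(1)]) (rule order_trans[OF K(2) mult_left_mono[OF exp_abs_mono[OF assms(2)] K(1)]])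
qed

text \<open>An exponent strictly above \<omega> dominates both the orbit and the convolution, so the
  formula lies in the required growth class and all transforms converge.\<close>

lemma LT_mild_solution_sol_formula:
  assumes f: "f \<in> M_exp \<nu>" and \<nu>: "\<nu> \<le> \<mu>" and \<mu>: "\<omega> < \<mu>"
  shows "LT_mild_solution domA A B \<omega> \<mu> f x y (sol_formula j B T f x y)"
proof -
  have fa: "L1_approximable f"
    by (rule L1_loc_approximable[OF M_exp_L1_loc[OF f]])
  obtain K where K: "\<And>t. norm (f t) \<le> K * exp (\<mu> * \<bar>t\<bar>)"
    using M_exp_bound_mono[OF f \<nu>] by metis
  have F: "L1_approximable (\<lambda>s. (0::'y, f s))"
    by (rule L1_approximable_inject2[OF fa])
  have Z: "L1_approximable (\<lambda>s. 0 :: 'y \<times> 'x)"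
    by (intro L1_approximable_continuous continuous_on_const)
  define S where "S = mild (\<lambda>s. (0, f s)) (0, y + 2 *\<^sub>R B x)"
  define C where "C = mild (\<lambda>s. 0) (0, x)"
  obtain k where k: "\<And>t. norm (S t) \<le> k * exp (\<mu> * \<bar>t\<bar>)"
    using norm_mild_le[OF F _ \<mu>] K unfolding S_def by (metis norm_Pair_0)
  obtain l where l: "\<And>t. norm (C t) \<le> l * exp (\<mu> * \<bar>t\<bar>)"
    using norm_mild_le[OF Z, of 0 \<mu>] \<mu> unfolding C_def by (metis norm_zero mult_zero_left order_refl)
  have Sa: "L1_approximable S" and Ca: "L1_approximable C"
    unfolding S_def C_def by (intro L1_approximable_continuous mild_cont F Z)+
  define u where "u = sol_formula j B T f x y"
  have C: "C t = T t (0, x)" for t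
    by (simp add: C_def mild_def conv_def T_zero_right int0_const)
  define H :: "'y \<times> 'x \<Rightarrow> 'x" where "H p = snd p - B (j (fst p))" for p
  have Hl: "bounded_linear H"
    unfolding H_def
    by (intro bounded_linear_sub bounded_linear_snd bounded_linear_compose[OF Bj_linear bounded_linear_fst])
  obtain a where a: "a \<ge> 0" "\<And>p. norm (H p) \<le> norm p * a"
    using bounded_linear.nonneg_bounded[OF Hl] by blast
  obtain b where b: "b \<ge> 0" "\<And>p :: 'y \<times> 'x. norm (j (fst p)) \<le> norm p * b"
    using bounded_linear.nonneg_bounded[OF j_fst_linear] by blast
  have K': "norm (u t) \<le> (l * a + k * b) * exp (\<mu> * \<bar>t\<bar>)" for t
  proof -
    have "u t = H (C t) + j (fst (S t))"
      by (simp add: u_def sol_formula_eq[OF fa] S_def C H_def cos_part_def)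
    then have "norm (u t) \<le> norm (C t) * a + norm (S t) * b"
      using norm_triangle_ineq[of "H (C t)" "j (fst (S t))"] a(2)[of "C t"] b(2)[of "S t"] by simp
    also have "\<dots> \<le> l * exp (\<mu> * \<bar>t\<bar>) * a + k * exp (\<mu> * \<bar>t\<bar>) * b"
      by (intro add_mono mult_right_mono a b k l)
    finally show ?thesis
      by (simp add: algebra_simps)
  qed
  have uc: "continuous_on UNIV u"
    unfolding u_def using integrated_solution_sol_formula[OF fa] by (simp add: integrated_solution_def)
  have ua: "L1_approximable u"
    by (rule L1_approximable_continuous[OF uc])
  have pos: "laplace u z \<in> domA \<and> Qop A B z (laplace u z) = z *\<^sub>C x + 2 *\<^sub>R B x + y + laplace f z"
    if z: "\<mu> < Re z" for z
    using sol_formula_laplace[OF fa trivial_limit_at_top_linorder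
        exp_decay_tendsto(1)[OF k z, unfolded S_def] laplace_tendsto[OF Sa k z, unfolded S_def]
        exp_decay_tendsto(1)[OF l z, unfolded C_def] laplace_tendsto[OF Ca l z, unfolded C_def]
        laplace_tendsto[OF fa K z] laplace_tendsto[OF ua K' z, unfolded u_def]]
    by (simp add: u_def)
  have neg: "laplace (\<lambda>t. u (- t)) z \<in> domA \<and>
      Qop A B (- z) (laplace (\<lambda>t. u (- t)) z) = z *\<^sub>C x - 2 *\<^sub>R B x - y + laplace (\<lambda>t. f (- t)) z"
    if z: "\<mu> < Re z" for z
  proof -
    define v where "v = laplace (\<lambda>t. u (- t)) z"
    \<comment> \<open>On the negative half line every limit is minus a transform, so the equation
      first appears for \<open>- v\<close> and \<open>- z\<close>. Multiplication by -1 restores the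
      stated signs.\<close>
    have m: "- v \<in> domA" "Qop A B (- z) (- v) = (- z) *\<^sub>C x + 2 *\<^sub>R B x + y + - laplace (\<lambda>t. f (- t)) z"
      using sol_formula_laplace[OF fa trivial_limit_at_bot_linorder
        exp_decay_tendsto(2)[OF k z, unfolded S_def] laplace_reflect_tendsto[OF Sa k z, unfolded S_def]
        exp_decay_tendsto(2)[OF l z, unfolded C_def] laplace_reflect_tendsto[OF Ca l z, unfolded C_def]
        laplace_reflect_tendsto[OF fa K z] laplace_reflect_tendsto[OF ua K' z, unfolded u_def]]
      by (simp_all add: u_def v_def)
    have eq: "(- 1) *\<^sub>C (- v) = v"
      by (simp add: scaleC_simps scaleC_one)
    have "v \<in> domA"
      using domA_scaleC[OF m(1), of "- 1"] unfolding eq .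
    moreover have "Qop A B (- z) v = (- 1) *\<^sub>C Qop A B (- z) (- v)"
      using Qop_scaleC[OF m(1), of "- z" "- 1"] unfolding eq .
    ultimately show ?thesis
      unfolding v_def[symmetric] m(2) by (simp add: scaleC_simps scaleC_one)
  qed
  show ?thesis
    unfolding LT_mild_solution_def u_def[symmetric] using pos neg C_expI[OF uc K'] by auto
qed

section \<open>Uniqueness of Laplace transform mild solutions\<close>

lemma laplace_diff:
  fixes u w :: "real \<Rightarrow> 'c::complex_banach"
  assumes "continuous_on UNIV u" "\<And>t. norm (u t) \<le> K * exp (\<mu> * \<bar>t\<bar>)"
    and "continuous_on UNIV w" "\<And>t. norm (w t) \<le> K' * exp (\<mu> * \<bar>t\<bar>)" and z: "\<mu> < Re z"
  shows "laplace (\<lambda>t. u t - w t) z = laplace u z - laplace w z"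
proof -
  have d: "norm (u t - w t) \<le> (K + K') * exp (\<mu> * \<bar>t\<bar>)" for t
    using norm_triangle_ineq4[of "u t" "w t"] assms(2,4)[of t] by (simp add: distrib_right)
  note li = decay_locally_integrable[OF L1_approximable_continuous, where z = z]
  have "int0 (\<lambda>t. decay z t *\<^sub>C (u t - w t)) = (\<lambda>\<tau>. int0 (\<lambda>t. decay z t *\<^sub>C u t) \<tau> - int0 (\<lambda>t. decay z t *\<^sub>C w t) \<tau>)"
    unfolding scaleC_simps by (rule ext, rule int0_diff[OF li[OF assms(1)] li[OF assms(3)]])
  moreover have "((\<lambda>\<tau>. int0 (\<lambda>t. decay z t *\<^sub>C u t) \<tau> - int0 (\<lambda>t. decay z t *\<^sub>C w t) \<tau>) \<longlongrightarrow> laplace u z - laplace w z) at_top"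
    by (intro tendsto_diff laplace_tendsto[OF _ assms(2) z] laplace_tendsto[OF _ assms(4) z]
        L1_approximable_continuous assms)
  moreover have "(int0 (\<lambda>t. decay z t *\<^sub>C (u t - w t)) \<longlongrightarrow> laplace (\<lambda>t. u t - w t) z) at_top"
    by (rule laplace_tendsto[OF _ d z]) (intro L1_approximable_continuous continuous_intros assms)
  ultimately show ?thesis
    using tendsto_unique[OF trivial_limit_at_top_linorder] by fastforce
qed

lemma LT_mild_solution_unique:
  assumes u: "LT_mild_solution domA A B \<omega> \<mu> f x y u" and w: "LT_mild_solution domA A B \<omega> \<mu> f x y w"
  shows "u = w"
proof -
  obtain K where K: "K \<ge> 0" "continuous_on UNIV u" "\<And>t. norm (u t) \<le> K * exp (\<mu> * \<bar>t\<bar>)"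
    using C_expD u unfolding LT_mild_solution_def by metis
  obtain K' where K': "K' \<ge> 0" "continuous_on UNIV w" "\<And>t. norm (w t) \<le> K' * exp (\<mu> * \<bar>t\<bar>)"
    using C_expD w unfolding LT_mild_solution_def by metis
  have diff0: "a = b" if "a \<in> domA" "b \<in> domA" "Qop A B z a = Qop A B z b" "\<omega> < \<bar>Re z\<bar>" for a b z
  proof -
    have "Qop A B z (a + (- 1) *\<^sub>C b) = 0"
      using that domA_scaleC[OF that(2), of "- 1"]
      by (simp only: Qop_add Qop_scaleC) (simp add: scaleC_simps scaleC_one)
    from Qop_injective[OF subspace_add[OF domA_sub that(1) domA_scaleC[OF that(2)]] this that(4)]
    show ?thesis by (simp add: scaleC_simps scaleC_one)
  qed
  have zero: "u' t = w' t"
    if c: "continuous_on UNIV u'" "\<And>t. norm (u' t) \<le> K * exp (\<mu> * \<bar>t\<bar>)"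
      "continuous_on UNIV w'" "\<And>t. norm (w' t) \<le> K' * exp (\<mu> * \<bar>t\<bar>)"
      and L: "\<And>z. max \<mu> \<omega> < Re z \<Longrightarrow> laplace u' z = laplace w' z" and t: "t \<ge> 0"
    for u' w' :: "real \<Rightarrow> 'x" and t
  proof -
    have "u' t - w' t = 0"
    proof (rule laplace_eq_0_imp[where K = "K + K'" and \<mu> = \<mu> and \<sigma> = "max \<mu> \<omega>" and d = "\<lambda>t. u' t - w' t"])
      show "continuous_on UNIV (\<lambda>t. u' t - w' t)"
        by (intro continuous_intros c)
      show "norm (u' t - w' t) \<le> (K + K') * exp (\<mu> * t)" if "t \<ge> 0" for t
        using norm_triangle_ineq4[of "u' t" "w' t"] c(2,4)[of t] that by (simp add: distrib_right)
      show "laplace (\<lambda>t. u' t - w' t) (complex_of_real z) = 0" if "z > max \<mu> \<omega>" for z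
        using laplace_diff[OF c, of "complex_of_real z"] L[of "complex_of_real z"] that by simp
    qed (use K(1) K'(1) t in auto)
    then show ?thesis by simp
  qed
  have p: "laplace u z = laplace w z" if "max \<mu> \<omega> < Re z" for z
    by (rule diff0[of _ _ z]) (use u w that in \<open>auto simp: LT_mild_solution_def\<close>)
  \<comment> \<open>The reflected functions meet the pencil at \<open>- z\<close>; its injectivity
    depends only on |Re z|. Equality of both kinds of transforms determines the functions on both
    half lines.\<close>
  have n: "laplace (\<lambda>t. u (- t)) z = laplace (\<lambda>t. w (- t)) z" if "max \<mu> \<omega> < Re z" for z
    by (rule diff0[of _ _ "- z"]) (use u w that in \<open>auto simp: LT_mild_solution_def\<close>)
  have r: "continuous_on UNIV (\<lambda>t. g (- t))" if "continuous_on UNIV g" for g :: "real \<Rightarrow> 'x"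
    by (rule continuous_on_compose2[OF that]) (auto intro!: continuous_intros)
  have "u t = w t" for t
  proof (cases "t \<ge> 0")
    case True
    then show ?thesis
      using zero[OF K(2,3) K'(2,3) p] by blast
  next
    case False
    have "norm (u (- t)) \<le> K * exp (\<mu> * \<bar>t\<bar>)" "norm (w (- t)) \<le> K' * exp (\<mu> * \<bar>t\<bar>)" for t
      using K(3)[of "- t"] K'(3)[of "- t"] by simp_all
    from zero[OF r[OF K(2)] this(1) r[OF K'(2)] this(2) n, of "- t"] False
    show ?thesis by simp
  qed
  then show ?thesis by auto
qed

text \<open>A larger exponent weakens the growth condition and shrinks the half plane of test
  points. Uniqueness for \<nu> \<le> \<omega>, where the formula may grow too fast to be a
  competitor, is obtained by comparing in a larger class.\<close>

lemma LT_mild_solution_mono: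
  assumes w: "LT_mild_solution domA A B \<omega> \<nu> f x y w" and \<nu>: "\<nu> \<le> \<mu>"
  shows "LT_mild_solution domA A B \<omega> \<mu> f x y w"
proof -
  obtain K where K: "K \<ge> 0" "continuous_on UNIV w" "\<And>t. norm (w t) \<le> K * exp (\<nu> * \<bar>t\<bar>)"
    using C_expD w unfolding LT_mild_solution_def by metis
  have "norm (w t) \<le> K * exp (\<mu> * \<bar>t\<bar>)" for t
    by (rule order_trans[OF K(3) mult_left_mono[OF exp_abs_mono[OF \<nu>] K(1)]])
  from C_expI[OF K(2) this] w show ?thesis
    using \<nu> unfolding LT_mild_solution_def by (simp add: max_def split: if_splits)
qed

end

theorem theorem5p5:
  fixes j :: "'y::complex_banach \<Rightarrow> 'x::complex_banach"
    and domA domB :: "'x set" and A B :: "'x \<Rightarrow> 'x"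
    and T :: "real \<Rightarrow> 'y \<times> 'x \<Rightarrow> 'y \<times> 'x"
    and M \<omega> :: real
  assumes "closed_operator domA A"
    and "closed_operator domB B"
    and "resolvent_set domB B \<noteq> {}"
    and "continuous_embedding j"
    and "domA \<subseteq> dom_square domB B \<inter> range j"
    and "B ` domA \<subseteq> range j"
    and "range j \<subseteq> domB"
    and "generates_C0_group (domG j domA) (opG j A B) T"
    and "\<And>t. onorm (T t) \<le> M * exp (\<omega> * \<bar>t\<bar>)"
  shows
    "(\<forall>x\<in>domA. \<forall>y\<in>range j. \<forall>f\<in>C1_fun.
        sol_formula j B T f x y \<in> C2_fun \<inter> C1_Y j \<inter> C0_dom domA A \<and>
        is_the_unique (classical_solution domA A domB B f x y) (sol_formula j B T f x y)) \<and>
     (\<forall>x\<in>domA. \<forall>y\<in>range j. \<forall>f\<in>C0_Y j.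
        sol_formula j B T f x y \<in> C2_fun \<inter> C1_Y j \<inter> C0_dom domA A \<and>
        is_the_unique (classical_solution domA A domB B f x y) (sol_formula j B T f x y)) \<and>
     (\<forall>x\<in>domB. \<forall>y. \<forall>\<nu>. \<forall>f\<in>M_exp \<nu>.
        (\<forall>\<mu>\<ge>\<nu>. \<omega> < \<mu> \<longrightarrow>
           is_the_unique (LT_mild_solution domA A B \<omega> \<mu> f x y) (sol_formula j B T f x y)) \<and>
        (\<forall>w. LT_mild_solution domA A B \<omega> \<nu> f x y w \<longrightarrow> w = sol_formula j B T f x y)) \<and>
     (\<forall>x\<in>domB. \<forall>y. \<forall>f\<in>L1_loc.
        is_the_unique (integral_mild_solution domA A domB B f x y) (sol_formula j B T f x y))"
proof -
  interpret second_order_problem j domA domB A B T M \<omega>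
    by unfold_locales (fact assms)+
  have LT: "is_the_unique (LT_mild_solution domA A B \<omega> \<mu> f x y) (sol_formula j B T f x y)"
    if "f \<in> M_exp \<nu>" "\<nu> \<le> \<mu>" "\<omega> < \<mu>" for f \<nu> \<mu> x y
    unfolding is_the_unique_def
    using LT_mild_solution_sol_formula[OF that] LT_mild_solution_unique by blast
  have LT': "w = sol_formula j B T f x y"
    if f: "f \<in> M_exp \<nu>" and w: "LT_mild_solution domA A B \<omega> \<nu> f x y w" for f \<nu> x y w
  proof -
    \<comment> \<open>An exponent for which the formula is known to be a solution and to which
      \<open>w\<close> can be moved.\<close>
    define \<mu> where "\<mu> = max \<nu> \<omega> + 1"
    have "\<nu> \<le> \<mu>" "\<omega> < \<mu>"
      by (auto simp: \<mu>_def)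
    then show ?thesis
      using LT[OF f, of \<mu> x y] LT_mild_solution_mono[OF w] unfolding is_the_unique_def by blast
  qed
  show ?thesis
    by (intro conjI ballI allI impI)
      ((rule sol_formula_classical_C1[THEN conjunct1] sol_formula_classical_C1[THEN conjunct2]
          sol_formula_classical_Y[THEN conjunct1] sol_formula_classical_Y[THEN conjunct2]
          LT LT' integral_mild_solution_sol_formula; assumption)+)
qed

end
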